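(* Let $H$ be a braided Hopf algebra in a braided tensor category $(\mathcal C,\otimes,I,C)$ with $C_{H,H}=C_{H,H}^{-1}$, let $H^d$ be a faithful quasi-dual of $H$ and let $H^{d'}\subseteq H^d$ be a strict quasi-dual of $H$, with associated morphisms $\rightharpoonup:H\otimes H^d\to H^d$ and $\rho:H^{d'}\to H^{d'}\otimes H$. Put $\leftharpoondown\;=\;\rightharpoonup(S\otimes H^{d'})\,C_{H^{d'},H}:H^{d'}\otimes H\to H^{d'}$. Then $(H^{d'},\leftharpoondown,\rho)$ is a (right) $H$-Hopf module in $\mathcal C$.
   Context: $(\mathcal C,\otimes,I,C)$ is a braided tensor category, regarded as strict, with unit object $I$ and braiding $C_{U,V}:U\otimes V\to V\otimes U$. An object's name also denotes its identity morphism. A braided Hopf algebra in $\mathcal C$ is a Hopf algebra object $(H,m,\eta,\Delta,\epsilon,S)$ in $\mathcal C$ (with $\Delta$ multiplicative for the braided tensor product algebra structure on $H\otimes H$). Faithful quasi-dual: an algebra $N$ in $\mathcal C$ together with a morphism $\langle\,,\rangle:N\otimes H\to I$ is a left quasi-dual of $H$ if $\langle\,,\rangle(m_N\otimes H)=(\langle\,,\rangle\otimes\langle\,,\rangle)(N\otimes C_{N,H}\otimes H)(N\otimes N\otimes\Delta)$ and $\langle\,,\rangle(\eta_N\otimes H)=\epsilon$. It is a faithful quasi-dual, written $H^d$, if moreover for all objects $U,V$ and all morphisms $f,f':U\to V\otimes N$, $g,g':U\to H\otimes V$ in $\mathcal C$: $(V\otimes\langle\,,\rangle)(f\otimes H)=(V\otimes\langle\,,\rangle)(f'\otimes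 H)$ implies $f=f'$, and $(\langle\,,\rangle\otimes V)(N\otimes g)=(\langle\,,\rangle\otimes V)(N\otimes g')$ implies $g=g'$. Strict quasi-dual: given a faithful quasi-dual $H^d$, a left ideal $H^{d'}$ of $H^d$ (a subobject such that $m$ restricts to $H^d\otimes H^{d'}\to H^{d'}$) is a strict quasi-dual of $H$ if there are morphisms $\rightharpoonup:H\otimes H^d\to H^d$ and $\rho:H^{d'}\to H^{d'}\otimes H$ in $\mathcal C$ such that $\langle\,,\rangle(\rightharpoonup\otimes H)=\langle\,,\rangle(H^d\otimes m)(H^d\otimes C_{H,H})(C_{H,H^d}\otimes H)$, $(H^{d'}\otimes\langle\,,\rangle)(C_{H^d,H^{d'}}\otimes H)(H^d\otimes\rho)=m$ on $H^d\otimes H^{d'}$, and $\rightharpoonup$ restricts to a morphism $H\otimes H^{d'}\to H^{d'}$. A (right) $H$-Hopf module in $\mathcal C$ is an object $M$ with a right $H$-module structure $\alpha:M\otimes H\to M$ and a right $H$-comodule structure $\rho:M\to M\otimes H$ such that $\rho\,\alpha=(\alpha\otimes m)(M\otimes C_{H,H}\otimes H)(\rho\otimes\Delta)$. *)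

theory Defs
  imports Main
begin

section \<open>Strict braided tensor categories\<close>

text \<open>
  \<open>\<one> U\<close> is the identity of the object \<open>U\<close>, \<open>\<boxtimes>\<close> is the tensor product of objects, \<open>\<otimes>\<close> that of
  arrows, and \<open>\<sigma> U V : U \<boxtimes> V \<rightarrow> V \<boxtimes> U\<close> is the braiding. The operations are unconstrained
  outside \<open>Obj\<close> and on non-composable arrows.
\<close>

record ('o, 'a) category =
  Obj :: "'o set"
  Arr :: "'a set"
  src :: "'a \<Rightarrow> 'o"
  tgt :: "'a \<Rightarrow> 'o"
  ident :: "'o \<Rightarrow> 'a"  (\<open>\<one>\<index> _\<close> [1000] 999)
  comp :: "'a \<Rightarrow> 'a \<Rightarrow> 'a"  (infixr \<open>\<cdot>\<index>\<close> 55)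

record ('o, 'a) monoidal_category = "('o, 'a) category" +
  tensor_unit :: 'o  (\<open>\<I>\<index>\<close>)
  tensor_obj :: "'o \<Rightarrow> 'o \<Rightarrow> 'o"  (infixl \<open>\<boxtimes>\<index>\<close> 70)
  tensor_arr :: "'a \<Rightarrow> 'a \<Rightarrow> 'a"  (infixl \<open>\<otimes>\<index>\<close> 70)

record ('o, 'a) braided_category = "('o, 'a) monoidal_category" +
  braiding :: "'o \<Rightarrow> 'o \<Rightarrow> 'a"  (\<open>\<sigma>\<index>\<close>)

definition hom :: "('o, 'a, 'x) category_scheme \<Rightarrow> 'o \<Rightarrow> 'o \<Rightarrow> 'a set" where
  "hom C U V = {f \<in> Arr C. src C f = U \<and> tgt C f = V}"

definition inverse_arrows :: "('o, 'a, 'x) category_scheme \<Rightarrow> 'a \<Rightarrow> 'a \<Rightarrow> bool" where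
  "inverse_arrows C f g \<longleftrightarrow>
     f \<in> Arr C \<and> g \<in> hom C (tgt C f) (src C f) \<and>
     g \<cdot>\<^bsub>C\<^esub> f = \<one>\<^bsub>C\<^esub> (src C f) \<and> f \<cdot>\<^bsub>C\<^esub> g = \<one>\<^bsub>C\<^esub> (tgt C f)"

definition monic :: "('o, 'a, 'x) category_scheme \<Rightarrow> 'a \<Rightarrow> bool" where
  "monic C i \<longleftrightarrow> i \<in> Arr C \<and>
     (\<forall>U \<in> Obj C. \<forall>f \<in> hom C U (src C i). \<forall>g \<in> hom C U (src C i).
        i \<cdot>\<^bsub>C\<^esub> f = i \<cdot>\<^bsub>C\<^esub> g \<longrightarrow> f = g)"

locale category =
  fixes C :: "('o, 'a, 'x) category_scheme" (structure)
  assumes src_obj: "f \<in> Arr C \<Longrightarrow> src C f \<in> Obj C"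
    and tgt_obj: "f \<in> Arr C \<Longrightarrow> tgt C f \<in> Obj C"
    and ident_hom: "U \<in> Obj C \<Longrightarrow> \<one> U \<in> hom C U U"
    and comp_hom: "\<lbrakk>f \<in> hom C U V; g \<in> hom C V W\<rbrakk> \<Longrightarrow> g \<cdot> f \<in> hom C U W"
    and comp_assoc: "\<lbrakk>f \<in> hom C U V; g \<in> hom C V W; h \<in> hom C W X\<rbrakk>
          \<Longrightarrow> (h \<cdot> g) \<cdot> f = h \<cdot> (g \<cdot> f)"
    and comp_ident: "f \<in> hom C U V \<Longrightarrow> f \<cdot> \<one> U = f"
    and ident_comp: "f \<in> hom C U V \<Longrightarrow> \<one> V \<cdot> f = f"

locale strict_monoidal_category = category C
  for C :: "('o, 'a, 'x) monoidal_category_scheme" (structure) +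
  assumes unit_obj: "\<I> \<in> Obj C"
    and tensor_obj: "\<lbrakk>U \<in> Obj C; V \<in> Obj C\<rbrakk> \<Longrightarrow> U \<boxtimes> V \<in> Obj C"
    and tensor_hom: "\<lbrakk>f \<in> hom C U V; g \<in> hom C U' V'\<rbrakk>
          \<Longrightarrow> f \<otimes> g \<in> hom C (U \<boxtimes> U') (V \<boxtimes> V')"
    and tensor_ident: "\<lbrakk>U \<in> Obj C; V \<in> Obj C\<rbrakk> \<Longrightarrow> \<one> U \<otimes> \<one> V = \<one> (U \<boxtimes> V)"
    and interchange: "\<lbrakk>f \<in> hom C U V; g \<in> hom C V W; f' \<in> hom C U' V'; g' \<in> hom C V' W'\<rbrakk>
          \<Longrightarrow> (g \<cdot> f) \<otimes> (g' \<cdot> f') = (g \<otimes> g') \<cdot> (f \<otimes> f')"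
    and assoc_obj: "\<lbrakk>U \<in> Obj C; V \<in> Obj C; W \<in> Obj C\<rbrakk>
          \<Longrightarrow> (U \<boxtimes> V) \<boxtimes> W = U \<boxtimes> (V \<boxtimes> W)"
    and unit_left_obj: "U \<in> Obj C \<Longrightarrow> \<I> \<boxtimes> U = U"
    and unit_right_obj: "U \<in> Obj C \<Longrightarrow> U \<boxtimes> \<I> = U"
    and assoc_arr: "\<lbrakk>f \<in> Arr C; g \<in> Arr C; h \<in> Arr C\<rbrakk>
          \<Longrightarrow> (f \<otimes> g) \<otimes> h = f \<otimes> (g \<otimes> h)"
    and unit_left_arr: "f \<in> Arr C \<Longrightarrow> \<one> \<I> \<otimes> f = f"
    and unit_right_arr: "f \<in> Arr C \<Longrightarrow> f \<otimes> \<one> \<I> = f"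

locale strict_braided_category = strict_monoidal_category C
  for C :: "('o, 'a, 'x) braided_category_scheme" (structure) +
  assumes braiding_hom: "\<lbrakk>U \<in> Obj C; V \<in> Obj C\<rbrakk> \<Longrightarrow> \<sigma> U V \<in> hom C (U \<boxtimes> V) (V \<boxtimes> U)"
    and braiding_iso: "\<lbrakk>U \<in> Obj C; V \<in> Obj C\<rbrakk> \<Longrightarrow> \<exists>g. inverse_arrows C (\<sigma> U V) g"
    and braiding_natural: "\<lbrakk>f \<in> hom C U U'; g \<in> hom C V V'\<rbrakk>
          \<Longrightarrow> \<sigma> U' V' \<cdot> (f \<otimes> g) = (g \<otimes> f) \<cdot> \<sigma> U V"
    and hexagon_left: "\<lbrakk>U \<in> Obj C; V \<in> Obj C; W \<in> Obj C\<rbrakk>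
          \<Longrightarrow> \<sigma> (U \<boxtimes> V) W = (\<sigma> U W \<otimes> \<one> V) \<cdot> (\<one> U \<otimes> \<sigma> V W)"
    and hexagon_right: "\<lbrakk>U \<in> Obj C; V \<in> Obj C; W \<in> Obj C\<rbrakk>
          \<Longrightarrow> \<sigma> U (V \<boxtimes> W) = (\<one> V \<otimes> \<sigma> U W) \<cdot> (\<sigma> U V \<otimes> \<one> W)"

section \<open>Braided Hopf algebras and Hopf modules\<close>

locale algebra_object = strict_monoidal_category C
  for C :: "('o, 'a, 'x) monoidal_category_scheme" (structure) +
  fixes A m \<eta>
  assumes A_obj: "A \<in> Obj C"
    and m_hom: "m \<in> hom C (A \<boxtimes> A) A"
    and \<eta>_hom: "\<eta> \<in> hom C \<I> A"
    and m_assoc: "m \<cdot> (m \<otimes> \<one> A) = m \<cdot> (\<one> A \<otimes> m)"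
    and unit_left: "m \<cdot> (\<eta> \<otimes> \<one> A) = \<one> A"
    and unit_right: "m \<cdot> (\<one> A \<otimes> \<eta>) = \<one> A"

locale coalgebra_object = strict_monoidal_category C
  for C :: "('o, 'a, 'x) monoidal_category_scheme" (structure) +
  fixes A \<Delta> \<epsilon>
  assumes coalg_obj: "A \<in> Obj C"
    and \<Delta>_hom: "\<Delta> \<in> hom C A (A \<boxtimes> A)"
    and \<epsilon>_hom: "\<epsilon> \<in> hom C A \<I>"
    and coassoc: "(\<Delta> \<otimes> \<one> A) \<cdot> \<Delta> = (\<one> A \<otimes> \<Delta>) \<cdot> \<Delta>"
    and counit_left: "(\<epsilon> \<otimes> \<one> A) \<cdot> \<Delta> = \<one> A"
    and counit_right: "(\<one> A \<otimes> \<epsilon>) \<cdot> \<Delta> = \<one> A"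

locale braided_hopf_algebra = strict_braided_category C +
  algebra_object C H m \<eta> + coalgebra_object C H \<Delta> \<epsilon>
  for C :: "('o, 'a, 'x) braided_category_scheme" (structure) and H m \<eta> \<Delta> \<epsilon> +
  fixes S
  assumes \<Delta>_mult: "\<Delta> \<cdot> m = (m \<otimes> m) \<cdot> (\<one> H \<otimes> \<sigma> H H \<otimes> \<one> H) \<cdot> (\<Delta> \<otimes> \<Delta>)"
    and \<Delta>_unit: "\<Delta> \<cdot> \<eta> = \<eta> \<otimes> \<eta>"
    and \<epsilon>_mult: "\<epsilon> \<cdot> m = \<epsilon> \<otimes> \<epsilon>"
    and \<epsilon>_unit: "\<epsilon> \<cdot> \<eta> = \<one> \<I>"
    and S_hom: "S \<in> hom C H H"
    and antipode_left: "m \<cdot> (S \<otimes> \<one> H) \<cdot> \<Delta> = \<eta> \<cdot> \<epsilon>"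
    and antipode_right: "m \<cdot> (\<one> H \<otimes> S) \<cdot> \<Delta> = \<eta> \<cdot> \<epsilon>"

locale right_module = algebra_object C A m \<eta>
  for C :: "('o, 'a, 'x) monoidal_category_scheme" (structure) and A m \<eta> +
  fixes M \<alpha>
  assumes module_obj: "M \<in> Obj C"
    and action_hom: "\<alpha> \<in> hom C (M \<boxtimes> A) M"
    and action_assoc: "\<alpha> \<cdot> (\<alpha> \<otimes> \<one> A) = \<alpha> \<cdot> (\<one> M \<otimes> m)"
    and action_unit: "\<alpha> \<cdot> (\<one> M \<otimes> \<eta>) = \<one> M"

locale right_comodule = coalgebra_object C A \<Delta> \<epsilon>
  for C :: "('o, 'a, 'x) monoidal_category_scheme" (structure) and A \<Delta> \<epsilon> +
  fixes M \<rho>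
  assumes comodule_obj: "M \<in> Obj C"
    and coaction_hom: "\<rho> \<in> hom C M (M \<boxtimes> A)"
    and coaction_coassoc: "(\<rho> \<otimes> \<one> A) \<cdot> \<rho> = (\<one> M \<otimes> \<Delta>) \<cdot> \<rho>"
    and coaction_counit: "(\<one> M \<otimes> \<epsilon>) \<cdot> \<rho> = \<one> M"

locale hopf_module = braided_hopf_algebra C H m \<eta> \<Delta> \<epsilon> S +
  right_module C H m \<eta> M \<alpha> + right_comodule C H \<Delta> \<epsilon> M \<rho>
  for C :: "('o, 'a, 'x) braided_category_scheme" (structure)
    and H m \<eta> \<Delta> \<epsilon> S M \<alpha> \<rho> +
  assumes hopf_compat: "\<rho> \<cdot> \<alpha> = (\<alpha> \<otimes> m) \<cdot> (\<one> M \<otimes> \<sigma> H H \<otimes> \<one> H) \<cdot> (\<rho> \<otimes> \<Delta>)"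

section \<open>Quasi-duals\<close>

text \<open>
  \<open>N\<close> stands for \<open>H\<^sup>d\<close> with product \<open>mN\<close> and unit \<open>\<eta>N\<close>, \<open>p\<close> for the pairing, and
  further below, \<open>N'\<close> for the left ideal of \<open>H\<^sup>d\<close> and \<open>act\<close> for \<open>\<rightharpoonup>\<close>.
\<close>

locale left_quasi_dual = braided_hopf_algebra C H m \<eta> \<Delta> \<epsilon> S + N: algebra_object C N mN \<eta>N
  for C :: "('o, 'a, 'x) braided_category_scheme" (structure)
    and H m \<eta> \<Delta> \<epsilon> S N mN \<eta>N +
  fixes p
  assumes pairing_hom: "p \<in> hom C (N \<boxtimes> H) \<I>"
    and pairing_mult: "p \<cdot> (mN \<otimes> \<one> H)
          = (p \<otimes> p) \<cdot> (\<one> N \<otimes> \<sigma> N H \<otimes> \<one> H) \<cdot> (\<one> N \<otimes> \<one> N \<otimes> \<Delta>)"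
    and pairing_unit: "p \<cdot> (\<eta>N \<otimes> \<one> H) = \<epsilon>"

locale faithful_quasi_dual = left_quasi_dual +
  assumes faithful_left: "\<lbrakk>U \<in> Obj C; V \<in> Obj C; f \<in> hom C U (V \<boxtimes> N); f' \<in> hom C U (V \<boxtimes> N);
          (\<one> V \<otimes> p) \<cdot> (f \<otimes> \<one> H) = (\<one> V \<otimes> p) \<cdot> (f' \<otimes> \<one> H)\<rbrakk> \<Longrightarrow> f = f'"
    and faithful_right: "\<lbrakk>U \<in> Obj C; V \<in> Obj C; g \<in> hom C U (H \<boxtimes> V); g' \<in> hom C U (H \<boxtimes> V);
          (p \<otimes> \<one> V) \<cdot> (\<one> N \<otimes> g) = (p \<otimes> \<one> V) \<cdot> (\<one> N \<otimes> g')\<rbrakk> \<Longrightarrow> g = g'"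

text \<open>
  A subobject is given by a monomorphism \<open>i\<close>. A morphism restricts to the subobject when it
  factors through \<open>i\<close>; the factorization (here \<open>m'\<close>, and \<open>act'\<close> below) is unique since \<open>i\<close>
  is monic, so carrying it as a parameter adds no data.
\<close>

locale left_ideal = algebra_object C A m \<eta>
  for C :: "('o, 'a, 'x) monoidal_category_scheme" (structure) and A m \<eta> +
  fixes A' i m'
  assumes ideal_obj: "A' \<in> Obj C"
    and incl_hom: "i \<in> hom C A' A"
    and incl_monic: "monic C i"
    and ideal_mult_hom: "m' \<in> hom C (A \<boxtimes> A') A'"
    and ideal_mult: "i \<cdot> m' = m \<cdot> (\<one> A \<otimes> i)"

locale strict_quasi_dual = faithful_quasi_dual C H m \<eta> \<Delta> \<epsilon> S N mN \<eta>N p +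
  N: left_ideal C N mN \<eta>N N' i m'
  for C :: "('o, 'a, 'x) braided_category_scheme" (structure)
    and H m \<eta> \<Delta> \<epsilon> S N mN \<eta>N p N' i m' +
  fixes act act' \<rho>
  assumes act_hom: "act \<in> hom C (H \<boxtimes> N) N"
    and act_pairing: "p \<cdot> (act \<otimes> \<one> H)
          = p \<cdot> (\<one> N \<otimes> m) \<cdot> (\<one> N \<otimes> \<sigma> H H) \<cdot> (\<sigma> H N \<otimes> \<one> H)"
    and act'_hom: "act' \<in> hom C (H \<boxtimes> N') N'"
    and act'_restricts: "i \<cdot> act' = act \<cdot> (\<one> H \<otimes> i)"
    and \<rho>_hom: "\<rho> \<in> hom C N' (N' \<boxtimes> H)"
    and \<rho>_pairing: "(\<one> N' \<otimes> p) \<cdot> (\<sigma> N N' \<otimes> \<one> H) \<cdot> (\<one> N \<otimes> \<rho>) = m'"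

end

theory Submission imports Defs "HOL-Library.Multiset" begin

text \<open>
  A morphism into \<open>V \<boxtimes> N\<close> is determined by its pairing with \<open>H\<close>, and a morphism into
  \<open>V \<boxtimes> H\<close> by its pairing with \<open>N\<close>. Since the pairing slides through braidings, symmetry of
  \<open>\<sigma> H H\<close> forces all braidings between \<open>H\<close> and \<open>N\<close> to be symmetric, so that Sweedler-style
  computations with \<open>H\<close> and \<open>N\<close> are legitimate. In Sweedler notation \<open>\<rightharpoonup>\<close> is the action
  \<open>\<langle>h \<rightharpoonup> x, k\<rangle> = \<langle>x, k h\<rangle>\<close>; it satisfies \<open>h \<rightharpoonup> x y = (h\<^sub>1 \<rightharpoonup> x) (h\<^sub>2 \<rightharpoonup> y)\<close>, and evaluating
  \<open>S h\<^sub>1 \<rightharpoonup> (h\<^sub>2 \<rightharpoonup> y (S h\<^sub>3 \<rightharpoonup> x))\<close> in two ways gives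
  \<open>y (S h \<rightharpoonup> x) = S h\<^sub>1 \<rightharpoonup> ((h\<^sub>2 \<rightharpoonup> y) x)\<close>. Paired with \<open>y\<close>, the coaction of \<open>x\<close> is \<open>y x\<close>, so
  this is the Hopf module condition; coassociativity of \<open>\<rho>\<close> is associativity of the product.

  The braidings with the ideal \<open>N'\<close> need not be symmetric, so identities involving \<open>N'\<close> are
  first composed with the inclusion \<open>i\<close>.
\<close>

section \<open>Arrows in strict braided categories\<close>

text \<open>That Sweedler notation is legitimate is itself a coherence statement: when all braidings
  among \<open>H\<close> and \<open>N\<close> are symmetric, an arrow built from boxes and braidings
  depends only on which output is joined to which input. This is proved once for lists of named
  wires. Afterwards a computation is a sequence of rewritings of lists of boxes, in which braidings
  leave no trace.

  The expression evaluated in two ways contains both \<open>S h\<^sub>1\<close> next to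
  \<open>h\<^sub>2\<close> and \<open>h\<^sub>2\<close> next to \<open>S h\<^sub>3\<close>. Either
  pair can be cancelled first, and the two outcomes are the two sides of the identity.

  For the Hopf module condition it is not enough to compose with \<open>i\<close>, because both the
  product and the coaction take their argument in \<open>N'\<close>. Both sides are therefore
  written through one construction, \<open>transfer\<close>, natural in the factor on which
  \<open>H\<close> does not act. Naturality carries identities proved over \<open>N\<close> and over
  \<open>N \<boxtimes> H\<close> back along \<open>i\<close> and along the coaction, so that no
  double crossing with \<open>N'\<close> ever has to be undone.\<close>

context strict_monoidal_category
begin

lemma hom_iff: "f \<in> hom C U V \<longleftrightarrow> f \<in> Arr C \<and> src C f = U \<and> tgt C f = V"
  by (simp add: hom_def)

lemma comp_arr [simp]:
  assumes "f \<in> Arr C" "g \<in> Arr C" "tgt C f = src C g"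
  shows "g \<cdot> f \<in> Arr C" "src C (g \<cdot> f) = src C f" "tgt C (g \<cdot> f) = tgt C g"
  using comp_hom[of f "src C f" "tgt C f" g "tgt C g"] assms by (auto simp: hom_iff)

lemma tensor_arr [simp]:
  assumes "f \<in> Arr C" "g \<in> Arr C"
  shows "f \<otimes> g \<in> Arr C" "src C (f \<otimes> g) = src C f \<boxtimes> src C g" "tgt C (f \<otimes> g) = tgt C f \<boxtimes> tgt C g"
  using tensor_hom[of f "src C f" "tgt C f" g "src C g" "tgt C g"] assms by (auto simp: hom_iff)

lemma ident_arr [simp]:
  assumes "U \<in> Obj C"
  shows "\<one> U \<in> Arr C" "src C (\<one> U) = U" "tgt C (\<one> U) = U"
  using ident_hom[OF assms] by (auto simp: hom_iff)

declare src_obj [simp] tgt_obj [simp] unit_obj [simp] tensor_obj [simp]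
  unit_left_obj [simp] unit_right_obj [simp] unit_left_arr [simp] unit_right_arr [simp]
  assoc_obj [simp] assoc_arr [simp] tensor_ident [simp]

lemma comp_assoc_arr:
  assumes "f \<in> Arr C" "g \<in> Arr C" "h \<in> Arr C" "tgt C f = src C g" "tgt C g = src C h"
  shows "(h \<cdot> g) \<cdot> f = h \<cdot> g \<cdot> f"
  using comp_assoc[of f "src C f" "src C g" g "src C h" h "tgt C h"] assms by (simp add: hom_iff)

lemma comp_ident_arr [simp]: "f \<in> Arr C \<Longrightarrow> src C f = U \<Longrightarrow> f \<cdot> \<one> U = f"
  by (rule comp_ident) (auto simp: hom_iff)

lemma ident_comp_arr [simp]: "f \<in> Arr C \<Longrightarrow> tgt C f = U \<Longrightarrow> \<one> U \<cdot> f = f"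
  by (rule ident_comp) (auto simp: hom_iff)

lemma interchange_arr:
  assumes "f \<in> Arr C" "g \<in> Arr C" "f' \<in> Arr C" "g' \<in> Arr C" "tgt C f = src C g" "tgt C f' = src C g'"
  shows "(g \<otimes> g') \<cdot> (f \<otimes> f') = (g \<cdot> f) \<otimes> (g' \<cdot> f')"
  by (rule interchange[symmetric]) (use assms in \<open>auto simp: hom_iff\<close>)

lemma whisker_left_comp:
  assumes "f \<in> Arr C" "g \<in> Arr C" "tgt C f = src C g" "U \<in> Obj C"
  shows "\<one> U \<otimes> (g \<cdot> f) = (\<one> U \<otimes> g) \<cdot> (\<one> U \<otimes> f)"
  using assms by (simp add: interchange_arr)

lemma whisker_right_comp:
  assumes "f \<in> Arr C" "g \<in> Arr C" "tgt C f = src C g" "U \<in> Obj C"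
  shows "(g \<cdot> f) \<otimes> \<one> U = (g \<otimes> \<one> U) \<cdot> (f \<otimes> \<one> U)"
  using assms by (simp add: interchange_arr)

lemma whisker_swap:
  assumes "f \<in> Arr C" "g \<in> Arr C" "src C f = U" "tgt C f = U'" "src C g = V" "tgt C g = V'"
  shows "(f \<otimes> \<one> V') \<cdot> (\<one> U \<otimes> g) = (\<one> U' \<otimes> g) \<cdot> (f \<otimes> \<one> V)"
  using assms by (auto simp: interchange_arr)

text \<open>Composites are kept nested to the right, where the adjacent factors \<open>a\<close> and
  \<open>b\<close> do not form a subterm; this rule applies an equation for
  \<open>a \<cdot> b\<close> there all the same.\<close>

lemma comp_reassoc:
  assumes "a \<cdot> b = c" "f \<in> Arr C" "a \<in> Arr C" "b \<in> Arr C" "tgt C f = src C b" "tgt C b = src C a"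
  shows "a \<cdot> b \<cdot> f = c \<cdot> f"
  using assms comp_assoc_arr[of f b a] by simp

end

context strict_braided_category
begin

lemma braiding_arr [simp]:
  assumes "U \<in> Obj C" "V \<in> Obj C"
  shows "\<sigma> U V \<in> Arr C" "src C (\<sigma> U V) = U \<boxtimes> V" "tgt C (\<sigma> U V) = V \<boxtimes> U"
  using braiding_hom[OF assms] by (auto simp: hom_iff)

lemma braiding_natural_arr:
  assumes "f \<in> Arr C" "g \<in> Arr C" "src C f = U" "tgt C f = U'" "src C g = V" "tgt C g = V'"
  shows "\<sigma> U' V' \<cdot> (f \<otimes> g) = (g \<otimes> f) \<cdot> \<sigma> U V"
  by (rule braiding_natural) (use assms in \<open>auto simp: hom_iff\<close>)

lemma braiding_inverse:
  assumes "U \<in> Obj C" "V \<in> Obj C"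
  obtains s where "s \<in> Arr C" "src C s = V \<boxtimes> U" "tgt C s = U \<boxtimes> V"
    "s \<cdot> \<sigma> U V = \<one> (U \<boxtimes> V)" "\<sigma> U V \<cdot> s = \<one> (V \<boxtimes> U)"
  using braiding_iso[OF assms] assms by (auto simp: inverse_arrows_def hom_iff)

text \<open>The hexagon for two units makes \<open>\<sigma> \<I> U\<close> idempotent, and an
  invertible idempotent is an identity.\<close>

lemma braiding_unit_left [simp]:
  assumes "U \<in> Obj C" shows "\<sigma> \<I> U = \<one> U"
proof -
  have "\<sigma> \<I> U = \<sigma> \<I> U \<cdot> \<sigma> \<I> U"
    using hexagon_left[of \<I> \<I> U] assms by simp
  moreover obtain s where s: "s \<in> Arr C" "src C s = U" "tgt C s = U" "s \<cdot> \<sigma> \<I> U = \<one> U"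
    by (rule braiding_inverse[of \<I> U]) (use assms in auto)
  moreover have "(s \<cdot> \<sigma> \<I> U) \<cdot> \<sigma> \<I> U = s \<cdot> \<sigma> \<I> U \<cdot> \<sigma> \<I> U"
    using assms s(1-3) by (simp add: comp_assoc_arr)
  ultimately show ?thesis using s(4) assms by simp
qed

lemma braiding_unit_right [simp]:
  assumes "U \<in> Obj C" shows "\<sigma> U \<I> = \<one> U"
proof -
  have "\<sigma> U \<I> = \<sigma> U \<I> \<cdot> \<sigma> U \<I>"
    using hexagon_right[of U \<I> \<I>] assms by simp
  moreover obtain s where s: "s \<in> Arr C" "src C s = U" "tgt C s = U" "s \<cdot> \<sigma> U \<I> = \<one> U"
    by (rule braiding_inverse[of U \<I>]) (use assms in auto)
  moreover have "(s \<cdot> \<sigma> U \<I>) \<cdot> \<sigma> U \<I> = s \<cdot> \<sigma> U \<I> \<cdot> \<sigma> U \<I>"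
    using assms s(1-3) by (simp add: comp_assoc_arr)
  ultimately show ?thesis using s(4) assms by simp
qed

text \<open>Naturality of the braiding past \<open>W\<close>, applied to the arrow
  \<open>\<sigma> U V\<close>, with both crossings expanded by the hexagon.\<close>

lemma yang_baxter:
  assumes "U \<in> Obj C" "V \<in> Obj C" "W \<in> Obj C"
  shows "(\<sigma> V W \<otimes> \<one> U) \<cdot> (\<one> V \<otimes> \<sigma> U W) \<cdot> (\<sigma> U V \<otimes> \<one> W)
    = (\<one> W \<otimes> \<sigma> U V) \<cdot> (\<sigma> U W \<otimes> \<one> V) \<cdot> (\<one> U \<otimes> \<sigma> V W)"
  using braiding_natural_arr[of "\<sigma> U V" "\<one> W" "U \<boxtimes> V" "V \<boxtimes> U" W W] assms
  by (simp add: hexagon_left comp_assoc_arr)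

end

section \<open>Coherence of permutations of wires\<close>

text \<open>
  A wire is an object tagged with a number: the order of two lists of distinct wires determines a
  permutation of tensor factors even when the objects coincide.
\<close>

type_synonym 'o wire = "nat \<times> 'o"

text \<open>Symmetry is required only between members of \<open>K\<close>; for tensor products of
  such objects it follows from \<open>perm_perm\<close> and \<open>perm_block\<close>. The ambient
  category stays merely braided, since other objects, such as the ideal, have to live in it
  too.\<close>

locale symmetric_objects = strict_braided_category C
  for C :: "('o, 'a, 'x) braided_category_scheme" (structure) +
  fixes K
  assumes objects: "K \<subseteq> Obj C"
    and symmetric: "\<lbrakk>U \<in> K; V \<in> K\<rbrakk> \<Longrightarrow> \<sigma> V U \<cdot> \<sigma> U V = \<one> (U \<boxtimes> V)"
begin

lemma in_Obj [simp]: "U \<in> K \<Longrightarrow> U \<in> Obj C"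
  using objects by auto

definition wires :: "'o wire set" where
  "wires = {w. snd w \<in> K}"

primrec ob :: "'o wire list \<Rightarrow> 'o" where
  "ob [] = \<I>"
| "ob (w # ws) = snd w \<boxtimes> ob ws"

lemma wires_Obj [simp]: "w \<in> wires \<Longrightarrow> snd w \<in> Obj C"
  by (simp add: wires_def)

lemma ob_Obj [simp]: "set ws \<subseteq> wires \<Longrightarrow> ob ws \<in> Obj C"
  by (induction ws) auto

lemma ob_append [simp]: "set ws \<subseteq> wires \<Longrightarrow> set vs \<subseteq> wires \<Longrightarrow> ob (ws @ vs) = ob ws \<boxtimes> ob vs"
  by (induction ws) auto

lemma set_remove1_wires: "set ws \<subseteq> wires \<Longrightarrow> set (remove1 x ws) \<subseteq> wires"
  using set_remove1_subset by fastforce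

text \<open>\<open>pull x ws\<close> moves the first occurrence of \<open>x\<close> to the front; \<open>perm ws xs\<close> is only meaningful
  when \<open>xs\<close> is a permutation of \<open>ws\<close>.\<close>

primrec pull :: "'o wire \<Rightarrow> 'o wire list \<Rightarrow> 'a" where
  "pull x [] = \<one> \<I>"
| "pull x (y # ys) = (if x = y then \<one> (ob (y # ys))
    else (\<sigma> (snd y) (snd x) \<otimes> \<one> (ob (remove1 x ys))) \<cdot> (\<one> (snd y) \<otimes> pull x ys))"

primrec perm :: "'o wire list \<Rightarrow> 'o wire list \<Rightarrow> 'a" where
  "perm ws [] = \<one> \<I>"
| "perm ws (x # xs) = (\<one> (snd x) \<otimes> perm (remove1 x ws) xs) \<cdot> pull x ws"

lemma pull_arr:
  assumes "set ws \<subseteq> wires" "x \<in> set ws"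
  shows "pull x ws \<in> Arr C \<and> src C (pull x ws) = ob ws \<and> tgt C (pull x ws) = snd x \<boxtimes> ob (remove1 x ws)"
  using assms
proof (induction ws)
  case (Cons y ys)
  have [simp]: "ob (remove1 x ys) \<in> Obj C" "ob ys \<in> Obj C" "snd x \<in> Obj C" "snd y \<in> Obj C"
    using Cons.prems by (auto intro!: ob_Obj wires_Obj set_remove1_wires)
  show ?case using Cons by (cases "x = y") auto
qed simp

lemma pull_simps [simp]:
  assumes "set ws \<subseteq> wires" "x \<in> set ws"
  shows "pull x ws \<in> Arr C" "src C (pull x ws) = ob ws" "tgt C (pull x ws) = snd x \<boxtimes> ob (remove1 x ws)"
  using pull_arr[OF assms] by auto

lemma perm_arr:
  assumes "mset ws = mset xs" "set xs \<subseteq> wires"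
  shows "perm ws xs \<in> Arr C \<and> src C (perm ws xs) = ob ws \<and> tgt C (perm ws xs) = ob xs"
  using assms
proof (induction xs arbitrary: ws)
  case (Cons x xs)
  have x: "x \<in> set ws" and ws: "set ws \<subseteq> wires"
    using mset_eq_setD[OF Cons.prems(1)] Cons.prems by auto
  have "mset (remove1 x ws) = mset xs" using Cons.prems by simp
  from Cons.IH[OF this] Cons.prems x ws show ?case by (simp add: pull_arr)
qed simp

lemma perm_simps [simp]:
  assumes "mset ws = mset xs" "set xs \<subseteq> wires"
  shows "perm ws xs \<in> Arr C" "src C (perm ws xs) = ob ws" "tgt C (perm ws xs) = ob xs"
  using perm_arr[OF assms] by auto

lemma perm_refl [simp]: "set ws \<subseteq> wires \<Longrightarrow> perm ws ws = \<one> (ob ws)"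
  by (induction ws) auto

text \<open>Induction on the list. If \<open>z\<close> is its head, two braidings cancel by
  symmetry; if a third wire is the head, the Yang-Baxter equation carries it across both. This is
  the only point at which the axiom \<open>symmetric\<close> enters the coherence argument.\<close>

lemma pull_pull:
  assumes "set ws \<subseteq> wires" "x \<in> set ws" "z \<in> set ws" "x \<noteq> z"
  shows "(\<sigma> (snd x) (snd z) \<otimes> \<one> (ob (remove1 z (remove1 x ws))))
      \<cdot> (\<one> (snd x) \<otimes> pull z (remove1 x ws)) \<cdot> pull x ws
    = (\<one> (snd z) \<otimes> pull x (remove1 z ws)) \<cdot> pull z ws"
  using assms
proof (induction ws)
  case (Cons w ws)
  have K [simp]: "snd w \<in> Obj C" "ob ws \<in> Obj C" "snd x \<in> Obj C" "snd z \<in> Obj C" "set ws \<subseteq> wires"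
    "set (remove1 x ws) \<subseteq> wires" "set (remove1 z ws) \<subseteq> wires" "set (remove1 z (remove1 x ws)) \<subseteq> wires"
    using Cons.prems by (auto intro!: set_remove1_wires ob_Obj)
  consider "w = x" | "w = z" | "w \<noteq> x" "w \<noteq> z" by blast
  then show ?case
  proof cases
    case 1
    then show ?thesis using Cons.prems by simp
  next
    case 2
    then have x: "x \<in> set ws" "w \<noteq> x" using Cons.prems by auto
    have "\<sigma> (snd x) (snd z) \<cdot> \<sigma> (snd z) (snd x) = \<one> (snd z \<boxtimes> snd x)"
      using Cons.prems by (intro symmetric) (auto simp: wires_def)
    then have "(\<sigma> (snd x) (snd z) \<otimes> \<one> (ob (remove1 x ws))) \<cdot> (\<sigma> (snd z) (snd x) \<otimes> \<one> (ob (remove1 x ws)))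
      = \<one> (snd z \<boxtimes> snd x \<boxtimes> ob (remove1 x ws))"
      by (simp add: interchange_arr)
    from comp_reassoc[OF this, of "\<one> (snd z) \<otimes> pull x ws"] 2 x show ?thesis by simp
  next
    case 3
    then have x: "x \<in> set ws" and z: "z \<in> set ws" using Cons.prems by auto
    let ?W = "snd w" and ?X = "snd x" and ?Z = "snd z"
    let ?R = "ob (remove1 z (remove1 x ws))"
    have zx: "z \<in> set (remove1 x ws)" "x \<in> set (remove1 z ws)" using x z Cons.prems by auto
    have c: "remove1 x (remove1 z ws) = remove1 z (remove1 x ws)" by (rule remove1_commute)
    have "(\<sigma> ?X ?Z \<otimes> \<one> (?W \<boxtimes> ?R)) \<cdot> (\<one> ?X \<otimes> ((\<sigma> ?W ?Z \<otimes> \<one> ?R) \<cdot> (\<one> ?W \<otimes> pull z (remove1 x ws))))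
       \<cdot> (\<sigma> ?W ?X \<otimes> \<one> (ob (remove1 x ws))) \<cdot> (\<one> ?W \<otimes> pull x ws)
      = (\<sigma> ?X ?Z \<otimes> \<one> (?W \<boxtimes> ?R)) \<cdot> (\<one> ?X \<otimes> \<sigma> ?W ?Z \<otimes> \<one> ?R) \<cdot> ((\<one> (?X \<boxtimes> ?W) \<otimes> pull z (remove1 x ws))
       \<cdot> (\<sigma> ?W ?X \<otimes> \<one> (ob (remove1 x ws)))) \<cdot> (\<one> ?W \<otimes> pull x ws)"
      using x z zx by (simp add: whisker_left_comp comp_assoc_arr flip: tensor_ident)
    also have "(\<one> (?X \<boxtimes> ?W) \<otimes> pull z (remove1 x ws)) \<cdot> (\<sigma> ?W ?X \<otimes> \<one> (ob (remove1 x ws)))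
      = (\<sigma> ?W ?X \<otimes> \<one> (?Z \<boxtimes> ?R)) \<cdot> (\<one> (?W \<boxtimes> ?X) \<otimes> pull z (remove1 x ws))"
      using x z zx by (simp add: whisker_swap del: tensor_ident)
    also have "(\<sigma> ?X ?Z \<otimes> \<one> (?W \<boxtimes> ?R)) \<cdot> (\<one> ?X \<otimes> \<sigma> ?W ?Z \<otimes> \<one> ?R) \<cdot> ((\<sigma> ?W ?X \<otimes> \<one> (?Z \<boxtimes> ?R))
        \<cdot> (\<one> (?W \<boxtimes> ?X) \<otimes> pull z (remove1 x ws))) \<cdot> (\<one> ?W \<otimes> pull x ws)
      = (((\<sigma> ?X ?Z \<otimes> \<one> ?W) \<cdot> (\<one> ?X \<otimes> \<sigma> ?W ?Z) \<cdot> (\<sigma> ?W ?X \<otimes> \<one> ?Z)) \<otimes> \<one> ?R)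
        \<cdot> (\<one> (?W \<boxtimes> ?X) \<otimes> pull z (remove1 x ws)) \<cdot> (\<one> ?W \<otimes> pull x ws)"
      using x z zx by (simp add: whisker_right_comp comp_assoc_arr)
    also have "(\<sigma> ?X ?Z \<otimes> \<one> ?W) \<cdot> (\<one> ?X \<otimes> \<sigma> ?W ?Z) \<cdot> (\<sigma> ?W ?X \<otimes> \<one> ?Z)
      = (\<one> ?Z \<otimes> \<sigma> ?W ?X) \<cdot> (\<sigma> ?W ?Z \<otimes> \<one> ?X) \<cdot> (\<one> ?W \<otimes> \<sigma> ?X ?Z)"
      by (rule yang_baxter) simp_all
    also have "(((\<one> ?Z \<otimes> \<sigma> ?W ?X) \<cdot> (\<sigma> ?W ?Z \<otimes> \<one> ?X) \<cdot> (\<one> ?W \<otimes> \<sigma> ?X ?Z)) \<otimes> \<one> ?R)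
        \<cdot> (\<one> (?W \<boxtimes> ?X) \<otimes> pull z (remove1 x ws)) \<cdot> (\<one> ?W \<otimes> pull x ws)
      = (\<one> ?Z \<otimes> \<sigma> ?W ?X \<otimes> \<one> ?R) \<cdot> (\<sigma> ?W ?Z \<otimes> \<one> (?X \<boxtimes> ?R))
        \<cdot> (\<one> ?W \<otimes> ((\<sigma> ?X ?Z \<otimes> \<one> ?R) \<cdot> (\<one> ?X \<otimes> pull z (remove1 x ws)) \<cdot> pull x ws))"
      using x z zx by (simp add: whisker_right_comp whisker_left_comp comp_assoc_arr flip: tensor_ident)
    also have "(\<sigma> ?X ?Z \<otimes> \<one> ?R) \<cdot> (\<one> ?X \<otimes> pull z (remove1 x ws)) \<cdot> pull x ws
      = (\<one> ?Z \<otimes> pull x (remove1 z ws)) \<cdot> pull z ws"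
      using Cons x z by simp
    also have "(\<one> ?Z \<otimes> \<sigma> ?W ?X \<otimes> \<one> ?R) \<cdot> (\<sigma> ?W ?Z \<otimes> \<one> (?X \<boxtimes> ?R))
        \<cdot> (\<one> ?W \<otimes> ((\<one> ?Z \<otimes> pull x (remove1 z ws)) \<cdot> pull z ws))
      = (\<one> ?Z \<otimes> \<sigma> ?W ?X \<otimes> \<one> ?R) \<cdot> ((\<sigma> ?W ?Z \<otimes> \<one> (?X \<boxtimes> ?R))
        \<cdot> (\<one> (?W \<boxtimes> ?Z) \<otimes> pull x (remove1 z ws))) \<cdot> (\<one> ?W \<otimes> pull z ws)"
      using x z zx by (simp add: whisker_left_comp comp_assoc_arr c flip: tensor_ident)
    also have "(\<sigma> ?W ?Z \<otimes> \<one> (?X \<boxtimes> ?R)) \<cdot> (\<one> (?W \<boxtimes> ?Z) \<otimes> pull x (remove1 z ws))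
      = (\<one> (?Z \<boxtimes> ?W) \<otimes> pull x (remove1 z ws)) \<cdot> (\<sigma> ?W ?Z \<otimes> \<one> (ob (remove1 z ws)))"
      using x z zx by (simp add: whisker_swap c del: tensor_ident)
    also have "(\<one> ?Z \<otimes> \<sigma> ?W ?X \<otimes> \<one> ?R) \<cdot> ((\<one> (?Z \<boxtimes> ?W) \<otimes> pull x (remove1 z ws))
        \<cdot> (\<sigma> ?W ?Z \<otimes> \<one> (ob (remove1 z ws)))) \<cdot> (\<one> ?W \<otimes> pull z ws)
      = (\<one> ?Z \<otimes> ((\<sigma> ?W ?X \<otimes> \<one> ?R) \<cdot> (\<one> ?W \<otimes> pull x (remove1 z ws))))
        \<cdot> (\<sigma> ?W ?Z \<otimes> \<one> (ob (remove1 z ws))) \<cdot> (\<one> ?W \<otimes> pull z ws)"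
      using x z zx by (simp add: whisker_left_comp comp_assoc_arr c flip: tensor_ident)
    finally show ?thesis using 3 by (auto simp: c)
  qed
qed simp

text \<open>\<open>perm\<close> assembles its target from the front, so extracting a later wire
  \<open>z\<close> of the target has to pass the head \<open>x\<close>; \<open>pull_pull\<close>
  exchanges the two extractions.\<close>

lemma pull_perm:
  assumes "mset ws = mset xs" "set xs \<subseteq> wires" "z \<in> set xs"
  shows "pull z xs \<cdot> perm ws xs = (\<one> (snd z) \<otimes> perm (remove1 z ws) (remove1 z xs)) \<cdot> pull z ws"
  using assms
proof (induction xs arbitrary: ws)
  case (Cons x xs)
  have m: "mset (remove1 x ws) = mset xs" using Cons.prems by simp
  have ws: "set ws \<subseteq> wires" "x \<in> set ws" "z \<in> set ws"
    using mset_eq_setD[OF Cons.prems(1)] Cons.prems by auto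
  have K [simp]: "snd x \<in> Obj C" "snd z \<in> Obj C" "set xs \<subseteq> wires" "set ws \<subseteq> wires"
    "set (remove1 x ws) \<subseteq> wires" "set (remove1 z ws) \<subseteq> wires" "set (remove1 z (remove1 x ws)) \<subseteq> wires"
    "set (remove1 z xs) \<subseteq> wires"
    using Cons.prems ws by (auto intro!: set_remove1_wires)
  show ?case
  proof (cases "x = z")
    case True
    then show ?thesis using Cons.prems ws m by simp
  next
    case False
    let ?X = "snd x" and ?Z = "snd z"
    let ?p = "perm (remove1 z (remove1 x ws)) (remove1 z xs)"
    have z: "z \<in> set xs" using Cons.prems False by auto
    have zx: "z \<in> set (remove1 x ws)" "x \<in> set (remove1 z ws)" using ws False by auto
    have c: "remove1 x (remove1 z ws) = remove1 z (remove1 x ws)" by (rule remove1_commute)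
    have m': "mset (remove1 z (remove1 x ws)) = mset (remove1 z xs)" using m by simp
    note [simp] = m m' z zx ws
    have "pull z (x # xs) \<cdot> perm ws (x # xs)
      = (\<sigma> ?X ?Z \<otimes> \<one> (ob (remove1 z xs))) \<cdot> (\<one> ?X \<otimes> (pull z xs \<cdot> perm (remove1 x ws) xs)) \<cdot> pull x ws"
      using False by (auto simp: comp_assoc_arr whisker_left_comp simp del: mset_remove1)
    also have "pull z xs \<cdot> perm (remove1 x ws) xs = (\<one> ?Z \<otimes> ?p) \<cdot> pull z (remove1 x ws)"
      by (rule Cons.IH) (simp_all del: mset_remove1)
    also have "(\<sigma> ?X ?Z \<otimes> \<one> (ob (remove1 z xs))) \<cdot> (\<one> ?X \<otimes> ((\<one> ?Z \<otimes> ?p) \<cdot> pull z (remove1 x ws))) \<cdot> pull x ws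
      = ((\<sigma> ?X ?Z \<otimes> \<one> (ob (remove1 z xs))) \<cdot> (\<one> (?X \<boxtimes> ?Z) \<otimes> ?p))
        \<cdot> (\<one> ?X \<otimes> pull z (remove1 x ws)) \<cdot> pull x ws"
      by (simp add: whisker_left_comp comp_assoc_arr flip: tensor_ident del: mset_remove1)
    also have "(\<sigma> ?X ?Z \<otimes> \<one> (ob (remove1 z xs))) \<cdot> (\<one> (?X \<boxtimes> ?Z) \<otimes> ?p)
      = (\<one> (?Z \<boxtimes> ?X) \<otimes> ?p) \<cdot> (\<sigma> ?X ?Z \<otimes> \<one> (ob (remove1 z (remove1 x ws))))"
      by (simp add: whisker_swap del: tensor_ident mset_remove1)
    also have "((\<one> (?Z \<boxtimes> ?X) \<otimes> ?p) \<cdot> (\<sigma> ?X ?Z \<otimes> \<one> (ob (remove1 z (remove1 x ws)))))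
        \<cdot> (\<one> ?X \<otimes> pull z (remove1 x ws)) \<cdot> pull x ws
      = (\<one> (?Z \<boxtimes> ?X) \<otimes> ?p) \<cdot> (\<sigma> ?X ?Z \<otimes> \<one> (ob (remove1 z (remove1 x ws))))
        \<cdot> (\<one> ?X \<otimes> pull z (remove1 x ws)) \<cdot> pull x ws"
      by (simp add: comp_assoc_arr del: mset_remove1)
    also have "(\<sigma> ?X ?Z \<otimes> \<one> (ob (remove1 z (remove1 x ws)))) \<cdot> (\<one> ?X \<otimes> pull z (remove1 x ws)) \<cdot> pull x ws
      = (\<one> ?Z \<otimes> pull x (remove1 z ws)) \<cdot> pull z ws"
      using False by (intro pull_pull) simp_all
    also have "(\<one> (?Z \<boxtimes> ?X) \<otimes> ?p) \<cdot> (\<one> ?Z \<otimes> pull x (remove1 z ws)) \<cdot> pull z ws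
      = (\<one> ?Z \<otimes> ((\<one> ?X \<otimes> ?p) \<cdot> pull x (remove1 z ws))) \<cdot> pull z ws"
      by (simp add: whisker_left_comp comp_assoc_arr c flip: tensor_ident del: mset_remove1)
    finally show ?thesis using False by (auto simp: c)
  qed
qed simp

text \<open>Induction on the final order: \<open>pull_perm\<close> carries the extraction of each
  wire back through the first permutation. This is the coherence theorem in the form used below,
  since composites of permutations depend only on the initial and the final order.\<close>

lemma perm_perm:
  assumes "mset ws = mset xs" "mset xs = mset ys" "set ys \<subseteq> wires"
  shows "perm xs ys \<cdot> perm ws xs = perm ws ys"
  using assms
proof (induction ys arbitrary: ws xs)
  case (Cons y ys)
  have m: "mset (remove1 y xs) = mset ys" "mset (remove1 y ws) = mset (remove1 y xs)" using Cons.prems by simp_all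
  have y: "y \<in> set xs" "y \<in> set ws" and xs: "set xs \<subseteq> wires" "set ws \<subseteq> wires"
    using mset_eq_setD[OF Cons.prems(1)] mset_eq_setD[OF Cons.prems(2)] Cons.prems by auto
  have K [simp]: "set (remove1 y xs) \<subseteq> wires" "set (remove1 y ws) \<subseteq> wires" "set ys \<subseteq> wires" "snd y \<in> Obj C"
    using Cons.prems xs by (auto intro!: set_remove1_wires)
  note [simp] = m y xs Cons.prems(1)
  have "perm xs (y # ys) \<cdot> perm ws xs = (\<one> (snd y) \<otimes> perm (remove1 y xs) ys) \<cdot> pull y xs \<cdot> perm ws xs"
    by (simp add: comp_assoc_arr del: mset_remove1)
  also have "pull y xs \<cdot> perm ws xs = (\<one> (snd y) \<otimes> perm (remove1 y ws) (remove1 y xs)) \<cdot> pull y ws"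
    by (rule pull_perm) simp_all
  also have "(\<one> (snd y) \<otimes> perm (remove1 y xs) ys) \<cdot> (\<one> (snd y) \<otimes> perm (remove1 y ws) (remove1 y xs)) \<cdot> pull y ws
    = (\<one> (snd y) \<otimes> (perm (remove1 y xs) ys \<cdot> perm (remove1 y ws) (remove1 y xs))) \<cdot> pull y ws"
    by (simp add: whisker_left_comp comp_assoc_arr del: mset_remove1)
  also have "perm (remove1 y xs) ys \<cdot> perm (remove1 y ws) (remove1 y xs) = perm (remove1 y ws) ys"
    by (rule Cons.IH) (simp_all del: mset_remove1)
  finally show ?case by simp
qed simp

lemma perm_append_left:
  assumes "set us \<subseteq> wires" "mset ws = mset vs" "set vs \<subseteq> wires"
  shows "perm (us @ ws) (us @ vs) = \<one> (ob us) \<otimes> perm ws vs"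
  using assms
proof (induction us)
  case (Cons u us)
  have ws: "set ws \<subseteq> wires" using mset_eq_setD[OF Cons.prems(2)] Cons.prems by auto
  have "\<one> (snd u) \<otimes> (\<one> (ob us) \<otimes> perm ws vs) = (\<one> (snd u) \<otimes> \<one> (ob us)) \<otimes> perm ws vs"
    using Cons.prems by (intro assoc_arr[symmetric]) simp_all
  with Cons ws show ?case by simp
qed simp

lemma pull_append:
  assumes "set ws \<subseteq> wires" "x \<in> set ws" "set us \<subseteq> wires"
  shows "pull x (ws @ us) = pull x ws \<otimes> \<one> (ob us)"
  using assms
proof (induction ws)
  case (Cons w ws)
  have [simp]: "set (remove1 x ws) \<subseteq> wires" "snd x \<in> Obj C"
    using Cons.prems by (auto intro!: set_remove1_wires)
  show ?case
    using Cons by (auto simp: remove1_append whisker_right_comp simp flip: tensor_ident)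
qed simp

lemma perm_append_right:
  assumes "set us \<subseteq> wires" "mset ws = mset vs" "set vs \<subseteq> wires"
  shows "perm (ws @ us) (vs @ us) = perm ws vs \<otimes> \<one> (ob us)"
  using assms
proof (induction vs arbitrary: ws)
  case (Cons v vs)
  have m: "mset (remove1 v ws) = mset vs" using Cons.prems by simp
  have v: "v \<in> set ws" "set ws \<subseteq> wires"
    using mset_eq_setD[OF Cons.prems(2)] Cons.prems by auto
  have [simp]: "set (remove1 v ws) \<subseteq> wires" using v by (auto intro!: set_remove1_wires)
  show ?case using Cons m v by (simp add: remove1_append pull_append whisker_right_comp del: mset_remove1)
qed simp

lemma pull_block:
  assumes "v \<notin> set us" "set us \<subseteq> wires" "v \<in> wires" "set vs \<subseteq> wires"
  shows "pull v (us @ v # vs) = \<sigma> (ob us) (snd v) \<otimes> \<one> (ob vs)"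
  using assms
proof (induction us)
  case (Cons u us)
  then show ?case
    by (auto simp: remove1_append hexagon_left whisker_right_comp)
qed simp

text \<open>The hexagons split the crossing of two blocks into crossings of single wires. This links
  \<open>perm\<close>, which is built wire by wire, to the braidings of tensor products that occur
  in the axioms.\<close>

lemma perm_block:
  assumes "set us \<inter> set vs = {}" "set us \<subseteq> wires" "set vs \<subseteq> wires"
  shows "perm (us @ vs) (vs @ us) = \<sigma> (ob us) (ob vs)"
  using assms
proof (induction vs)
  case (Cons v vs)
  then show ?case
    by (auto simp: remove1_append pull_block hexagon_right)
qed simp

end

section \<open>String diagrams as programs\<close>

lemma mset_eq_if_set_eq: "\<lbrakk>distinct xs; distinct ys; set xs = set ys\<rbrakk> \<Longrightarrow> mset xs = mset ys"
  by (simp add: set_eq_iff_mset_eq_distinct)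

text \<open>
  A box \<open>(F, xs, ys)\<close> applies the arrow \<open>F\<close> to the wires \<open>xs\<close> and produces the wires \<open>ys\<close>. Running a
  program, each box first permutes its input wires to the front, so the order of independent boxes
  and the position of their wires do not matter.
\<close>

type_synonym ('o, 'a) box = "'a \<times> 'o wire list \<times> 'o wire list"

definition without :: "'b list \<Rightarrow> 'b list \<Rightarrow> 'b list" where
  "without ws xs = filter (\<lambda>w. w \<notin> set xs) ws"

lemma set_without [simp]: "set (without ws xs) = set ws - set xs"
  by (auto simp: without_def)

lemma without_append [simp]: "without (ws @ vs) xs = without ws xs @ without vs xs"
  by (simp add: without_def)

lemma without_self [simp]: "without xs xs = []"
  by (simp add: without_def)

lemma without_disjoint [simp]: "set ws \<inter> set xs = {} \<Longrightarrow> without ws xs = ws"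
  by (auto simp: without_def filter_id_conv)

lemma distinct_without [simp]: "distinct ws \<Longrightarrow> distinct (without ws xs)"
  by (simp add: without_def)

definition outs :: "('o, 'a) box list \<Rightarrow> 'o wire set" where
  "outs P = (\<Union>(F, xs, ys) \<in> set P. set ys)"

lemma outs_simps [simp]:
  "outs [] = {}" "outs ((F, xs, ys) # P) = set ys \<union> outs P" "outs (P @ Q) = outs P \<union> outs Q"
  by (auto simp: outs_def)

primrec avail :: "'o wire set \<Rightarrow> ('o, 'a) box list \<Rightarrow> 'o wire set" where
  "avail W [] = W"
| "avail W (b # P) = (case b of (F, xs, ys) \<Rightarrow> avail (W - set xs \<union> set ys) P)"

lemma avail_append [simp]: "avail W (P @ Q) = avail (avail W P) Q"
  by (induction P arbitrary: W) auto

lemma mset_without: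
  assumes "distinct xs" "distinct ws" "set xs \<subseteq> set ws"
  shows "mset ws = mset xs + mset (without ws xs)"
  unfolding mset_append[symmetric] by (rule mset_eq_if_set_eq) (use assms in auto)

context strict_braided_category
begin

text \<open>The left side is what \<open>run\<close> yields for \<open>F\<close> followed by an
  independent box \<open>G\<close>: the output of \<open>F\<close> is braided past the input of
  \<open>G\<close>. Naturality pulls that crossing back to the inputs.\<close>

lemma swap_boxes:
  assumes "F \<in> Arr C" "src C F = X" "tgt C F = Y" "G \<in> Arr C" "src C G = U" "tgt C G = V" "R \<in> Obj C"
  shows "(G \<otimes> \<one> (Y \<boxtimes> R)) \<cdot> (\<sigma> Y U \<otimes> \<one> R) \<cdot> (F \<otimes> \<one> (U \<boxtimes> R)) = ((G \<otimes> F) \<cdot> \<sigma> X U) \<otimes> \<one> R"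
proof -
  have obs: "X \<in> Obj C" "Y \<in> Obj C" "U \<in> Obj C" "V \<in> Obj C" using assms by auto
  have "(G \<otimes> \<one> (Y \<boxtimes> R)) \<cdot> (\<sigma> Y U \<otimes> \<one> R) \<cdot> (F \<otimes> \<one> (U \<boxtimes> R)) = ((G \<otimes> \<one> Y) \<cdot> \<sigma> Y U \<cdot> (F \<otimes> \<one> U)) \<otimes> \<one> R"
    using assms obs by (simp add: whisker_right_comp)
  also have "\<sigma> Y U \<cdot> (F \<otimes> \<one> U) = (\<one> U \<otimes> F) \<cdot> \<sigma> X U"
    by (rule braiding_natural_arr) (use assms obs in auto)
  also have "(G \<otimes> \<one> Y) \<cdot> (\<one> U \<otimes> F) \<cdot> \<sigma> X U = ((G \<otimes> \<one> Y) \<cdot> (\<one> U \<otimes> F)) \<cdot> \<sigma> X U"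
    using assms obs by (simp add: comp_assoc_arr)
  also have "(G \<otimes> \<one> Y) \<cdot> (\<one> U \<otimes> F) = G \<otimes> F"
    using assms obs by (simp add: interchange_arr)
  finally show ?thesis .
qed

text \<open>The counterpart of \<open>swap_boxes\<close> for the opposite order, in which
  \<open>G\<close> comes first. Here the output of \<open>G\<close> crosses the input of
  \<open>F\<close> once in each direction, and the last assumption removes this double
  crossing.\<close>

lemma swap_boxes_symmetric:
  assumes "F \<in> Arr C" "src C F = X" "tgt C F = Y" "G \<in> Arr C" "src C G = U" "tgt C G = V" "R \<in> Obj C"
    and "\<sigma> X V \<cdot> \<sigma> V X = \<one> (V \<boxtimes> X)"
  shows "(\<sigma> Y V \<otimes> \<one> R) \<cdot> (F \<otimes> \<one> (V \<boxtimes> R)) \<cdot> (\<sigma> V X \<otimes> \<one> R) \<cdot> (G \<otimes> \<one> (X \<boxtimes> R)) \<cdot> (\<sigma> X U \<otimes> \<one> R)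
    = ((G \<otimes> F) \<cdot> \<sigma> X U) \<otimes> \<one> R"
proof -
  have obs: "X \<in> Obj C" "Y \<in> Obj C" "U \<in> Obj C" "V \<in> Obj C" using assms by auto
  have "(\<sigma> Y V \<otimes> \<one> R) \<cdot> (F \<otimes> \<one> (V \<boxtimes> R)) \<cdot> (\<sigma> V X \<otimes> \<one> R) \<cdot> (G \<otimes> \<one> (X \<boxtimes> R)) \<cdot> (\<sigma> X U \<otimes> \<one> R)
    = ((\<sigma> Y V \<cdot> (F \<otimes> \<one> V)) \<cdot> \<sigma> V X \<cdot> (G \<otimes> \<one> X) \<cdot> \<sigma> X U) \<otimes> \<one> R"
    using assms obs by (simp add: whisker_right_comp comp_assoc_arr)
  also have "\<sigma> Y V \<cdot> (F \<otimes> \<one> V) = (\<one> V \<otimes> F) \<cdot> \<sigma> X V"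
    by (rule braiding_natural_arr) (use assms obs in auto)
  also have "((\<one> V \<otimes> F) \<cdot> \<sigma> X V) \<cdot> \<sigma> V X \<cdot> (G \<otimes> \<one> X) \<cdot> \<sigma> X U
    = (\<one> V \<otimes> F) \<cdot> (\<sigma> X V \<cdot> \<sigma> V X) \<cdot> (G \<otimes> \<one> X) \<cdot> \<sigma> X U"
    using assms(1-7) obs by (simp add: comp_assoc_arr)
  also have "\<dots> = ((\<one> V \<otimes> F) \<cdot> (G \<otimes> \<one> X)) \<cdot> \<sigma> X U"
    unfolding assms(8) using assms(1-7) obs by (simp add: comp_assoc_arr)
  also have "(\<one> V \<otimes> F) \<cdot> (G \<otimes> \<one> X) = G \<otimes> F"
    using assms obs by (simp add: interchange_arr)
  finally show ?thesis .
qed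

end

context symmetric_objects
begin

section \<open>Interpretation of programs and exchange of independent boxes\<close>

primrec run :: "'o wire list \<Rightarrow> ('o, 'a) box list \<Rightarrow> 'o wire list \<Rightarrow> 'a" where
  "run ws [] zs = perm ws zs"
| "run ws (b # P) zs = (case b of (F, xs, ys) \<Rightarrow>
    run (ys @ without ws xs) P zs \<cdot> (F \<otimes> \<one> (ob (without ws xs))) \<cdot> perm ws (xs @ without ws xs))"

text \<open>The condition \<open>set xs \<inter> outs P = {}\<close> forbids reusing the name of a
  consumed wire. Without it two boxes might not be exchangeable although neither uses an output of
  the other, because one could produce a wire that the other still has to consume.\<close>

primrec ok :: "'o wire set \<Rightarrow> ('o, 'a) box list \<Rightarrow> bool" where
  "ok W [] \<longleftrightarrow> True"
| "ok W (b # P) \<longleftrightarrow> (case b of (F, xs, ys) \<Rightarrow>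
    distinct xs \<and> distinct ys \<and> set xs \<subseteq> W \<and> set ys \<inter> W = {} \<and> set xs \<inter> outs P = {} \<and> set ys \<subseteq> wires
    \<and> F \<in> hom C (ob xs) (ob ys) \<and> ok (W - set xs \<union> set ys) P)"

lemma ok_append: "ok W (P @ Q) \<Longrightarrow> ok W P \<and> ok (avail W P) Q"
  by (induction P arbitrary: W) auto

lemma avail_Un:
  assumes "ok W P" "ok (W \<union> V) (P @ R)" "W \<inter> V = {}"
  shows "avail (W \<union> V) P = avail W P \<union> V \<and> avail W P \<inter> V = {}"
  using assms
proof (induction P arbitrary: W)
  case (Cons b P)
  obtain F xs ys where b: "b = (F, xs, ys)" by (cases b)
  have "W \<union> V - set xs \<union> set ys = (W - set xs \<union> set ys) \<union> V" using Cons.prems b by auto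
  then show ?case using Cons.IH[of "W - set xs \<union> set ys"] Cons.prems by (auto simp: b)
qed auto

lemma run_arr:
  assumes "ok (set ws) P" "avail (set ws) P = set zs" "distinct ws" "distinct zs" "set ws \<subseteq> wires"
  shows "run ws P zs \<in> Arr C \<and> src C (run ws P zs) = ob ws \<and> tgt C (run ws P zs) = ob zs"
  using assms
proof (induction P arbitrary: ws)
  case Nil
  then show ?case using perm_arr[of ws zs] mset_eq_if_set_eq[of ws zs] by auto
next
  case (Cons b P)
  obtain F xs ys where b: "b = (F, xs, ys)" by (cases b)
  let ?w = "without ws xs"
  have "mset ws = mset (xs @ ?w)" using Cons.prems b by (intro mset_eq_if_set_eq) auto
  moreover have "set (xs @ ?w) \<subseteq> wires" "set ?w \<subseteq> wires" "set xs \<subseteq> wires" using Cons.prems b by auto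
  moreover have "run (ys @ ?w) P zs \<in> Arr C \<and> src C (run (ys @ ?w) P zs) = ob (ys @ ?w)
      \<and> tgt C (run (ys @ ?w) P zs) = ob zs"
    using Cons.prems b by (intro Cons.IH) (auto simp: Un_commute)
  ultimately show ?case using Cons.prems b by (auto simp: hom_iff)
qed

lemma run_simps [simp]:
  assumes "ok (set ws) P" "avail (set ws) P = set zs" "distinct ws" "distinct zs" "set ws \<subseteq> wires"
  shows "run ws P zs \<in> Arr C" "src C (run ws P zs) = ob ws" "tgt C (run ws P zs) = ob zs"
  using run_arr[OF assms] by auto

text \<open>Each box brings its own inputs to the front anyway, and a permutation of the remaining
  wires slides past it by the exchange law.\<close>

lemma run_perm:
  assumes "ok (set ws) P" "avail (set ws) P = set zs" "distinct ws" "distinct zs" "set ws \<subseteq> wires"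
    "distinct vs" "set vs = set ws"
  shows "run ws P zs \<cdot> perm vs ws = run vs P zs"
  using assms
proof (induction P arbitrary: ws vs)
  case Nil
  then show ?case by (auto intro!: perm_perm mset_eq_if_set_eq)
next
  case (Cons b P)
  obtain F xs ys where b: "b = (F, xs, ys)" by (cases b)
  let ?w = "without ws xs" and ?v = "without vs xs"
  have P: "distinct xs" "distinct ys" "set xs \<subseteq> set ws" "set ys \<inter> set ws = {}" "set ys \<subseteq> wires"
    "F \<in> Arr C" "src C F = ob xs" "tgt C F = ob ys" "set xs \<subseteq> wires" "set ?w \<subseteq> wires" "set ?v \<subseteq> wires"
    using Cons.prems b by (auto simp: hom_iff)
  have m [simp]: "mset ws = mset (xs @ ?w)" "mset vs = mset ws" "mset ?v = mset ?w"
    using Cons.prems P by (auto intro!: mset_eq_if_set_eq mset_without)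
  have r: "ok (set (ys @ ?w)) P" "avail (set (ys @ ?w)) P = set zs" "distinct (ys @ ?w)"
    "set (ys @ ?w) \<subseteq> wires" "distinct (ys @ ?v)" "set (ys @ ?v) = set (ys @ ?w)"
    using Cons.prems b by (auto simp: Un_commute)
  note r' = run_simps[OF r(1-3) Cons.prems(4) r(4)]
  have "run ws (b # P) zs \<cdot> perm vs ws
    = run (ys @ ?w) P zs \<cdot> (F \<otimes> \<one> (ob ?w)) \<cdot> perm ws (xs @ ?w) \<cdot> perm vs ws"
    using r' P Cons.prems by (simp add: b comp_assoc_arr)
  also have "perm ws (xs @ ?w) \<cdot> perm vs ws = perm vs (xs @ ?w)"
    using P by (intro perm_perm) auto
  also have "\<dots> = perm (xs @ ?v) (xs @ ?w) \<cdot> perm vs (xs @ ?v)"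
    using P by (intro perm_perm[symmetric]) auto
  also have "perm (xs @ ?v) (xs @ ?w) = \<one> (ob xs) \<otimes> perm ?v ?w"
    using P by (intro perm_append_left) auto
  also have "run (ys @ ?w) P zs \<cdot> (F \<otimes> \<one> (ob ?w)) \<cdot> (\<one> (ob xs) \<otimes> perm ?v ?w) \<cdot> perm vs (xs @ ?v)
    = run (ys @ ?w) P zs \<cdot> ((F \<otimes> \<one> (ob ?w)) \<cdot> (\<one> (ob xs) \<otimes> perm ?v ?w)) \<cdot> perm vs (xs @ ?v)"
    using r' P Cons.prems by (simp add: comp_assoc_arr)
  also have "(F \<otimes> \<one> (ob ?w)) \<cdot> (\<one> (ob xs) \<otimes> perm ?v ?w)
    = (\<one> (ob ys) \<otimes> perm ?v ?w) \<cdot> (F \<otimes> \<one> (ob ?v))"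
    using P by (intro whisker_swap) auto
  also have "\<one> (ob ys) \<otimes> perm ?v ?w = perm (ys @ ?v) (ys @ ?w)"
    using P by (intro perm_append_left[symmetric]) auto
  also have "run (ys @ ?w) P zs \<cdot> (perm (ys @ ?v) (ys @ ?w) \<cdot> (F \<otimes> \<one> (ob ?v))) \<cdot> perm vs (xs @ ?v)
    = (run (ys @ ?w) P zs \<cdot> perm (ys @ ?v) (ys @ ?w)) \<cdot> (F \<otimes> \<one> (ob ?v)) \<cdot> perm vs (xs @ ?v)"
    using r' P Cons.prems by (simp add: comp_assoc_arr)
  also have "run (ys @ ?w) P zs \<cdot> perm (ys @ ?v) (ys @ ?w) = run (ys @ ?v) P zs"
    using r Cons.prems(4) by (intro Cons.IH) auto
  finally show ?case by (simp add: b)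
qed

text \<open>While \<open>P\<close> runs, the wires \<open>rest\<close> are idle, so its arrow splits
  off as a whiskered factor. With \<open>rest\<close> empty this is composition of programs, with
  \<open>R\<close> empty it is whiskering, and in general it allows one subprogram to be replaced by
  another.\<close>

lemma run_append:
  assumes "ok (set as) P" "avail (set as) P = set bs" "ok (set (as @ rest)) (P @ R)"
    "avail (set (as @ rest)) (P @ R) = set zs" "distinct (as @ rest)" "distinct (bs @ rest)" "distinct zs"
    "set (as @ rest) \<subseteq> wires" "set bs \<subseteq> wires"
  shows "run (as @ rest) (P @ R) zs = run (bs @ rest) R zs \<cdot> (run as P bs \<otimes> \<one> (ob rest))"
  using assms
proof (induction P arbitrary: as)
  case Nil
  have m: "mset as = mset bs" using Nil by (intro mset_eq_if_set_eq) auto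
  have "run (as @ rest) R zs = run (bs @ rest) R zs \<cdot> perm (as @ rest) (bs @ rest)"
    using Nil by (intro run_perm[symmetric]) auto
  also have "perm (as @ rest) (bs @ rest) = perm as bs \<otimes> \<one> (ob rest)"
    using Nil m by (intro perm_append_right) auto
  finally show ?case by simp
next
  case (Cons b P)
  obtain F xs ys where b: "b = (F, xs, ys)" by (cases b)
  let ?w = "without as xs"
  have P: "distinct xs" "distinct ys" "set xs \<subseteq> set as" "set ys \<inter> set as = {}" "set ys \<subseteq> wires"
    "F \<in> Arr C" "src C F = ob xs" "tgt C F = ob ys" "set xs \<subseteq> wires" "set ?w \<subseteq> wires" "set rest \<subseteq> wires"
    using Cons.prems b by (auto simp: hom_iff)
  have "set rest \<inter> set xs = {}" using P(3) Cons.prems(5) by auto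
  then have w [simp]: "without rest xs = rest" by (rule without_disjoint)
  have m [simp]: "mset as = mset (xs @ ?w)"
    using Cons.prems P by (auto intro!: mset_eq_if_set_eq mset_without)
  have s1: "set (ys @ ?w) = set as - set xs \<union> set ys" by auto
  have s2: "set ((ys @ ?w) @ rest) = set (as @ rest) - set xs \<union> set ys"
    using P Cons.prems(5) by auto
  have q: "ok (set (ys @ ?w)) P" "avail (set (ys @ ?w)) P = set bs"
    "ok (set ((ys @ ?w) @ rest)) (P @ R)" "avail (set ((ys @ ?w) @ rest)) (P @ R) = set zs"
    "distinct ((ys @ ?w) @ rest)" "set ((ys @ ?w) @ rest) \<subseteq> wires"
    unfolding s1 s2 using Cons.prems P by (auto simp: b)
  have R: "ok (set (bs @ rest)) R" "avail (set (bs @ rest)) R = set zs"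
    using avail_Un[of "set as" "b # P" "set rest" R] ok_append[OF Cons.prems(3)] Cons.prems by auto
  have "run (as @ rest) ((b # P) @ R) zs = run ((ys @ ?w) @ rest) (P @ R) zs
     \<cdot> (F \<otimes> \<one> (ob ?w \<boxtimes> ob rest)) \<cdot> perm (as @ rest) ((xs @ ?w) @ rest)"
    using P by (simp add: b w)
  also have "run ((ys @ ?w) @ rest) (P @ R) zs = run (bs @ rest) R zs \<cdot> (run (ys @ ?w) P bs \<otimes> \<one> (ob rest))"
    using q Cons.prems by (intro Cons.IH) auto
  also have "perm (as @ rest) ((xs @ ?w) @ rest) = perm as (xs @ ?w) \<otimes> \<one> (ob rest)"
    using P by (intro perm_append_right) auto
  finally have e: "run (as @ rest) ((b # P) @ R) zs = (run (bs @ rest) R zs \<cdot> (run (ys @ ?w) P bs \<otimes> \<one> (ob rest)))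
     \<cdot> (F \<otimes> \<one> (ob ?w \<boxtimes> ob rest)) \<cdot> (perm as (xs @ ?w) \<otimes> \<one> (ob rest))" .
  define A B where "A = run (bs @ rest) R zs" and "B = run (ys @ ?w) P bs"
  have A: "A \<in> Arr C" "src C A = ob bs \<boxtimes> ob rest"
    using run_arr[OF R] Cons.prems P(11) by (auto simp: A_def)
  have B: "B \<in> Arr C" "src C B = ob ys \<boxtimes> ob ?w" "tgt C B = ob bs"
    using run_arr[OF q(1,2)] Cons.prems(5,6) P(2,4,5,10) by (auto simp: B_def)
  have "set as \<subseteq> wires" using Cons.prems(8) by simp
  then have "set (xs @ ?w) \<subseteq> wires" using P(9) by auto
  then have p: "perm as (xs @ ?w) \<in> Arr C" "src C (perm as (xs @ ?w)) = ob as" "tgt C (perm as (xs @ ?w)) = ob (xs @ ?w)"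
    using perm_arr[OF m] by blast+
  define q where "q = perm as (xs @ ?w)"
  have q': "q \<in> Arr C" "src C q = ob as" "tgt C q = ob xs \<boxtimes> ob ?w"
    using p P(9,10) by (simp_all add: q_def)
  have obs: "ob as \<in> Obj C" "ob rest \<in> Obj C" "ob ?w \<in> Obj C" "ob bs \<in> Obj C" "ob xs \<in> Obj C" "ob ys \<in> Obj C"
    using \<open>set as \<subseteq> wires\<close> P(5,9-11) Cons.prems(9) by (auto intro: ob_Obj)
  have "(A \<cdot> (B \<otimes> \<one> (ob rest))) \<cdot> (F \<otimes> \<one> (ob ?w \<boxtimes> ob rest)) \<cdot> (q \<otimes> \<one> (ob rest))
    = A \<cdot> ((B \<cdot> (F \<otimes> \<one> (ob ?w)) \<cdot> q) \<otimes> \<one> (ob rest))"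
    using A B q' P(6-8) obs by (simp add: comp_assoc_arr whisker_right_comp)
  then show ?case unfolding e unfolding b run.simps prod.case A_def B_def q_def .
qed

lemma avail_disjoint: "ok W P \<Longrightarrow> W \<inter> V = {} \<Longrightarrow> outs P \<inter> V = {} \<Longrightarrow> avail W P \<inter> V = {}"
proof (induction P arbitrary: W)
  case (Cons b P)
  obtain F xs ys where b: "b = (F, xs, ys)" by (cases b)
  show ?case using Cons.prems unfolding b by simp (intro Cons.IH, auto)
qed simp

lemma ok_swap:
  assumes "ok W (c # b # R)" "set (fst (snd b)) \<subseteq> W"
  shows "ok W (b # c # R) \<and> avail W (b # c # R) = avail W (c # b # R)"
proof -
  obtain F xs ys where c: "c = (F, xs, ys)" by (cases c)
  obtain G us vs where b: "b = (G, us, vs)" by (cases b)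
  have "W - set us \<union> set vs - set xs \<union> set ys = W - set xs \<union> set ys - set us \<union> set vs"
    using assms unfolding b c by auto
  then show ?thesis using assms unfolding b c by auto
qed

text \<open>Once the wires are arranged as \<open>xs @ us @ rest\<close>, either order of the boxes
  acts on the first two blocks as
  \<open>(G \<otimes> F) \<cdot> \<sigma> (ob xs) (ob us)\<close>.\<close>

lemma run_swap:
  assumes "ok (set ws) (c # b # R)" "set (fst (snd b)) \<subseteq> set ws" "avail (set ws) (c # b # R) = set zs"
    "distinct ws" "distinct zs" "set ws \<subseteq> wires"
  shows "run ws (c # b # R) zs = run ws (b # c # R) zs"
proof -
  note ok' = ok_swap[OF assms(1,2)]
  obtain F xs ys where c: "c = (F, xs, ys)" by (cases c)
  obtain G us vs where b: "b = (G, us, vs)" by (cases b)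
  define rest where "rest = without ws (xs @ us)"
  note defs = b c
  have d: "distinct xs" "distinct us" "distinct ys" "distinct vs" "distinct rest"
    "set xs \<inter> set us = {}" "set xs \<inter> set rest = {}" "set us \<inter> set rest = {}"
    "set ys \<inter> set vs = {}" "set ys \<inter> set rest = {}" "set vs \<inter> set rest = {}"
    "set ys \<inter> set xs = {}" "set ys \<inter> set us = {}" "set vs \<inter> set xs = {}" "set vs \<inter> set us = {}"
    "set xs \<subseteq> wires" "set us \<subseteq> wires" "set rest \<subseteq> wires" "set ys \<subseteq> wires" "set vs \<subseteq> wires"
    and s: "set ws = set (xs @ us @ rest)"
    using assms ok' unfolding defs rest_def by auto
  have FG: "F \<in> Arr C" "src C F = ob xs" "tgt C F = ob ys" "G \<in> Arr C" "src C G = ob us" "tgt C G = ob vs"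
    using assms(1) unfolding defs by (auto simp: hom_iff)
  have w: "without (xs @ us @ rest) xs = us @ rest" "without (ys @ us @ rest) us = ys @ rest"
    "without (xs @ us @ rest) us = xs @ rest" "without (vs @ xs @ rest) xs = vs @ rest"
    using d by (simp_all add: Int_commute)
  have p: "perm (xs' @ us' @ rest) (us' @ xs' @ rest) = \<sigma> (ob xs') (ob us') \<otimes> \<one> (ob rest)"
    if "set xs' \<inter> set us' = {}" "set xs' \<subseteq> wires" "set us' \<subseteq> wires" for xs' us'
    using perm_append_right[of rest "xs' @ us'" "us' @ xs'"] perm_block[OF that] that d by simp
  have "ok (set (vs @ ys @ rest)) R \<and> avail (set (vs @ ys @ rest)) R = set zs"
  proof -
    have "set (vs @ ys @ rest) = set ws - set xs \<union> set ys - set us \<union> set vs"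
      unfolding s using d by auto
    then show ?thesis using assms(1,3) unfolding defs by simp
  qed
  then have R: "ok (set (vs @ ys @ rest)) R" "avail (set (vs @ ys @ rest)) R = set zs" by auto
  \<comment> \<open>Both crossings are permutations of wires by \<open>perm_block\<close>, and
    \<open>perm_perm\<close> makes each composite the trivial permutation; blocks thus inherit
    symmetry from single wires.\<close>
  have sym: "\<sigma> (ob vs) (ob xs) \<cdot> \<sigma> (ob xs) (ob vs) = \<one> (ob xs \<boxtimes> ob vs)"
    "\<sigma> (ob xs) (ob vs) \<cdot> \<sigma> (ob vs) (ob xs) = \<one> (ob vs \<boxtimes> ob xs)"
    using perm_perm[of "xs @ vs" "vs @ xs" "xs @ vs"] perm_perm[of "vs @ xs" "xs @ vs" "vs @ xs"] perm_block[of xs vs] perm_block[of vs xs] d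
    by (simp_all add: Int_commute union_commute)
  define r where "r = run (vs @ ys @ rest) R zs"
  have "distinct (vs @ ys @ rest)" "set (vs @ ys @ rest) \<subseteq> wires" using d by auto
  then have r: "r \<in> Arr C" "src C r = ob vs \<boxtimes> ob ys \<boxtimes> ob rest"
    using run_arr[OF R] d(17-20) assms(5) by (simp_all add: r_def)
  have r2: "run (ys @ vs @ rest) R zs \<in> Arr C" "src C (run (ys @ vs @ rest) R zs) = ob ys \<boxtimes> ob vs \<boxtimes> ob rest"
  proof -
    have "set (ys @ vs @ rest) = set (vs @ ys @ rest)" by auto
    moreover have "distinct (ys @ vs @ rest)" "set (ys @ vs @ rest) \<subseteq> wires" using d by auto
    moreover have "ob (ys @ vs @ rest) = ob ys \<boxtimes> ob vs \<boxtimes> ob rest" using d(18-20) by simp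
    ultimately show "run (ys @ vs @ rest) R zs \<in> Arr C" "src C (run (ys @ vs @ rest) R zs) = ob ys \<boxtimes> ob vs \<boxtimes> ob rest"
      using run_arr[of "ys @ vs @ rest" R zs] R d(18-20) assms(5) by metis+
  qed
  let ?q = "perm ws (xs @ us @ rest)"
  have "mset ws = mset (xs @ us @ rest)" "set (xs @ us @ rest) \<subseteq> wires"
    using s d assms(4) by (auto intro!: mset_eq_if_set_eq simp del: mset_append)
  then have q: "?q \<in> Arr C" "tgt C ?q = ob (xs @ us @ rest)"
    using perm_arr by blast+
  have dis: "distinct (xs @ us @ rest)" using d by (simp add: Int_Un_distrib)
  have to_front: "run ws Q zs = run (xs @ us @ rest) Q zs \<cdot> ?q"
    if "ok (set ws) Q" "avail (set ws) Q = set zs" for Q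
    using that assms(4-6) dis unfolding s by (intro run_perm[symmetric]) (simp_all only: s)
  have "run ws (c # b # R) zs = run (xs @ us @ rest) (c # b # R) zs \<cdot> ?q"
    by (rule to_front) (fact assms(1) assms(3))+
  also have "run (xs @ us @ rest) (c # b # R) zs = r \<cdot> (G \<otimes> \<one> (ob ys \<boxtimes> ob rest))
      \<cdot> (\<sigma> (ob ys) (ob us) \<otimes> \<one> (ob rest)) \<cdot> (F \<otimes> \<one> (ob us \<boxtimes> ob rest))"
    using d(16-20) FG r p[of ys us] d(13) by (simp add: defs w r_def comp_assoc_arr del: without_append)
  also have "r \<cdot> (G \<otimes> \<one> (ob ys \<boxtimes> ob rest)) \<cdot> (\<sigma> (ob ys) (ob us) \<otimes> \<one> (ob rest)) \<cdot> (F \<otimes> \<one> (ob us \<boxtimes> ob rest))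
      = r \<cdot> (((G \<otimes> F) \<cdot> \<sigma> (ob xs) (ob us)) \<otimes> \<one> (ob rest))"
    by (rule arg_cong[where f = "\<lambda>x. r \<cdot> x"], rule swap_boxes) (use FG d(18) in simp_all)
  finally have 1: "run ws (c # b # R) zs = (r \<cdot> (((G \<otimes> F) \<cdot> \<sigma> (ob xs) (ob us)) \<otimes> \<one> (ob rest))) \<cdot> ?q" .
  have "run ws (b # c # R) zs = run (xs @ us @ rest) (b # c # R) zs \<cdot> ?q"
    by (rule to_front) (use ok' assms(3) in simp_all)
  also have "run (xs @ us @ rest) (b # c # R) zs = run (ys @ vs @ rest) R zs \<cdot> (F \<otimes> \<one> (ob vs \<boxtimes> ob rest))
      \<cdot> (\<sigma> (ob vs) (ob xs) \<otimes> \<one> (ob rest)) \<cdot> (G \<otimes> \<one> (ob xs \<boxtimes> ob rest)) \<cdot> (\<sigma> (ob xs) (ob us) \<otimes> \<one> (ob rest))"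
    using d(16-20) FG r2 p[of vs xs] p[of xs us] d(6,14) by (simp add: defs w comp_assoc_arr del: without_append)
  also have "run (ys @ vs @ rest) R zs = r \<cdot> (\<sigma> (ob ys) (ob vs) \<otimes> \<one> (ob rest))"
    unfolding r_def p[OF d(9,19,20), symmetric]
  proof (rule run_perm[symmetric])
    show "distinct (vs @ ys @ rest)" "set (vs @ ys @ rest) \<subseteq> wires" "distinct (ys @ vs @ rest)"
      "set (ys @ vs @ rest) = set (vs @ ys @ rest)"
      using d by auto
  qed (use R assms(5) in simp_all)
  also have "(r \<cdot> (\<sigma> (ob ys) (ob vs) \<otimes> \<one> (ob rest))) \<cdot> (F \<otimes> \<one> (ob vs \<boxtimes> ob rest))
      \<cdot> (\<sigma> (ob vs) (ob xs) \<otimes> \<one> (ob rest)) \<cdot> (G \<otimes> \<one> (ob xs \<boxtimes> ob rest)) \<cdot> (\<sigma> (ob xs) (ob us) \<otimes> \<one> (ob rest))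
    = r \<cdot> (\<sigma> (ob ys) (ob vs) \<otimes> \<one> (ob rest)) \<cdot> (F \<otimes> \<one> (ob vs \<boxtimes> ob rest))
      \<cdot> (\<sigma> (ob vs) (ob xs) \<otimes> \<one> (ob rest)) \<cdot> (G \<otimes> \<one> (ob xs \<boxtimes> ob rest)) \<cdot> (\<sigma> (ob xs) (ob us) \<otimes> \<one> (ob rest))"
    using d(16-20) FG r by (simp add: comp_assoc_arr)
  also have "(\<sigma> (ob ys) (ob vs) \<otimes> \<one> (ob rest)) \<cdot> (F \<otimes> \<one> (ob vs \<boxtimes> ob rest))
      \<cdot> (\<sigma> (ob vs) (ob xs) \<otimes> \<one> (ob rest)) \<cdot> (G \<otimes> \<one> (ob xs \<boxtimes> ob rest)) \<cdot> (\<sigma> (ob xs) (ob us) \<otimes> \<one> (ob rest))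
    = ((G \<otimes> F) \<cdot> \<sigma> (ob xs) (ob us)) \<otimes> \<one> (ob rest)"
    by (rule swap_boxes_symmetric) (use FG d(18) sym in simp_all)
  finally show ?thesis using 1 by simp
qed

lemma ok_bubble:
  assumes "ok (set ws) (P @ b # R)" "set (fst (snd b)) \<subseteq> set ws" "avail (set ws) (P @ b # R) = set zs"
    "distinct ws" "distinct zs" "set ws \<subseteq> wires"
  shows "ok (set ws) (b # P @ R) \<and> avail (set ws) (b # P @ R) = set zs
    \<and> run ws (P @ b # R) zs = run ws (b # P @ R) zs"
  using assms
proof (induction P arbitrary: ws)
  case (Cons c P)
  obtain F xs ys where c: "c = (F, xs, ys)" by (cases c)
  let ?w = "ys @ without ws xs"
  have s: "set ?w = set ws - set xs \<union> set ys" by auto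
  \<comment> \<open>A wire consumed by \<open>c\<close> cannot come back before \<open>b\<close> is
    reached, so \<open>c\<close> takes none of the inputs of \<open>b\<close> and the two boxes can
    be exchanged.\<close>
  have "avail (set ws - set xs \<union> set ys) P \<inter> set xs = {}"
    using Cons.prems(1) unfolding c by (intro avail_disjoint) (auto dest: ok_append)
  moreover have "set (fst (snd b)) \<subseteq> avail (set ws - set xs \<union> set ys) P"
    using ok_append[of "set ws - set xs \<union> set ys" P "b # R"] Cons.prems(1) unfolding c by (auto split: prod.splits)
  ultimately have "set xs \<inter> set (fst (snd b)) = {}" by auto
  with Cons.prems have b: "set (fst (snd b)) \<subseteq> set ?w" by auto
  have pre: "ok (set ?w) (P @ b # R)" "avail (set ?w) (P @ b # R) = set zs" "distinct ?w" "set ?w \<subseteq> wires"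
    using Cons.prems unfolding c s distinct_append by auto
  note IH = Cons.IH[OF pre(1) b pre(2,3) Cons.prems(5) pre(4)]
  have 1: "ok (set ws) (c # b # P @ R)" "avail (set ws) (c # b # P @ R) = set zs"
    using IH Cons.prems unfolding c s by (auto split: prod.splits)
  have "run ws ((c # P) @ b # R) zs = run ws (c # b # P @ R) zs"
    using IH by (simp add: c)
  also have "\<dots> = run ws (b # c # P @ R) zs"
    using 1 Cons.prems by (intro run_swap) auto
  finally show ?case using ok_swap[OF 1(1) Cons.prems(2)] 1(2) by simp
qed simp

text \<open>The first box of \<open>P\<close> uses only wires present from the start, so its
  occurrence in \<open>Q\<close> can be bubbled to the front; induction handles the rest.\<close>

lemma run_reorder:
  assumes "mset P = mset Q" "ok (set ws) P" "ok (set ws) Q" "avail (set ws) P = set zs"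
    "avail (set ws) Q = set zs" "distinct ws" "distinct zs" "set ws \<subseteq> wires"
  shows "run ws P zs = run ws Q zs"
  using assms
proof (induction P arbitrary: Q ws)
  case (Cons b P)
  obtain F xs ys where b: "b = (F, xs, ys)" by (cases b)
  have "b \<in> set Q" using mset_eq_setD[OF Cons.prems(1)] by auto
  then obtain Q1 Q2 where Q: "Q = Q1 @ b # Q2" by (auto dest: split_list)
  have bub: "ok (set ws) (b # Q1 @ Q2) \<and> avail (set ws) (b # Q1 @ Q2) = set zs
    \<and> run ws Q zs = run ws (b # Q1 @ Q2) zs"
    unfolding Q by (rule ok_bubble) (use Cons.prems in \<open>auto simp: b Q\<close>)
  let ?w = "ys @ without ws xs"
  have s: "set ?w = set ws - set xs \<union> set ys" by auto
  have b': "ok (set ws) (b # Q1 @ Q2)" "avail (set ws) (b # Q1 @ Q2) = set zs" using bub by blast+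
  have "run ?w P zs = run ?w (Q1 @ Q2) zs"
  proof (rule Cons.IH)
    show "mset P = mset (Q1 @ Q2)" using Cons.prems(1) unfolding Q by simp
    show "ok (set ?w) P" "avail (set ?w) P = set zs" unfolding s using Cons.prems(2,4) unfolding b by simp_all
    show "ok (set ?w) (Q1 @ Q2)" "avail (set ?w) (Q1 @ Q2) = set zs" unfolding s using b' unfolding b by simp_all
    show "distinct ?w" "set ?w \<subseteq> wires" using Cons.prems(2,6,8) unfolding b by auto
    show "distinct zs" by (fact Cons.prems(7))
  qed
  then have "run ws (b # P) zs = run ws (b # Q1 @ Q2) zs"
    unfolding b by (simp only: run.simps prod.case)
  then show ?case using bub by metis
qed simp

lemma ok_avail_wires: "ok W P \<Longrightarrow> W \<subseteq> wires \<Longrightarrow> avail W P \<subseteq> wires"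
proof (induction P arbitrary: W)
  case (Cons b P)
  obtain F xs ys where b: "b = (F, xs, ys)" by (cases b)
  have "avail (W - set xs \<union> set ys) P \<subseteq> wires"
    by (rule Cons.IH) (use Cons.prems in \<open>auto simp: b\<close>)
  then show ?case by (simp add: b)
qed simp

lemma finite_avail: "finite W \<Longrightarrow> finite (avail W P)"
proof (induction P arbitrary: W)
  case (Cons b P)
  obtain F xs ys where b: "b = (F, xs, ys)" by (cases b)
  have "finite (avail (W - set xs \<union> set ys) P)" by (rule Cons.IH) (use Cons.prems in simp)
  then show ?case by (simp only: b avail.simps prod.case)
qed simp

lemma perm_run:
  assumes "ok (set ws) P" "avail (set ws) P = set zs" "distinct ws" "distinct zs" "set ws \<subseteq> wires"
    "distinct vs" "set vs = set zs"
  shows "perm zs vs \<cdot> run ws P zs = run ws P vs"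
  using assms
proof (induction P arbitrary: ws)
  case Nil
  then have "set vs \<subseteq> wires" "mset ws = mset zs" "mset zs = mset vs"
    by (auto intro!: mset_eq_if_set_eq)
  then show ?case by (simp add: perm_perm del: perm_simps)
next
  case (Cons b P)
  obtain F xs ys where b: "b = (F, xs, ys)" by (cases b)
  let ?w = "without ws xs"
  have P: "distinct xs" "distinct ys" "set xs \<subseteq> set ws" "set ys \<inter> set ws = {}" "set ys \<subseteq> wires"
    "F \<in> Arr C" "src C F = ob xs" "tgt C F = ob ys"
    using Cons.prems b by (auto simp: hom_iff)
  have w: "set xs \<subseteq> wires" "set ?w \<subseteq> wires" using P(3) Cons.prems(5) by auto
  have s: "set (ys @ ?w) = set ws - set xs \<union> set ys" by auto
  have r: "ok (set (ys @ ?w)) P" "avail (set (ys @ ?w)) P = set zs" "distinct (ys @ ?w)" "set (ys @ ?w) \<subseteq> wires"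
    unfolding s using Cons.prems b P(4) by auto
  have z: "set zs \<subseteq> wires" using ok_avail_wires[OF r(1,4)] r(2) by simp
  define A p q where "A = run (ys @ ?w) P zs" and "p = perm ws (xs @ ?w)" and "q = perm zs vs"
  have A: "A \<in> Arr C" "src C A = ob ys \<boxtimes> ob ?w" "tgt C A = ob zs"
    using run_arr[OF r(1,2,3) Cons.prems(4) r(4)] P(5) w by (auto simp: A_def)
  have "mset ws = mset (xs @ ?w)" using mset_without[OF P(1) Cons.prems(3) P(3)] by simp
  moreover have "set (xs @ ?w) \<subseteq> wires" using w(1) Cons.prems(5) by auto
  ultimately have p: "p \<in> Arr C" "tgt C p = ob (xs @ ?w)"
    using perm_arr unfolding p_def by blast+
  have p': "tgt C p = ob xs \<boxtimes> ob ?w" unfolding p(2) using w by simp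
  have "mset zs = mset vs" by (rule mset_eq_if_set_eq) (use Cons.prems in auto)
  then have q: "q \<in> Arr C" "src C q = ob zs"
    using perm_arr[of zs vs] z Cons.prems(7) by (auto simp: q_def)
  have "q \<cdot> A \<cdot> (F \<otimes> \<one> (ob ?w)) \<cdot> p = (q \<cdot> A) \<cdot> (F \<otimes> \<one> (ob ?w)) \<cdot> p"
    using A p(1) p' q P(6-8) w by (simp add: comp_assoc_arr)
  also have "q \<cdot> A = run (ys @ ?w) P vs"
    unfolding q_def A_def by (rule Cons.IH) (use r Cons.prems(4,6,7) in simp_all)
  finally show ?case unfolding b run.simps prod.case A_def p_def q_def .
qed

section \<open>Denotation and equivalence of programs\<close>

definition denotes :: "'a \<Rightarrow> 'o wire list \<Rightarrow> 'o wire list \<Rightarrow> ('o, 'a) box list \<Rightarrow> bool" where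
  "denotes f ws zs P \<longleftrightarrow> f = run ws P zs \<and> ok (set ws) P \<and> avail (set ws) P = set zs
    \<and> distinct ws \<and> distinct zs \<and> set ws \<subseteq> wires"

text \<open>Going through a common arrow, instead of equating two runs, records that both programs
  are well formed with the same inputs and outputs.\<close>

definition eqv :: "'o wire list \<Rightarrow> 'o wire list \<Rightarrow> ('o, 'a) box list \<Rightarrow> ('o, 'a) box list \<Rightarrow> bool" where
  "eqv ws zs P Q \<longleftrightarrow> (\<exists>f. denotes f ws zs P \<and> denotes f ws zs Q)"

lemma eqvI: "denotes f ws zs P \<Longrightarrow> denotes f ws zs Q \<Longrightarrow> eqv ws zs P Q"
  by (auto simp: eqv_def)

lemma eqv_eq: "eqv ws zs P Q \<Longrightarrow> denotes f ws zs P \<Longrightarrow> denotes g ws zs Q \<Longrightarrow> f = g"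
  by (auto simp: eqv_def denotes_def)

lemma eqv_sym: "eqv ws zs P Q \<Longrightarrow> eqv ws zs Q P"
  by (auto simp: eqv_def)

lemma eqv_trans [trans]: "eqv ws zs P Q \<Longrightarrow> eqv ws zs Q R \<Longrightarrow> eqv ws zs P R"
  by (auto simp: eqv_def denotes_def)

lemma denotes_arr:
  "denotes f ws zs P \<Longrightarrow> f \<in> Arr C \<and> src C f = ob ws \<and> tgt C f = ob zs \<and> set zs \<subseteq> wires"
  unfolding denotes_def using run_arr[of ws P zs] ok_avail_wires[of "set ws" P] by auto

lemma denotes_ident: "\<lbrakk>distinct ws; set ws \<subseteq> wires\<rbrakk> \<Longrightarrow> denotes (\<one> (ob ws)) ws ws []"
  by (simp add: denotes_def)

lemma denotes_braiding:
  "\<lbrakk>distinct ws; distinct vs; set ws \<inter> set vs = {}; set ws \<subseteq> wires; set vs \<subseteq> wires\<rbrakk>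
    \<Longrightarrow> denotes (\<sigma> (ob ws) (ob vs)) (ws @ vs) (vs @ ws) []"
  by (auto simp: denotes_def perm_block)

lemma denotes_box:
  assumes "F \<in> hom C (ob xs) (ob ys)" "distinct (xs @ ys)" "set xs \<subseteq> wires" "set ys \<subseteq> wires"
  shows "denotes F xs ys [(F, xs, ys)]"
  using assms by (auto simp: denotes_def hom_iff)

lemma denotes_comp:
  assumes f: "denotes f ws vs P" and g: "denotes g vs zs Q" and ok: "ok (set ws) (P @ Q)"
  shows "denotes (g \<cdot> f) ws zs (P @ Q)"
proof -
  have "avail (set ws) (P @ Q) = set zs" using f g by (simp add: denotes_def)
  then show ?thesis
    using run_append[of ws P vs "[]" Q zs] f g ok denotes_arr[OF f] denotes_arr[OF g] by (simp add: denotes_def)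
qed

text \<open>\<open>run_append\<close> treats programs that act on the front wires. The second factor
  is therefore brought to the front and back again; naturality and symmetry cancel the two
  crossings.\<close>

lemma denotes_tensor:
  assumes f: "denotes f ws vs P" and g: "denotes g ws' vs' P'" and ok: "ok (set (ws @ ws')) (P @ P')"
    and d: "set ws \<inter> set ws' = {}" "set vs \<inter> set vs' = {}"
  shows "denotes (f \<otimes> g) (ws @ ws') (vs @ vs') (P @ P')"
proof -
  have f': "ok (set ws) P" "avail (set ws) P = set vs" "distinct ws" "distinct vs" "set ws \<subseteq> wires"
    "set vs \<subseteq> wires" "f \<in> Arr C" "src C f = ob ws" "tgt C f = ob vs"
    using f denotes_arr[OF f] by (auto simp: denotes_def)
  have g': "ok (set ws') P'" "avail (set ws') P' = set vs'" "distinct ws'" "distinct vs'" "set ws' \<subseteq> wires"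
    "set vs' \<subseteq> wires" "g \<in> Arr C" "src C g = ob ws'" "tgt C g = ob vs'"
    using g denotes_arr[OF g] by (auto simp: denotes_def)
  have fr: "f = run ws P vs" and gr: "g = run ws' P' vs'" using f g by (auto simp: denotes_def)
  have aP: "avail (set (ws @ ws')) P = set (vs @ ws')" "set vs \<inter> set ws' = {}"
    using avail_Un[of "set ws" P "set ws'" P'] f' ok d by auto
  have ok': "ok (set (vs @ ws')) P'" using ok_append[OF ok] aP(1) by simp
  then have ok'': "ok (set (ws' @ vs)) (P' @ [])" by (simp add: Un_commute)
  have aP': "avail (set (ws' @ vs)) P' = set (vs' @ vs)"
    using avail_Un[of "set ws'" P' "set vs" "[]"] g' ok'' aP(2) by auto
  have dis: "distinct (ws @ ws')" "distinct (vs @ ws')" "distinct (ws' @ vs)" "distinct (vs' @ vs)" "distinct (vs @ vs')"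
    using f' g' d aP(2) by auto
  have s: "set (ws' @ vs) = set (vs @ ws')" "set (vs' @ vs) = set (vs @ vs')" by auto
  have "run (ws @ ws') (P @ P') (vs @ vs') = run (vs @ ws') P' (vs @ vs') \<cdot> (f \<otimes> \<one> (ob ws'))"
    unfolding fr
  proof (rule run_append)
    show "avail (set (ws @ ws')) (P @ P') = set (vs @ vs')"
      using aP aP' s by (simp only: avail_append)
  qed (use f' g' ok dis in simp_all)
  also have "run (vs @ ws') P' (vs @ vs') = perm (vs' @ vs) (vs @ vs') \<cdot> run (vs @ ws') P' (vs' @ vs)"
    by (rule perm_run[symmetric]) (use f' g' ok' dis aP' s in simp_all)
  also have "run (vs @ ws') P' (vs' @ vs) = run (ws' @ vs) P' (vs' @ vs) \<cdot> perm (vs @ ws') (ws' @ vs)"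
    by (rule run_perm[symmetric]) (use f' g' ok'' dis aP' s in simp_all)
  also have "run (ws' @ vs) P' (vs' @ vs) = g \<otimes> \<one> (ob vs)"
  proof -
    have "run (ws' @ vs) (P' @ []) (vs' @ vs) = run (vs' @ vs) [] (vs' @ vs) \<cdot> (run ws' P' vs' \<otimes> \<one> (ob vs))"
      by (rule run_append) (use f' g' ok'' aP' dis in simp_all)
    then show ?thesis using f' g' gr by simp
  qed
  also have "perm (vs' @ vs) (vs @ vs') = \<sigma> (ob vs') (ob vs)"
    by (rule perm_block) (use f' g' d in auto)
  also have "perm (vs @ ws') (ws' @ vs) = \<sigma> (ob vs) (ob ws')"
    by (rule perm_block) (use f' g' aP in simp_all)
  also have "\<sigma> (ob vs') (ob vs) \<cdot> (g \<otimes> \<one> (ob vs)) \<cdot> \<sigma> (ob vs) (ob ws')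
    = (\<sigma> (ob vs') (ob vs) \<cdot> (g \<otimes> \<one> (ob vs))) \<cdot> \<sigma> (ob vs) (ob ws')"
    using f' g' by (simp add: comp_assoc_arr)
  also have "\<sigma> (ob vs') (ob vs) \<cdot> (g \<otimes> \<one> (ob vs)) = (\<one> (ob vs) \<otimes> g) \<cdot> \<sigma> (ob ws') (ob vs)"
    using f' g' by (intro braiding_natural_arr) auto
  also have "((\<one> (ob vs) \<otimes> g) \<cdot> \<sigma> (ob ws') (ob vs)) \<cdot> \<sigma> (ob vs) (ob ws')
    = (\<one> (ob vs) \<otimes> g) \<cdot> (\<sigma> (ob ws') (ob vs) \<cdot> \<sigma> (ob vs) (ob ws'))"
    using f' g' by (simp add: comp_assoc_arr)
  also have "\<sigma> (ob ws') (ob vs) \<cdot> \<sigma> (ob vs) (ob ws') = \<one> (ob vs \<boxtimes> ob ws')"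
    using perm_perm[of "vs @ ws'" "ws' @ vs" "vs @ ws'"] perm_block[of vs ws'] perm_block[of ws' vs] f' g' aP(2)
    by (simp add: Int_commute union_commute)
  also have "((\<one> (ob vs) \<otimes> g) \<cdot> \<one> (ob vs \<boxtimes> ob ws')) \<cdot> (f \<otimes> \<one> (ob ws')) = f \<otimes> g"
    using f' g' by (simp add: interchange_arr)
  finally have "f \<otimes> g = run (ws @ ws') (P @ P') (vs @ vs')" by simp
  moreover have "avail (set (ws @ ws')) (P @ P') = set (vs @ vs')"
    using aP aP' s by (simp only: avail_append)
  ultimately show ?thesis using f' g' ok dis unfolding denotes_def by simp
qed

section \<open>Rewriting a subprogram in context\<close>

lemma run_cong_prefix:
  assumes "\<And>us. \<lbrakk>distinct us; set us \<subseteq> wires; set us = avail (set ws) R\<rbrakk> \<Longrightarrow> run us P zs = run us Q zs"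
    and "ok (set ws) R" "distinct ws" "set ws \<subseteq> wires"
  shows "run ws (R @ P) zs = run ws (R @ Q) zs"
  using assms
proof (induction R arbitrary: ws)
  case (Cons b R)
  obtain F xs ys where b: "b = (F, xs, ys)" by (cases b)
  let ?w = "ys @ without ws xs"
  have s: "set ?w = set ws - set xs \<union> set ys" by auto
  have "run ?w (R @ P) zs = run ?w (R @ Q) zs"
  proof (rule Cons.IH)
    fix us assume "distinct us" "set us \<subseteq> wires" "set us = avail (set ?w) R"
    then show "run us P zs = run us Q zs"
      unfolding s by (intro Cons.prems(1)) (simp_all add: b)
  next
    show "ok (set ?w) R" "distinct ?w" "set ?w \<subseteq> wires"
      unfolding s using Cons.prems(2-4) by (auto simp: b)
  qed
  then show ?case by (simp add: b)
qed simp

text \<open>With the wires \<open>as\<close> moved to the front, \<open>run_append\<close> shows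
  that the run depends on the initial block only through the arrow that it denotes.\<close>

lemma run_replace:
  assumes e: "eqv as bs P Q"
    and ok: "ok (set ws) (P @ R)" "ok (set ws) (Q @ R)"
    and av: "avail (set ws) (P @ R) = set zs"
    and d: "distinct ws" "distinct zs" "set ws \<subseteq> wires" "set as \<subseteq> set ws"
  shows "run ws (P @ R) zs = run ws (Q @ R) zs \<and> avail (set ws) (Q @ R) = set zs"
proof -
  obtain f where f: "denotes f as bs P" "denotes f as bs Q" using e by (auto simp: eqv_def)
  have b: "set bs \<subseteq> wires" using denotes_arr[OF f(1)] by simp
  let ?r = "without ws as"
  have s: "set (as @ ?r) = set ws" using d(4) by auto
  have w: "distinct as" "distinct bs" "distinct (as @ ?r)" "set as \<subseteq> wires" "set as \<inter> set ?r = {}"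
    using f d by (auto simp: denotes_def)
  have a: "avail (set ws) X = set (bs @ ?r) \<and> set bs \<inter> set ?r = {}" if "denotes f as bs X" "ok (set ws) (X @ R)" for X
    using avail_Un[of "set as" X "set ?r" R] that w(5) s by (simp add: denotes_def)
  have av': "avail (set ws) (Q @ R) = set zs"
    using a[OF f(1) ok(1)] a[OF f(2) ok(2)] av by simp
  have "run (as @ ?r) (X @ R) zs = run (bs @ ?r) R zs \<cdot> (f \<otimes> \<one> (ob ?r))"
    if X: "denotes f as bs X" "ok (set ws) (X @ R)" "avail (set ws) (X @ R) = set zs" for X
  proof -
    have "f = run as X bs" "ok (set as) X" "avail (set as) X = set bs" using X(1) by (auto simp: denotes_def)
    moreover have "distinct (bs @ ?r)" using a[OF X(1,2)] w(2) d(1) by simp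
    moreover have "set (as @ ?r) \<subseteq> wires" unfolding s by (rule d(3))
    ultimately show ?thesis
      using run_append[of as X bs ?r R zs] X(2,3) w b d(2) unfolding s by simp
  qed
  from this[OF f(1) ok(1) av] this[OF f(2) ok(2) av']
  have e: "run (as @ ?r) (P @ R) zs = run (as @ ?r) (Q @ R) zs" by simp
  have "run ws (X @ R) zs = run (as @ ?r) (X @ R) zs \<cdot> perm ws (as @ ?r)"
    if "ok (set ws) (X @ R)" "avail (set ws) (X @ R) = set zs" for X
    by (rule run_perm[symmetric]) (use that d w in \<open>simp_all only: s\<close>)
  then show ?thesis using ok av av' e by simp
qed

text \<open>The prefix \<open>A\<close> is common to both sides, so \<open>P\<close> is replaced on
  whatever wires \<open>A\<close> leaves. The freedom in \<open>Y\<close> absorbs a reordering into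
  the same step.\<close>

lemma eqv_in_context:
  assumes e: "eqv as bs P Q"
    and Y: "mset Y = mset (A @ Q @ B)"
    and ok: "ok (set ws) (A @ P @ B)" "ok (set ws) (A @ Q @ B)" "ok (set ws) Y"
    and as: "set as \<subseteq> avail (set ws) A"
    and av: "avail (set ws) (A @ P @ B) = set zs" "avail (set ws) Y = set zs"
    and d: "distinct ws" "distinct zs" "set ws \<subseteq> wires"
  shows "eqv ws zs (A @ P @ B) Y"
proof -
  have okA: "ok (set ws) A" "ok (avail (set ws) A) (P @ B)" "ok (avail (set ws) A) (Q @ B)"
    using ok_append[OF ok(1)] ok_append[OF ok(2)] by blast+
  have w: "avail (set ws) A \<subseteq> wires" by (rule ok_avail_wires[OF okA(1) d(3)])
  obtain vs where vs: "distinct vs" "set vs = avail (set ws) A"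
    using finite_distinct_list[OF finite_avail[OF List.finite_set]] by blast
  have avP: "avail (avail (set ws) A) (P @ B) = set zs"
    using av(1) by simp
  have main: "run us (P @ B) zs = run us (Q @ B) zs \<and> avail (set us) (Q @ B) = set zs"
    if "distinct us" "set us = avail (set ws) A" for us
    by (rule run_replace[OF e]) (use that okA avP as d w in simp_all)
  have "run ws (A @ P @ B) zs = run ws (A @ Q @ B) zs"
    by (rule run_cong_prefix) (simp_all only: main okA d)
  also have "\<dots> = run ws Y zs"
    by (rule run_reorder)
      (simp_all only: Y ok av d avail_append[of _ A "Q @ B"] vs(2)[symmetric] main[OF vs, THEN conjunct2])
  finally show ?thesis unfolding eqv_def denotes_def using ok(1,3) av d by simp
qed

text \<open>The conditions on programs in list form, for efficient rewriting on concrete programs;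
  the argument \<open>us\<close> of \<open>well_formed\<close> collects all wires that have occurred so far.\<close>

primrec takes :: "'b list \<Rightarrow> 'b list \<Rightarrow> 'b list option" where
  "takes [] ws = Some ws"
| "takes (x # xs) ws = (if x \<in> set ws then takes xs (remove1 x ws) else None)"

primrec fresh :: "'b list \<Rightarrow> 'b list \<Rightarrow> bool" where
  "fresh [] us = True"
| "fresh (x # xs) us \<longleftrightarrow> x \<notin> set us \<and> fresh xs (x # us)"

fun well_formed :: "'o wire list \<Rightarrow> ('o, 'a) box list \<Rightarrow> 'o wire list \<Rightarrow> 'o wire list \<Rightarrow> bool" where
  "well_formed zs [] us ws \<longleftrightarrow> set ws \<subseteq> set zs \<and> set zs \<subseteq> set ws"
| "well_formed zs ((F, xs, ys) # P) us ws \<longleftrightarrow> F \<in> hom C (ob xs) (ob ys) \<and> fresh ys us \<and> set ys \<subseteq> wires \<and>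
    (case takes xs ws of None \<Rightarrow> False | Some vs \<Rightarrow> well_formed zs P (ys @ us) (ys @ vs))"

fun available :: "'o wire list \<Rightarrow> ('o, 'a) box list \<Rightarrow> 'o wire list \<Rightarrow> bool" where
  "available xs [] ws \<longleftrightarrow> set xs \<subseteq> set ws"
| "available zs ((F, xs, ys) # P) ws \<longleftrightarrow>
    (case takes xs ws of None \<Rightarrow> False | Some vs \<Rightarrow> available zs P (ys @ vs))"

lemma takes_Some:
  "takes xs ws = Some vs \<Longrightarrow> distinct ws \<Longrightarrow>
    distinct xs \<and> set xs \<subseteq> set ws \<and> set vs = set ws - set xs \<and> distinct vs"
proof (induction xs arbitrary: ws)
  case (Cons x xs)
  then have "x \<in> set ws" "takes xs (remove1 x ws) = Some vs" by (auto split: if_splits)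
  with Cons.IH[of "remove1 x ws"] Cons.prems(2) show ?case by auto
qed simp

lemma fresh_iff: "fresh xs us \<longleftrightarrow> distinct xs \<and> set xs \<inter> set us = {}"
  by (induction xs arbitrary: us) auto

text \<open>Since \<open>us\<close> retains consumed wires as well, the single test
  \<open>fresh ys us\<close> covers both freshness conditions of \<open>ok\<close>; the statement
  about \<open>outs\<close> is what makes the induction go through.\<close>

lemma well_formed:
  assumes "well_formed zs P us ws" "set ws \<subseteq> set us" "distinct ws"
  shows "ok (set ws) P \<and> avail (set ws) P = set zs \<and> outs P \<inter> set us = {}"
  using assms
proof (induction zs P us ws rule: well_formed.induct)
  case (2 zs F xs ys P us ws)
  then obtain vs where vs: "takes xs ws = Some vs" by (cases "takes xs ws") auto
  note t = takes_Some[OF vs 2(4)]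
  have y: "distinct ys" "set ys \<inter> set us = {}" using 2(2) by (auto simp: fresh_iff)
  have "ok (set (ys @ vs)) P \<and> avail (set (ys @ vs)) P = set zs \<and> outs P \<inter> set (ys @ us) = {}"
    by (rule 2(1)[OF vs]) (use 2(2-4) vs t y in auto)
  moreover have "set (ys @ vs) = set ws - set xs \<union> set ys" using t by auto
  ultimately show ?case using 2(2-4) t y by auto
qed auto

lemma available:
  assumes "available zs P ws" "distinct ws" "ok (set ws) P"
  shows "set zs \<subseteq> avail (set ws) P"
  using assms
proof (induction zs P ws rule: available.induct)
  case (2 zs F xs ys P ws)
  then obtain vs where vs: "takes xs ws = Some vs" by (cases "takes xs ws") auto
  note t = takes_Some[OF vs 2(3)]
  have s: "set (ys @ vs) = set ws - set xs \<union> set ys" using t by auto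
  have "set zs \<subseteq> avail (set (ys @ vs)) P"
    by (rule 2(1)[OF vs]) (use 2(2-4) vs t s in auto)
  then show ?case unfolding s by simp
qed simp

text \<open>One line of a Sweedler computation: the block \<open>P\<close> that starts at position
  \<open>n\<close> of \<open>X\<close>, counted from 0, is replaced by \<open>Q\<close>, and the
  result is listed in any order that makes the boxes of the next rewriting adjacent.\<close>

lemma eqv_at:
  assumes e: "eqv as bs P Q"
    and X: "X = take n X @ P @ drop (n + length P) X"
    and Y: "mset Y = mset (take n X @ Q @ drop (n + length P) X)"
    and wf: "well_formed zs X ws ws" "well_formed zs (take n X @ Q @ drop (n + length P) X) ws ws"
      "well_formed zs Y ws ws"
    and a: "available as (take n X) ws"
    and d: "distinct ws" "distinct zs" "set ws \<subseteq> wires"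
  shows "eqv ws zs X Y"
proof -
  let ?A = "take n X" and ?B = "drop (n + length P) X"
  note wf' = wf[THEN well_formed, OF subset_refl d(1)]
  have A: "ok (set ws) ?A" using ok_append[of "set ws" ?A "P @ ?B"] wf'(1) X by metis
  have "eqv ws zs (?A @ P @ ?B) Y"
    by (rule eqv_in_context[OF e Y])
      (use wf' available[OF a d(1) A] d in \<open>simp_all only: X[symmetric]\<close>)
  then show ?thesis by (simp only: X[symmetric])
qed

lemma eqv_reorder:
  assumes "mset X = mset Y" "well_formed zs X ws ws" "well_formed zs Y ws ws"
    "distinct ws" "distinct zs" "set ws \<subseteq> wires"
  shows "eqv ws zs X Y"
  using run_reorder[OF assms(1), of ws zs] assms(2,3)[THEN well_formed, OF subset_refl assms(4)] assms(4-6)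
  by (simp add: eqv_def denotes_def)

end

section \<open>The calculus for a quasi-dual\<close>

context left_quasi_dual
begin

lemma structure_arr [simp]:
  "H \<in> Obj C" "N \<in> Obj C"
  "m \<in> Arr C" "src C m = H \<boxtimes> H" "tgt C m = H"
  "\<eta> \<in> Arr C" "src C \<eta> = \<I>" "tgt C \<eta> = H"
  "\<Delta> \<in> Arr C" "src C \<Delta> = H" "tgt C \<Delta> = H \<boxtimes> H"
  "\<epsilon> \<in> Arr C" "src C \<epsilon> = H" "tgt C \<epsilon> = \<I>"
  "S \<in> Arr C" "src C S = H" "tgt C S = H"
  "mN \<in> Arr C" "src C mN = N \<boxtimes> N" "tgt C mN = N"
  "\<eta>N \<in> Arr C" "src C \<eta>N = \<I>" "tgt C \<eta>N = N"
  "p \<in> Arr C" "src C p = N \<boxtimes> H" "tgt C p = \<I>"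
  using A_obj N.A_obj m_hom \<eta>_hom \<Delta>_hom \<epsilon>_hom S_hom N.m_hom N.\<eta>_hom pairing_hom by (auto simp: hom_iff)

text \<open>Naturality of the braiding at \<open>p\<close>: its target is the unit, where the
  braiding is trivial, and the hexagon splits the crossing of \<open>V\<close> with
  \<open>N \<boxtimes> H\<close>.\<close>

lemma pairing_slide_right:
  assumes "V \<in> Obj C"
  shows "(p \<otimes> \<one> V) \<cdot> (\<one> N \<otimes> \<sigma> V H) \<cdot> (\<sigma> V N \<otimes> \<one> H) = \<one> V \<otimes> p"
  using braiding_natural_arr[of "\<one> V" p V V "N \<boxtimes> H" \<I>] assms by (simp add: hexagon_right)

lemma pairing_slide_left:
  assumes "V \<in> Obj C"
  shows "(\<one> V \<otimes> p) \<cdot> (\<sigma> N V \<otimes> \<one> H) \<cdot> (\<one> N \<otimes> \<sigma> H V) = p \<otimes> \<one> V"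
  using braiding_natural_arr[of p "\<one> V" "N \<boxtimes> H" \<I> V V] assms by (simp add: hexagon_left)

end

context faithful_quasi_dual
begin

text \<open>Sliding a string past the pairing transfers symmetry of its braiding with \<open>H\<close> to \<open>N\<close>.\<close>

lemma symmetric_with_dual:
  assumes V: "V \<in> Obj C" and sym: "\<sigma> H V \<cdot> \<sigma> V H = \<one> (V \<boxtimes> H)"
  shows "\<sigma> N V \<cdot> \<sigma> V N = \<one> (V \<boxtimes> N)"
proof (rule faithful_left[of "V \<boxtimes> N" V])
  have "(\<one> V \<otimes> p) \<cdot> ((\<sigma> N V \<cdot> \<sigma> V N) \<otimes> \<one> H)
    = (\<one> V \<otimes> p) \<cdot> (\<sigma> N V \<otimes> \<one> H) \<cdot> (\<one> N \<otimes> (\<sigma> H V \<cdot> \<sigma> V H)) \<cdot> (\<sigma> V N \<otimes> \<one> H)"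
    unfolding sym using V by (simp add: whisker_right_comp)
  also have "\<dots> = ((\<one> V \<otimes> p) \<cdot> (\<sigma> N V \<otimes> \<one> H) \<cdot> (\<one> N \<otimes> \<sigma> H V)) \<cdot> (\<one> N \<otimes> \<sigma> V H) \<cdot> (\<sigma> V N \<otimes> \<one> H)"
    using V by (simp add: whisker_left_comp comp_assoc_arr)
  also have "\<dots> = (\<one> V \<otimes> p) \<cdot> (\<one> (V \<boxtimes> N) \<otimes> \<one> H)"
    using V by (simp add: pairing_slide_left pairing_slide_right)
  finally show "(\<one> V \<otimes> p) \<cdot> ((\<sigma> N V \<cdot> \<sigma> V N) \<otimes> \<one> H) = (\<one> V \<otimes> p) \<cdot> (\<one> (V \<boxtimes> N) \<otimes> \<one> H)" .
qed (use V in \<open>auto simp: hom_iff\<close>)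

end

locale symmetric_quasi_dual =
  strict_quasi_dual C H m \<eta> \<Delta> \<epsilon> S N mN \<eta>N p N' i m' act act' \<rho>
  for C :: "('o, 'a, 'x) braided_category_scheme" (structure)
    and H m \<eta> \<Delta> \<epsilon> S N mN \<eta>N p N' i m' act act' \<rho> +
  assumes braiding_HH: "\<sigma> H H \<cdot> \<sigma> H H = \<one> (H \<boxtimes> H)"
begin

lemma act_arr [simp]: "act \<in> Arr C" "src C act = H \<boxtimes> N" "tgt C act = N"
  using act_hom by (auto simp: hom_iff)

lemma braiding_HN: "\<sigma> N H \<cdot> \<sigma> H N = \<one> (H \<boxtimes> N)"
  by (rule symmetric_with_dual) (simp_all add: braiding_HH)

text \<open>\<open>symmetric_with_dual\<close> for \<open>V = H\<close> yields one of the two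
  composites; as braidings are invertible, the one-sided inverse is two-sided. This other composite
  is the hypothesis needed for \<open>V = N\<close>.\<close>

lemma braiding_NH: "\<sigma> H N \<cdot> \<sigma> N H = \<one> (N \<boxtimes> H)"
proof -
  obtain s where s: "s \<in> Arr C" "src C s = N \<boxtimes> H" "tgt C s = H \<boxtimes> N" "\<sigma> H N \<cdot> s = \<one> (N \<boxtimes> H)"
    by (rule braiding_inverse[of H N]) auto
  have "\<sigma> N H = \<sigma> N H \<cdot> \<sigma> H N \<cdot> s" using s by simp
  also have "\<dots> = s" using s comp_reassoc[OF braiding_HN, of s] by simp
  finally show ?thesis using s by simp
qed

lemma braiding_NN: "\<sigma> N N \<cdot> \<sigma> N N = \<one> (N \<boxtimes> N)"
  by (rule symmetric_with_dual) (simp_all add: braiding_NH)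

sublocale symmetric_objects C "{H, N}"
  by unfold_locales (auto simp: braiding_HH braiding_HN braiding_NH braiding_NN)

text \<open>The box \<open>bI\<close> renames a wire; unit and counit laws leave such boxes behind.\<close>

abbreviation "bI V x y \<equiv> (\<one> V, [(x :: nat, V)], [(y :: nat, V)])"
abbreviation "bm x y z \<equiv> (m, [(x :: nat, H), (y :: nat, H)], [(z :: nat, H)])"
abbreviation "bu x \<equiv> (\<eta>, [], [(x :: nat, H)])"
abbreviation "bD x y z \<equiv> (\<Delta>, [(x :: nat, H)], [(y :: nat, H), (z :: nat, H)])"
abbreviation "be x \<equiv> (\<epsilon>, [(x :: nat, H)], [])"
abbreviation "bS x y \<equiv> (S, [(x :: nat, H)], [(y :: nat, H)])"
abbreviation "bmN x y z \<equiv> (mN, [(x :: nat, N), (y :: nat, N)], [(z :: nat, N)])"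
abbreviation "bp x y \<equiv> (p, [(x :: nat, N), (y :: nat, H)], [])"
abbreviation "ba h x y \<equiv> (act, [(h :: nat, H), (x :: nat, N)], [(y :: nat, N)])"

lemma wire_in_wires [simp]: "(x, V) \<in> wires \<longleftrightarrow> V = H \<or> V = N"
  by (simp add: wires_def)

lemma box_hom [simp]:
  "m \<in> hom C (H \<boxtimes> H) H" "\<eta> \<in> hom C \<I> H" "\<Delta> \<in> hom C H (H \<boxtimes> H)" "\<epsilon> \<in> hom C H \<I>"
  "S \<in> hom C H H" "mN \<in> hom C (N \<boxtimes> N) N" "p \<in> hom C (N \<boxtimes> H) \<I>" "act \<in> hom C (H \<boxtimes> N) N"
  "V \<in> Obj C \<Longrightarrow> \<one> V \<in> hom C V V"
  by (simp_all add: hom_iff)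

lemma den_comp:
  assumes "denotes f ws vs P" "denotes g us zs Q" "us = vs" "well_formed zs (P @ Q) ws ws"
  shows "denotes (g \<cdot> f) ws zs (P @ Q)"
  using assms well_formed[OF assms(4)] by (intro denotes_comp[of f ws vs P g]) (auto simp: denotes_def)

lemma den_tensor:
  assumes "denotes f ws vs P" "denotes g ws' vs' P'" "well_formed (vs @ vs') (P @ P') (ws @ ws') (ws @ ws')"
    "distinct (ws @ ws')" "distinct (vs @ vs')"
  shows "denotes (f \<otimes> g) (ws @ ws') (vs @ vs') (P @ P')"
  using assms well_formed[OF assms(3) subset_refl assms(4)] by (intro denotes_tensor[OF assms(1,2)]) auto

text \<open>All lists in the conclusion are variables, so that the rule applies to programs in any form.\<close>

lemma den_comp_eq:
  "\<lbrakk>denotes f ws vs P; denotes g us zs Q; us = vs; ws' = ws; zs' = zs; R = P @ Q; h = g \<cdot> f;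
    well_formed zs' R ws' ws'\<rbrakk> \<Longrightarrow> denotes h ws' zs' R"
  using den_comp by simp

lemma den_tensor_eq:
  "\<lbrakk>denotes f ws vs P; denotes g ws' vs' P'; us = ws @ ws'; zs = vs @ vs'; R = P @ P'; h = f \<otimes> g;
    well_formed zs R us us; distinct us; distinct zs\<rbrakk> \<Longrightarrow> denotes h us zs R"
  using den_tensor by simp

lemma den:
  "distinct [x, y, z] \<Longrightarrow> denotes m [(x, H), (y, H)] [(z, H)] [bm x y z]"
  "denotes \<eta> [] [(x, H)] [bu x]"
  "distinct [x, y, z] \<Longrightarrow> denotes \<Delta> [(x, H)] [(y, H), (z, H)] [bD x y z]"
  "denotes \<epsilon> [(x, H)] [] [be x]"
  "distinct [x, y] \<Longrightarrow> denotes S [(x, H)] [(y, H)] [bS x y]"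
  "distinct [x, y, z] \<Longrightarrow> denotes mN [(x, N), (y, N)] [(z, N)] [bmN x y z]"
  "distinct [x, y] \<Longrightarrow> denotes p [(x, N), (y, H)] [] [bp x y]"
  "distinct [x, y, z] \<Longrightarrow> denotes act [(x, H), (y, N)] [(z, N)] [ba x y z]"
  "distinct [x, y] \<Longrightarrow> denotes (\<one> H) [(x, H)] [(y, H)] [bI H x y]"
  "distinct [x, y] \<Longrightarrow> denotes (\<one> N) [(x, N)] [(y, N)] [bI N x y]"
  "denotes (\<one> H) [(x, H)] [(x, H)] []"
  "denotes (\<one> N) [(x, N)] [(x, N)] []"
  "distinct [x, y] \<Longrightarrow> denotes (\<sigma> H H) [(x, H), (y, H)] [(y, H), (x, H)] []"
  "distinct [x, y] \<Longrightarrow> denotes (\<sigma> H N) [(x, H), (y, N)] [(y, N), (x, H)] []"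
  "distinct [x, y] \<Longrightarrow> denotes (\<sigma> N H) [(x, N), (y, H)] [(y, H), (x, N)] []"
  using denotes_box[of m "[(x, H), (y, H)]" "[(z, H)]"] denotes_box[of \<eta> "[]" "[(x, H)]"]
    denotes_box[of \<Delta> "[(x, H)]" "[(y, H), (z, H)]"] denotes_box[of \<epsilon> "[(x, H)]" "[]"]
    denotes_box[of S "[(x, H)]" "[(y, H)]"] denotes_box[of mN "[(x, N), (y, N)]" "[(z, N)]"]
    denotes_box[of p "[(x, N), (y, H)]" "[]"] denotes_box[of act "[(x, H), (y, N)]" "[(z, N)]"]
    denotes_box[of "\<one> H" "[(x, H)]" "[(y, H)]"] denotes_box[of "\<one> N" "[(x, N)]" "[(y, N)]"]
    denotes_ident[of "[(x, H)]"] denotes_ident[of "[(x, N)]"]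
    denotes_braiding[of "[(x, H)]" "[(y, H)]"] denotes_braiding[of "[(x, H)]" "[(y, N)]"]
    denotes_braiding[of "[(x, N)]" "[(y, H)]"]
  by simp_all

lemmas den_m = den(1) and den_u = den(2) and den_D = den(3) and den_e = den(4) and den_S = den(5)
  and den_mN = den(6) and den_p = den(7) and den_a = den(8) and den_bIH = den(9) and den_bIN = den(10)
  and den_H = den(11) and den_N = den(12) and den_HH = den(13) and den_HN = den(14) and den_NH = den(15)

section \<open>The axioms as rewriting rules for programs\<close>

lemma eqv_assoc:
  assumes "distinct [x, y, z, u, v]"
  shows "eqv [(x, H), (y, H), (z, H)] [(v, H)] [bm x y u, bm u z v] [bm y z u, bm x u v]"
  by (rule eqvI[where f = "m \<cdot> (m \<otimes> \<one> H)",
      OF den_comp_eq[OF den_tensor[OF den_m[of x y u] den_H[of z]] den_m[of u z v]]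
        den_comp_eq[OF den_tensor[OF den_H[of x] den_m[of y z u]] den_m[of x u v]]])
    (use assms in \<open>auto simp: m_assoc comp_assoc_arr\<close>)

lemma eqv_unit_left:
  assumes "distinct [x, y, u]"
  shows "eqv [(x, H)] [(y, H)] [bu u, bm u x y] [bI H x y]"
  by (rule eqvI[where f = "\<one> H",
      OF den_comp_eq[OF den_tensor[OF den_u[of u] den_H[of x]] den_m[of u x y]]
        den_bIH[of x y]])
    (use assms in \<open>auto simp: unit_left comp_assoc_arr\<close>)

lemma eqv_unit_right:
  assumes "distinct [x, y, u]"
  shows "eqv [(x, H)] [(y, H)] [bu u, bm x u y] [bI H x y]"
  by (rule eqvI[where f = "\<one> H",
      OF den_comp_eq[OF den_tensor[OF den_H[of x] den_u[of u]] den_m[of x u y]]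
        den_bIH[of x y]])
    (use assms in \<open>auto simp: unit_right comp_assoc_arr\<close>)

lemma eqv_coassoc:
  assumes "distinct [x, y, a, b, c]"
  shows "eqv [(x, H)] [(a, H), (b, H), (c, H)] [bD x y c, bD y a b] [bD x a y, bD y b c]"
  by (rule eqvI[where f = "(\<Delta> \<otimes> \<one> H) \<cdot> \<Delta>",
      OF den_comp_eq[OF den_D[of x y c] den_tensor[OF den_D[of y a b] den_H[of c]]]
        den_comp_eq[OF den_D[of x a y] den_tensor[OF den_H[of a] den_D[of y b c]]]])
    (use assms in \<open>auto simp: coassoc comp_assoc_arr\<close>)

lemma eqv_counit_left:
  assumes "distinct [x, y, u]"
  shows "eqv [(x, H)] [(y, H)] [bD x u y, be u] [bI H x y]"
  by (rule eqvI[where f = "\<one> H",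
      OF den_comp_eq[OF den_D[of x u y] den_tensor[OF den_e[of u] den_H[of y]]]
        den_bIH[of x y]])
    (use assms in \<open>auto simp: counit_left comp_assoc_arr\<close>)

lemma eqv_counit_right:
  assumes "distinct [x, y, u]"
  shows "eqv [(x, H)] [(y, H)] [bD x y u, be u] [bI H x y]"
  by (rule eqvI[where f = "\<one> H",
      OF den_comp_eq[OF den_D[of x y u] den_tensor[OF den_H[of y] den_e[of u]]]
        den_bIH[of x y]])
    (use assms in \<open>auto simp: counit_right comp_assoc_arr\<close>)

lemma eqv_counit_mult:
  assumes "distinct [x, y, z]"
  shows "eqv [(x, H), (y, H)] [] [bm x y z, be z] [be x, be y]"
  by (rule eqvI[where f = "\<epsilon> \<cdot> m",
      OF den_comp_eq[OF den_m[of x y z] den_e[of z]]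
        den_tensor_eq[OF den_e[of x] den_e[of y]]])
    (use assms in \<open>auto simp: \<epsilon>_mult comp_assoc_arr\<close>)

lemma eqv_antipode_left:
  assumes "distinct [x, a, b, s, c]"
  shows "eqv [(x, H)] [(c, H)] [bD x a b, bS a s, bm s b c] [be x, bu c]"
  by (rule eqvI[where f = "\<eta> \<cdot> \<epsilon>",
      OF den_comp_eq[OF den_D[of x a b] den_comp[OF den_tensor[OF den_S[of a s] den_H[of b]] den_m[of s b c]]]
        den_comp_eq[OF den_e[of x] den_u[of c]]])
    (use assms in \<open>auto simp: antipode_left comp_assoc_arr\<close>)

lemma eqv_antipode_right:
  assumes "distinct [x, a, b, s, c]"
  shows "eqv [(x, H)] [(c, H)] [bD x a b, bS b s, bm a s c] [be x, bu c]"
  by (rule eqvI[where f = "\<eta> \<cdot> \<epsilon>",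
      OF den_comp_eq[OF den_D[of x a b] den_comp[OF den_tensor[OF den_H[of a] den_S[of b s]] den_m[of a s c]]]
        den_comp_eq[OF den_e[of x] den_u[of c]]])
    (use assms in \<open>auto simp: antipode_right comp_assoc_arr\<close>)

text \<open>The middle braiding of \<open>\<Delta>_mult\<close> leaves no box behind; it only
  decides which wires the two products take.\<close>

lemma eqv_comult_mult:
  assumes "distinct [x, y, z, a, b, x1, x2, y1, y2]"
  shows "eqv [(x, H), (y, H)] [(a, H), (b, H)] [bm x y z, bD z a b]
    [bD x x1 x2, bD y y1 y2, bm x1 y1 a, bm x2 y2 b]"
  by (rule eqvI[where f = "\<Delta> \<cdot> m",
      OF den_comp_eq[OF den_m[of x y z] den_D[of z a b]]
        den_comp_eq[OF den_tensor[OF den_D[of x x1 x2] den_D[of y y1 y2]]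
      den_comp[OF den_tensor[OF den_tensor[OF den_H[of x1] den_HH[of x2 y1]] den_H[of y2]]
        den_tensor[OF den_m[of x1 y1 a] den_m[of x2 y2 b]]]]])
    (use assms in \<open>auto simp: \<Delta>_mult comp_assoc_arr\<close>)

lemma eqv_pairing_mult:
  assumes "distinct [x, y, z, k, k1, k2]"
  shows "eqv [(x, N), (y, N), (k, H)] [] [bmN x y z, bp z k] [bD k k1 k2, bp x k1, bp y k2]"
  by (rule eqvI[where f = "p \<cdot> (mN \<otimes> \<one> H)",
      OF den_comp_eq[OF den_tensor[OF den_mN[of x y z] den_H[of k]] den_p[of z k]]
        den_comp_eq[OF den_tensor[OF den_tensor[OF den_N[of x] den_N[of y]] den_D[of k k1 k2]]
      den_comp[OF den_tensor[OF den_tensor[OF den_N[of x] den_NH[of y k1]] den_H[of k2]]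
        den_tensor[OF den_p[of x k1] den_p[of y k2]]]]])
    (use assms in \<open>auto simp: pairing_mult comp_assoc_arr\<close>)

lemma eqv_act_pairing:
  assumes "distinct [h, x, k, u, v]"
  shows "eqv [(h, H), (x, N), (k, H)] [] [ba h x u, bp u k] [bm k h v, bp x v]"
  by (rule eqvI[where f = "p \<cdot> (act \<otimes> \<one> H)",
      OF den_comp_eq[OF den_tensor[OF den_a[of h x u] den_H[of k]] den_p[of u k]]
        den_comp_eq[OF den_tensor[OF den_HN[of h x] den_H[of k]]
      den_comp[OF den_tensor[OF den_N[of x] den_HH[of h k]]
        den_comp[OF den_tensor[OF den_N[of x] den_m[of k h v]] den_p[of x v]]]]])
    (use assms in \<open>auto simp: act_pairing comp_assoc_arr\<close>)

lemma denotes_id_box: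
  assumes "distinct (us @ (x, V) # (y, V) # vs)" "V = H \<or> V = N" "set us \<union> set vs \<subseteq> wires"
  shows "denotes (\<one> (ob us \<boxtimes> V \<boxtimes> ob vs)) (us @ (x, V) # vs) (us @ (y, V) # vs) [bI V x y]"
proof -
  have b: "denotes (\<one> V) [(x, V)] [(y, V)] [bI V x y]" "denotes (\<one> (ob us)) us us []" "denotes (\<one> (ob vs)) vs vs []"
    using denotes_box[of "\<one> V" "[(x, V)]" "[(y, V)]"] assms by (auto intro!: denotes_ident)
  have "denotes (\<one> V \<otimes> \<one> (ob vs)) ([(x, V)] @ vs) ([(y, V)] @ vs) ([bI V x y] @ [])"
    by (rule denotes_tensor[OF b(1,3)]) (use assms in \<open>auto simp: hom_iff\<close>)
  from denotes_tensor[OF b(2) this] show ?thesis using assms by (auto simp: hom_iff)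
qed

lemma eqv_id_in:
  assumes "F \<in> hom C (ob (us @ (x, V) # vs)) (ob ys)" "distinct (us @ (x, V) # (y, V) # vs @ ys)"
    "V = H \<or> V = N" "set us \<union> set vs \<union> set ys \<subseteq> wires"
  shows "eqv (us @ (x, V) # vs) ys [bI V x y, (F, us @ (y, V) # vs, ys)] [(F, us @ (x, V) # vs, ys)]"
proof (rule eqvI)
  have F: "F \<in> Arr C" "src C F = ob us \<boxtimes> V \<boxtimes> ob vs" "tgt C F = ob ys"
    using assms by (auto simp: hom_iff)
  show "denotes F (us @ (x, V) # vs) ys [(F, us @ (x, V) # vs, ys)]"
    using assms by (intro denotes_box) auto
  have y: "denotes F (us @ (y, V) # vs) ys [(F, us @ (y, V) # vs, ys)]"
    using assms by (intro denotes_box) auto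
  have "denotes (F \<cdot> \<one> (ob us \<boxtimes> V \<boxtimes> ob vs)) (us @ (x, V) # vs) ys ([bI V x y] @ [(F, us @ (y, V) # vs, ys)])"
    by (rule denotes_comp[OF denotes_id_box y]) (use assms in \<open>auto simp: hom_iff\<close>)
  then show "denotes F (us @ (x, V) # vs) ys [bI V x y, (F, us @ (y, V) # vs, ys)]"
    using F by simp
qed

lemma eqv_id_out:
  assumes "F \<in> hom C (ob xs) (ob (us @ (y, V) # vs))" "distinct (xs @ us @ (x, V) # (y, V) # vs)"
    "V = H \<or> V = N" "set us \<union> set vs \<union> set xs \<subseteq> wires"
  shows "eqv xs (us @ (y, V) # vs) [(F, xs, us @ (x, V) # vs), bI V x y] [(F, xs, us @ (y, V) # vs)]"
proof (rule eqvI)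
  have F: "F \<in> Arr C" "tgt C F = ob us \<boxtimes> V \<boxtimes> ob vs" "src C F = ob xs"
    using assms by (auto simp: hom_iff)
  show "denotes F xs (us @ (y, V) # vs) [(F, xs, us @ (y, V) # vs)]"
    using assms by (intro denotes_box) auto
  have x: "denotes F xs (us @ (x, V) # vs) [(F, xs, us @ (x, V) # vs)]"
    using assms by (intro denotes_box) auto
  have "denotes (\<one> (ob us \<boxtimes> V \<boxtimes> ob vs) \<cdot> F) xs (us @ (y, V) # vs) ([(F, xs, us @ (x, V) # vs)] @ [bI V x y])"
    by (rule denotes_comp[OF x denotes_id_box]) (use assms in \<open>auto simp: hom_iff\<close>)
  then show "denotes F xs (us @ (y, V) # vs) [(F, xs, us @ (x, V) # vs), bI V x y]"
    using F by simp
qed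

text \<open>This is \<open>faithful_left\<close> for \<open>V = \<I>\<close> in program form: the
  output \<open>z\<close> of both programs is paired with a new wire \<open>k\<close> of type
  \<open>H\<close>.\<close>

lemma faithful_denotes:
  assumes e: "eqv (ws @ [(k, H)]) [] (P @ [bp z k]) (Q @ [bp z k])"
    and P: "denotes f ws [(z, N)] P" and Q: "denotes g ws [(z, N)] Q"
    and k: "(k, H) \<notin> set ws" "k \<noteq> z"
  shows "f = g"
proof -
  have ok: "ok (set (ws @ [(k, H)])) (P @ [bp z k])" "ok (set (ws @ [(k, H)])) (Q @ [bp z k])"
    using e by (auto simp: eqv_def denotes_def)
  have w: "f \<in> hom C (ob ws) N" "g \<in> hom C (ob ws) N" "set ws \<subseteq> wires"
    using denotes_arr[OF P] denotes_arr[OF Q] P by (auto simp: hom_iff denotes_def)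
  have "denotes (p \<cdot> (h \<otimes> \<one> H)) (ws @ [(k, H)]) [] (R @ [bp z k])"
    if "denotes h ws [(z, N)] R" "ok (set (ws @ [(k, H)])) (R @ [bp z k])" for h R
    using denotes_comp[OF denotes_tensor[OF that(1) den_H[of k]], of p "[]" "[bp z k]"] den_p[of z k]
      that k ok_append[OF that(2)] by simp
  from eqv_eq[OF e this[OF P ok(1)] this[OF Q ok(2)]] show ?thesis
    using faithful_left[of "ob ws" \<I> f g] w by (simp add: hom_iff)
qed

end

section \<open>Identities for the antipode and the action\<close>

context symmetric_quasi_dual
begin

text \<open>Paired with \<open>k\<close>, the claim is
  \<open>\<langle>x, k 1\<rangle> = \<langle>x, k\<rangle>\<close>. The final renaming box gives
  both programs the same output wire 3, as \<open>faithful_denotes\<close> demands.\<close>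

lemma act_unit: "act \<cdot> (\<eta> \<otimes> \<one> N) = \<one> N"
proof -
  let ?ws = "[(1, N), (2, H)]" and ?zs = "[] :: (nat \<times> 'o) list"
  have "eqv ?ws ?zs [bu 4, ba 4 1 3, bp 3 2]
      [bu 4, bm 2 4 5, bp 1 5]"
    by (rule eqv_at[OF eqv_act_pairing[of 4 1 2 3 5], of _ 1]) simp_all
  also have "eqv ?ws ?zs \<dots>
      [bI H 2 5, bp 1 5]"
    by (rule eqv_at[OF eqv_unit_right[of 2 5 4], of _ 0]) simp_all
  also have "eqv ?ws ?zs \<dots>
      [bp 1 2]"
    by (rule eqv_at[OF eqv_id_in[of p "[(1, N)]" 2 H "[]" "[]" 5], of _ 0]) simp_all
  also have "eqv ?ws ?zs \<dots>
      [bI N 1 3, bp 3 2]"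
    by (rule eqv_at[OF eqv_sym[OF eqv_id_in[of p "[]" 1 N "[(2, H)]" "[]" 3]], of _ 0]) simp_all
  finally have e: "eqv ([(1, N)] @ [(2, H)]) [] ([bu 4, ba 4 1 3] @ [bp 3 2]) ([bI N 1 3] @ [bp 3 2])" by simp
  show ?thesis
    by (rule faithful_denotes[OF e den_comp_eq[OF den_tensor[OF den_u[of 4] den_N[of 1]] den_a[of 4 1 3]]
          den_bIN[of 1 3]]) simp_all
qed

lemma eqv_act_unit:
  assumes "distinct [x, y, u]"
  shows "eqv [(x, N)] [(y, N)] [bu u, ba u x y] [bI N x y]"
  by (rule eqvI[where f = "\<one> N",
      OF den_comp_eq[OF den_tensor[OF den_u[of u] den_N[of x]] den_a[of u x y]]
        den_bIN[of x y]])
    (use assms in \<open>auto simp: act_unit comp_assoc_arr\<close>)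

lemma act_assoc: "act \<cdot> (m \<otimes> \<one> N) = act \<cdot> (\<one> H \<otimes> act)"
proof -
  let ?ws = "[(1, H), (2, H), (3, N), (4, H)]" and ?zs = "[] :: (nat \<times> 'o) list"
  have "eqv ?ws ?zs [bm 1 2 5, ba 5 3 6, bp 6 4]
      [bm 1 2 5, bm 4 5 7, bp 3 7]"
    by (rule eqv_at[OF eqv_act_pairing[of 5 3 4 6 7], of _ 1]) simp_all
  also have "eqv ?ws ?zs \<dots>
      [bm 4 1 5, bm 5 2 7, bp 3 7]"
    by (rule eqv_at[OF eqv_sym[OF eqv_assoc[of 4 1 2 5 7]], of _ 0]) simp_all
  also have "eqv ?ws ?zs \<dots>
      [ba 2 3 8, bm 4 1 5, bp 8 5]"
    by (rule eqv_at[OF eqv_sym[OF eqv_act_pairing[of 2 3 5 8 7]], of _ 1]) simp_all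
  also have "eqv ?ws ?zs \<dots>
      [ba 2 3 8, ba 1 8 6, bp 6 4]"
    by (rule eqv_at[OF eqv_sym[OF eqv_act_pairing[of 1 8 4 6 5]], of _ 1]) simp_all
  finally have e: "eqv ([(1, H), (2, H), (3, N)] @ [(4, H)]) []
    ([bm 1 2 5, ba 5 3 6] @ [bp 6 4]) ([ba 2 3 8, ba 1 8 6] @ [bp 6 4])" by simp
  show ?thesis
    by (rule faithful_denotes[OF e den_comp_eq[OF den_tensor[OF den_m[of 1 2 5] den_N[of 3]] den_a[of 5 3 6]]
          den_comp_eq[OF den_tensor[OF den_H[of 1] den_a[of 2 3 8]] den_a[of 1 8 6]]]) simp_all
qed

lemma eqv_act_assoc:
  assumes "distinct [h, k, x, u, y, z]"
  shows "eqv [(h, H), (k, H), (x, N)] [(z, N)] [bm h k u, ba u x z] [ba k x y, ba h y z]"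
  by (rule eqvI[where f = "act \<cdot> (m \<otimes> \<one> N)",
      OF den_comp_eq[OF den_tensor[OF den_m[of h k u] den_N[of x]] den_a[of u x z]]
        den_comp_eq[OF den_tensor[OF den_H[of h] den_a[of k x y]] den_a[of h y z]]])
    (use assms in \<open>auto simp: act_assoc comp_assoc_arr\<close>)

text \<open>Multiplicativity of \<open>\<Delta>\<close> under the pairing: \<open>\<langle>x y, k
  h\<rangle> = \<langle>x, k\<^sub>1 h\<^sub>1\<rangle> \<langle>y, k\<^sub>2
  h\<^sub>2\<rangle>\<close>, where each factor is again a pairing with an action.\<close>

lemma act_mult: "act \<cdot> (\<one> H \<otimes> mN) = mN \<cdot> (act \<otimes> act) \<cdot> (\<one> H \<otimes> \<sigma> H N \<otimes> \<one> N) \<cdot> (\<Delta> \<otimes> \<one> N \<otimes> \<one> N)"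
proof -
  let ?ws = "[(1, H), (2, N), (3, N), (4, H)]" and ?zs = "[] :: (nat \<times> 'o) list"
  have "eqv ?ws ?zs [bmN 2 3 5, ba 1 5 6, bp 6 4]
      [bm 4 1 10, bmN 2 3 5, bp 5 10]"
    by (rule eqv_at[OF eqv_act_pairing[of 1 5 4 6 10], of _ 1]) simp_all
  also have "eqv ?ws ?zs \<dots>
      [bm 4 1 10, bD 10 15 16, bp 2 15, bp 3 16]"
    by (rule eqv_at[OF eqv_pairing_mult[of 2 3 5 10 15 16], of _ 1]) simp_all
  also have "eqv ?ws ?zs \<dots>
      [bD 4 11 12, bD 1 13 14, bm 11 13 15, bp 2 15, bm 12 14 16, bp 3 16]"
    by (rule eqv_at[OF eqv_comult_mult[of 4 1 10 15 16 11 12 13 14], of _ 0]) simp_all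
  also have "eqv ?ws ?zs \<dots>
      [bD 4 11 12, bD 1 13 14, bm 12 14 16, bp 3 16, ba 13 2 8, bp 8 11]"
    by (rule eqv_at[OF eqv_sym[OF eqv_act_pairing[of 13 2 11 8 15]], of _ 2]) simp_all
  also have "eqv ?ws ?zs \<dots>
      [bD 1 13 14, ba 14 3 9, ba 13 2 8, bD 4 11 12, bp 8 11, bp 9 12]"
    by (rule eqv_at[OF eqv_sym[OF eqv_act_pairing[of 14 3 12 9 16]], of _ 2]) simp_all
  also have "eqv ?ws ?zs \<dots>
      [bD 1 13 14, ba 13 2 8, ba 14 3 9, bmN 8 9 6, bp 6 4]"
    by (rule eqv_at[OF eqv_sym[OF eqv_pairing_mult[of 8 9 6 4 11 12]], of _ 3]) simp_all
  finally have e: "eqv ([(1, H), (2, N), (3, N)] @ [(4, H)]) [] ([bmN 2 3 5, ba 1 5 6] @ [bp 6 4])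
    ([bD 1 13 14, ba 13 2 8, ba 14 3 9, bmN 8 9 6] @ [bp 6 4])" by simp
  show ?thesis
    by (rule faithful_denotes[OF e den_comp_eq[OF den_tensor[OF den_H[of 1] den_mN[of 2 3 5]] den_a[of 1 5 6]]
        den_comp_eq[OF den_tensor[OF den_D[of 1 13 14] den_tensor[OF den_N[of 2] den_N[of 3]]]
          den_comp[OF den_tensor[OF den_H[of 13] den_tensor[OF den_HN[of 14 2] den_N[of 3]]]
            den_comp[OF den_tensor[OF den_a[of 13 2 8] den_a[of 14 3 9]] den_mN[of 8 9 6]]]]])
      (simp_all add: comp_assoc_arr)
qed

lemma eqv_act_mult:
  assumes "distinct [h, x, y, z, w, a, b, u, v]"
  shows "eqv [(h, H), (x, N), (y, N)] [(w, N)] [bmN x y z, ba h z w] [bD h a b, ba a x u, ba b y v, bmN u v w]"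
  by (rule eqvI[where f = "act \<cdot> (\<one> H \<otimes> mN)",
      OF den_comp_eq[OF den_tensor[OF den_H[of h] den_mN[of x y z]] den_a[of h z w]]
        den_comp_eq[OF den_tensor[OF den_D[of h a b] den_tensor[OF den_N[of x] den_N[of y]]]
      den_comp[OF den_tensor[OF den_H[of a] den_tensor[OF den_HN[of b x] den_N[of y]]]
        den_comp[OF den_tensor[OF den_a[of a x u] den_a[of b y v]] den_mN[of u v w]]]]])
    (use assms in \<open>auto simp: act_mult comp_assoc_arr\<close>)

text \<open>Both sides equal \<open>S (h\<^sub>1 k\<^sub>1) (h\<^sub>2 k\<^sub>2 (S k\<^sub>3 S h\<^sub>3))\<close>.\<close>

lemma antipode_mult: "S \<cdot> m = m \<cdot> (S \<otimes> S) \<cdot> \<sigma> H H"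
proof -
  let ?ws = "[(1, H), (2, H)]" and ?zs = "[(3, H)]"
  \<comment> \<open>First \<open>k\<^sub>2 S k\<^sub>3\<close> and then
    \<open>h\<^sub>2 S h\<^sub>3\<close> cancel, from the inside outwards, which leaves
    \<open>S (h k)\<close>.\<close>
  have "eqv ?ws ?zs [bD 1 4 5, bD 5 6 7, bD 2 8 9, bD 9 10 11, bm 4 8 12, bS 12 13, bm 6 10 14, bS 7 15, bS 11 16, bm 16 15 17, bm 14 17 18, bm 13 18 3]
      [bD 1 4 5, bD 5 6 7, bD 2 8 9, bD 9 10 11, bm 6 10 14, bS 7 15, bS 11 16, bm 16 15 17, bm 14 17 18, bm 4 8 12, bS 12 13, bm 13 18 3]"
    by (rule eqv_reorder) simp_all
  also have "eqv ?ws ?zs \<dots>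
      [bD 1 4 5, bD 5 6 7, bD 2 8 9, bD 9 10 11, bS 11 16, bm 6 10 14, bm 14 16 17, bS 7 15, bm 17 15 18, bm 4 8 12, bS 12 13, bm 13 18 3]"
    by (rule eqv_at[OF eqv_sym[OF eqv_assoc[of 14 16 15 17 18]], of _ 7]) simp_all
  also have "eqv ?ws ?zs \<dots>
      [bD 2 8 9, bD 9 10 11, bS 11 16, bm 10 16 14, bD 1 4 5, bD 5 6 7, bm 6 14 17, bS 7 15, bm 17 15 18, bm 4 8 12, bS 12 13, bm 13 18 3]"
    by (rule eqv_at[OF eqv_assoc[of 6 10 16 14 17], of _ 5]) simp_all
  also have "eqv ?ws ?zs \<dots>
      [bD 1 4 5, bD 5 6 7, bu 14, bm 6 14 17, bD 2 8 9, be 9, bS 7 15, bm 17 15 18, bm 4 8 12, bS 12 13, bm 13 18 3]"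
    by (rule eqv_at[OF eqv_antipode_right[of 9 10 11 16 14], of _ 1]) simp_all
  also have "eqv ?ws ?zs \<dots>
      [bD 1 4 5, bD 5 6 7, bS 7 15, bI H 6 17, bm 17 15 18, bD 2 8 9, be 9, bm 4 8 12, bS 12 13, bm 13 18 3]"
    by (rule eqv_at[OF eqv_unit_right[of 6 17 14], of _ 2]) simp_all
  also have "eqv ?ws ?zs \<dots>
      [bD 1 4 5, bD 5 6 7, bS 7 15, bm 6 15 18, bD 2 8 9, be 9, bm 4 8 12, bS 12 13, bm 13 18 3]"
    by (rule eqv_at[OF eqv_id_in[of m "[]" 6 H "[(15, H)]" "[(18, H)]" 17], of _ 3]) simp_all
  also have "eqv ?ws ?zs \<dots>
      [bD 1 4 5, bD 2 8 9, bm 4 8 12, bS 12 13, bu 18, bm 13 18 3, be 5, be 9]"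
    by (rule eqv_at[OF eqv_antipode_right[of 5 6 7 15 18], of _ 1]) simp_all
  also have "eqv ?ws ?zs \<dots>
      [bD 1 4 5, be 5, bD 2 8 9, bm 4 8 12, bS 12 13, bI H 13 3, be 9]"
    by (rule eqv_at[OF eqv_unit_right[of 13 3 18], of _ 4]) simp_all
  also have "eqv ?ws ?zs \<dots>
      [bD 2 8 9, be 9, bI H 1 4, bm 4 8 12, bS 12 13, bI H 13 3]"
    by (rule eqv_at[OF eqv_counit_right[of 1 4 5], of _ 0]) simp_all
  also have "eqv ?ws ?zs \<dots>
      [bI H 2 8, bI H 1 4, bm 4 8 12, bS 12 13, bI H 13 3]"
    by (rule eqv_at[OF eqv_counit_right[of 2 8 9], of _ 0]) simp_all
  also have "eqv ?ws ?zs \<dots>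
      [bI H 2 8, bm 1 8 12, bS 12 13, bI H 13 3]"
    by (rule eqv_at[OF eqv_id_in[of m "[]" 1 H "[(8, H)]" "[(12, H)]" 4], of _ 1]) simp_all
  also have "eqv ?ws ?zs \<dots>
      [bm 1 2 12, bS 12 13, bI H 13 3]"
    by (rule eqv_at[OF eqv_id_in[of m "[(1, H)]" 2 H "[]" "[(12, H)]" 8], of _ 0]) simp_all
  also have "eqv ?ws ?zs \<dots>
      [bm 1 2 12, bS 12 3]"
    by (rule eqv_at[OF eqv_id_out[of S "[(12, H)]" "[]" 3 H "[]" 13], of _ 1]) simp_all
  finally have A: "eqv ?ws ?zs [bD 1 4 5, bD 5 6 7, bD 2 8 9, bD 9 10 11, bm 4 8 12, bS 12 13, bm 6 10 14, bS 7 15, bS 11 16, bm 16 15 17, bm 14 17 18, bm 13 18 3] [bm 1 2 12, bS 12 3]" .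
  \<comment> \<open>With the coproducts rebracketed, the legs \<open>h\<^sub>1 k\<^sub>1\<close> and
    \<open>h\<^sub>2 k\<^sub>2\<close> form the coproduct of a single product, so
    \<open>eqv_antipode_left\<close> and \<open>eqv_counit_mult\<close> leave
    \<open>S k S h\<close>.\<close>
  have "eqv ?ws ?zs [bD 1 4 5, bD 5 6 7, bD 2 8 9, bD 9 10 11, bm 4 8 12, bS 12 13, bm 6 10 14, bS 7 15, bS 11 16, bm 16 15 17, bm 14 17 18, bm 13 18 3]
      [bD 2 8 9, bD 9 10 11, bD 1 5 7, bD 5 4 6, bm 4 8 12, bS 12 13, bm 6 10 14, bS 7 15, bS 11 16, bm 16 15 17, bm 14 17 18, bm 13 18 3]"
    by (rule eqv_at[OF eqv_sym[OF eqv_coassoc[of 1 5 4 6 7]], of _ 0]) simp_all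
  also have "eqv ?ws ?zs \<dots>
      [bD 2 9 11, bD 9 8 10, bD 1 5 7, bD 5 4 6, bm 4 8 12, bS 12 13, bm 6 10 14, bS 7 15, bS 11 16, bm 16 15 17, bm 14 17 18, bm 13 18 3]"
    by (rule eqv_at[OF eqv_sym[OF eqv_coassoc[of 2 9 8 10 11]], of _ 0]) simp_all
  also have "eqv ?ws ?zs \<dots>
      [bD 2 9 11, bD 1 5 7, bD 5 4 6, bD 9 8 10, bm 4 8 12, bm 6 10 14, bS 12 13, bS 7 15, bS 11 16, bm 16 15 17, bm 13 14 18, bm 18 17 3]"
    by (rule eqv_at[OF eqv_sym[OF eqv_assoc[of 13 14 17 18 3]], of _ 10]) simp_all
  also have "eqv ?ws ?zs \<dots>
      [bD 2 9 11, bD 1 5 7, bm 5 9 22, bD 22 12 14, bS 12 13, bm 13 14 18, bS 7 15, bS 11 16, bm 16 15 17, bm 18 17 3]"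
    by (rule eqv_at[OF eqv_sym[OF eqv_comult_mult[of 5 9 22 12 14 4 6 8 10]], of _ 2]) simp_all
  also have "eqv ?ws ?zs \<dots>
      [bD 2 9 11, bD 1 5 7, bS 7 15, bS 11 16, bm 16 15 17, bu 18, bm 18 17 3, bm 5 9 22, be 22]"
    by (rule eqv_at[OF eqv_antipode_left[of 22 12 14 13 18], of _ 3]) simp_all
  also have "eqv ?ws ?zs \<dots>
      [bD 2 9 11, bD 1 5 7, bm 5 9 22, be 22, bS 7 15, bS 11 16, bm 16 15 17, bI H 17 3]"
    by (rule eqv_at[OF eqv_unit_left[of 17 3 18], of _ 5]) simp_all
  also have "eqv ?ws ?zs \<dots>
      [bD 1 5 7, be 5, bD 2 9 11, be 9, bS 7 15, bS 11 16, bm 16 15 17, bI H 17 3]"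
    by (rule eqv_at[OF eqv_counit_mult[of 5 9 22], of _ 2]) simp_all
  also have "eqv ?ws ?zs \<dots>
      [bD 2 9 11, be 9, bI H 1 7, bS 7 15, bS 11 16, bm 16 15 17, bI H 17 3]"
    by (rule eqv_at[OF eqv_counit_left[of 1 7 5], of _ 0]) simp_all
  also have "eqv ?ws ?zs \<dots>
      [bI H 1 7, bS 7 15, bI H 2 11, bS 11 16, bm 16 15 17, bI H 17 3]"
    by (rule eqv_at[OF eqv_counit_left[of 2 11 9], of _ 0]) simp_all
  also have "eqv ?ws ?zs \<dots>
      [bI H 2 11, bS 11 16, bS 1 15, bm 16 15 17, bI H 17 3]"
    by (rule eqv_at[OF eqv_id_in[of S "[]" 1 H "[]" "[(15, H)]" 7], of _ 0]) simp_all
  also have "eqv ?ws ?zs \<dots>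
      [bS 2 16, bS 1 15, bm 16 15 17, bI H 17 3]"
    by (rule eqv_at[OF eqv_id_in[of S "[]" 2 H "[]" "[(16, H)]" 11], of _ 0]) simp_all
  also have "eqv ?ws ?zs \<dots>
      [bS 2 16, bS 1 15, bm 16 15 3]"
    by (rule eqv_at[OF eqv_id_out[of m "[(16, H), (15, H)]" "[]" 3 H "[]" 17], of _ 2]) simp_all
  finally have B: "eqv ?ws ?zs [bD 1 4 5, bD 5 6 7, bD 2 8 9, bD 9 10 11, bm 4 8 12, bS 12 13, bm 6 10 14, bS 7 15, bS 11 16, bm 16 15 17, bm 14 17 18, bm 13 18 3] [bS 2 16, bS 1 15, bm 16 15 3]" .
  show ?thesis
    by (rule eqv_eq[OF eqv_trans[OF eqv_sym[OF A] B] den_comp_eq[OF den_m[of 1 2 12] den_S[of 12 3]]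
        den_comp_eq[OF den_HH[of 1 2] den_comp[OF den_tensor[OF den_S[of 2 16] den_S[of 1 15]] den_m[of 16 15 3]]]])
      (simp_all add: comp_assoc_arr)
qed

lemma eqv_antipode_mult:
  assumes "distinct [h, k, a, b, s, t]"
  shows "eqv [(h, H), (k, H)] [(b, H)] [bm h k a, bS a b] [bS k t, bS h s, bm t s b]"
  by (rule eqvI[where f = "S \<cdot> m",
      OF den_comp_eq[OF den_m[of h k a] den_S[of a b]]
        den_comp_eq[OF den_HH[of h k] den_comp[OF den_tensor[OF den_S[of k t] den_S[of h s]] den_m[of t s b]]]])
    (use assms in \<open>auto simp: antipode_mult comp_assoc_arr\<close>)

text \<open>\<open>y (S h \<rightharpoonup> x) = S h\<^sub>1 \<rightharpoonup> ((h\<^sub>2 \<rightharpoonup> y) x)\<close>; both sides equal \<open>S h\<^sub>1 \<rightharpoonup> (h\<^sub>2 \<rightharpoonup> y (S h\<^sub>3 \<rightharpoonup> x))\<close>.\<close>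

lemma eqv_mult_act_antipode: "eqv [(1, H), (2, N), (3, N)] [(4, N)]
    [bS 1 10, ba 10 3 11, bmN 2 11 4]
    [bD 1 5 6, ba 6 2 16, bmN 16 3 13, bS 5 9, ba 9 13 4]"
proof -
  let ?ws = "[(1, H), (2, N), (3, N)]" and ?zs = "[(4, N)]"
  \<comment> \<open>The two outer actions merge into that of \<open>S h\<^sub>1 h\<^sub>2\<close>,
    which cancels.\<close>
  have "eqv ?ws ?zs [bD 1 5 6, bD 6 7 8, bS 5 9, bS 8 10, ba 10 3 11, bmN 2 11 12, ba 7 12 13, ba 9 13 4]
      [bD 1 5 6, bD 6 7 8, bS 5 9, bS 8 10, ba 10 3 11, bmN 2 11 12, bm 9 7 19, ba 19 12 4]"
    by (rule eqv_at[OF eqv_sym[OF eqv_act_assoc[of 9 7 12 19 13 4]], of _ 6]) simp_all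
  also have "eqv ?ws ?zs \<dots>
      [bD 1 6 8, bD 6 5 7, bS 5 9, bm 9 7 19, bS 8 10, ba 10 3 11, bmN 2 11 12, ba 19 12 4]"
    by (rule eqv_at[OF eqv_sym[OF eqv_coassoc[of 1 6 5 7 8]], of _ 0]) simp_all
  also have "eqv ?ws ?zs \<dots>
      [bD 1 6 8, bS 8 10, ba 10 3 11, bmN 2 11 12, bu 19, ba 19 12 4, be 6]"
    by (rule eqv_at[OF eqv_antipode_left[of 6 5 7 9 19], of _ 1]) simp_all
  also have "eqv ?ws ?zs \<dots>
      [bD 1 6 8, be 6, bS 8 10, ba 10 3 11, bmN 2 11 12, bI N 12 4]"
    by (rule eqv_at[OF eqv_act_unit[of 12 4 19], of _ 4]) simp_all
  also have "eqv ?ws ?zs \<dots>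
      [bI H 1 8, bS 8 10, ba 10 3 11, bmN 2 11 12, bI N 12 4]"
    by (rule eqv_at[OF eqv_counit_left[of 1 8 6], of _ 0]) simp_all
  also have "eqv ?ws ?zs \<dots>
      [bS 1 10, ba 10 3 11, bmN 2 11 12, bI N 12 4]"
    by (rule eqv_at[OF eqv_id_in[of S "[]" 1 H "[]" "[(10, H)]" 8], of _ 0]) simp_all
  also have "eqv ?ws ?zs \<dots>
      [bS 1 10, ba 10 3 11, bmN 2 11 4]"
    by (rule eqv_at[OF eqv_id_out[of mN "[(2, N), (11, N)]" "[]" 4 N "[]" 12], of _ 2]) simp_all
  finally have A: "eqv ?ws ?zs [bD 1 5 6, bD 6 7 8, bS 5 9, bS 8 10, ba 10 3 11, bmN 2 11 12, ba 7 12 13, ba 9 13 4] [bS 1 10, ba 10 3 11, bmN 2 11 4]" .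
  \<comment> \<open>The action of \<open>h\<^sub>2\<close> is distributed over the product by
    \<open>eqv_act_mult\<close>; the half that falls on
    \<open>S h\<^sub>3 \<rightharpoonup> x\<close> cancels against
    \<open>S h\<^sub>3\<close>.\<close>
  have "eqv ?ws ?zs [bD 1 5 6, bD 6 7 8, bS 5 9, bS 8 10, ba 10 3 11, bmN 2 11 12, ba 7 12 13, ba 9 13 4]
      [bD 1 5 6, bD 6 7 8, bS 8 10, ba 10 3 11, bmN 2 11 12, ba 7 12 13, bS 5 9, ba 9 13 4]"
    by (rule eqv_reorder) simp_all
  also have "eqv ?ws ?zs \<dots>
      [bD 1 5 6, bD 6 7 8, bS 8 10, bD 7 14 15, ba 10 3 11, ba 15 11 17, ba 14 2 16, bmN 16 17 13, bS 5 9, ba 9 13 4]"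
    by (rule eqv_at[OF eqv_act_mult[of 7 2 11 12 13 14 15 16 17], of _ 4]) simp_all
  also have "eqv ?ws ?zs \<dots>
      [bD 1 5 6, bD 6 7 8, bD 7 14 15, bS 8 10, bm 15 10 18, ba 18 3 17, ba 14 2 16, bmN 16 17 13, bS 5 9, ba 9 13 4]"
    by (rule eqv_at[OF eqv_sym[OF eqv_act_assoc[of 15 10 3 18 11 17]], of _ 4]) simp_all
  also have "eqv ?ws ?zs \<dots>
      [bD 1 5 6, bD 6 14 7, bD 7 15 8, bS 8 10, bm 15 10 18, ba 18 3 17, ba 14 2 16, bmN 16 17 13, bS 5 9, ba 9 13 4]"
    by (rule eqv_at[OF eqv_coassoc[of 6 7 14 15 8], of _ 1]) simp_all
  also have "eqv ?ws ?zs \<dots>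
      [bu 18, ba 18 3 17, bD 1 5 6, bD 6 14 7, be 7, ba 14 2 16, bmN 16 17 13, bS 5 9, ba 9 13 4]"
    by (rule eqv_at[OF eqv_antipode_right[of 7 15 8 10 18], of _ 2]) simp_all
  also have "eqv ?ws ?zs \<dots>
      [bD 1 5 6, bD 6 14 7, be 7, bI N 3 17, ba 14 2 16, bmN 16 17 13, bS 5 9, ba 9 13 4]"
    by (rule eqv_at[OF eqv_act_unit[of 3 17 18], of _ 0]) simp_all
  also have "eqv ?ws ?zs \<dots>
      [bD 1 5 6, bI H 6 14, ba 14 2 16, bI N 3 17, bmN 16 17 13, bS 5 9, ba 9 13 4]"
    by (rule eqv_at[OF eqv_counit_right[of 6 14 7], of _ 1]) simp_all
  also have "eqv ?ws ?zs \<dots>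
      [bD 1 5 6, ba 6 2 16, bI N 3 17, bmN 16 17 13, bS 5 9, ba 9 13 4]"
    by (rule eqv_at[OF eqv_id_in[of act "[]" 6 H "[(2, N)]" "[(16, N)]" 14], of _ 1]) simp_all
  also have "eqv ?ws ?zs \<dots>
      [bD 1 5 6, ba 6 2 16, bmN 16 3 13, bS 5 9, ba 9 13 4]"
    by (rule eqv_at[OF eqv_id_in[of mN "[(16, N)]" 3 N "[]" "[(13, N)]" 17], of _ 2]) simp_all
  finally show ?thesis by (rule eqv_trans[OF eqv_sym[OF A]])
qed

end

section \<open>The Hopf module\<close>

context symmetric_quasi_dual
begin

section \<open>The right module structure on the ideal\<close>

lemma ideal_arr [simp]:
  "N' \<in> Obj C" "i \<in> Arr C" "src C i = N'" "tgt C i = N"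
  "m' \<in> Arr C" "src C m' = N \<boxtimes> N'" "tgt C m' = N'"
  "act' \<in> Arr C" "src C act' = H \<boxtimes> N'" "tgt C act' = N'"
  "\<rho> \<in> Arr C" "src C \<rho> = N'" "tgt C \<rho> = N' \<boxtimes> H"
  using N.ideal_obj N.incl_hom N.ideal_mult_hom act'_hom \<rho>_hom by (auto simp: hom_iff)

lemma incl_cancel:
  assumes "f \<in> Arr C" "g \<in> Arr C" "src C f = src C g" "tgt C f = N'" "tgt C g = N'" "i \<cdot> f = i \<cdot> g"
  shows "f = g"
  using N.incl_monic[unfolded monic_def, THEN conjunct2, rule_format, of "src C f" f g] assms
  by (simp add: hom_iff)

text \<open>As the unit is grouplike, \<open>antipode_left\<close> evaluated at it reads
  \<open>S 1 1 = 1\<close>.\<close>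

lemma antipode_unit: "S \<cdot> \<eta> = \<eta>"
proof -
  have "m \<cdot> (S \<otimes> \<one> H) \<cdot> \<Delta> \<cdot> \<eta> = (m \<cdot> (S \<otimes> \<one> H) \<cdot> \<Delta>) \<cdot> \<eta>"
    by (simp add: comp_assoc_arr)
  also have "\<dots> = \<eta>"
    unfolding antipode_left by (simp add: comp_assoc_arr \<epsilon>_unit)
  finally have "\<eta> = m \<cdot> ((S \<cdot> \<eta>) \<otimes> \<eta>)"
    by (simp add: \<Delta>_unit interchange_arr)
  also have "(S \<cdot> \<eta>) \<otimes> \<eta> = (\<one> H \<otimes> \<eta>) \<cdot> (S \<cdot> \<eta>)"
    using interchange_arr[of "S \<cdot> \<eta>" "\<one> H" "\<one> \<I>" \<eta>] by simp
  also have "m \<cdot> (\<one> H \<otimes> \<eta>) \<cdot> (S \<cdot> \<eta>) = (m \<cdot> (\<one> H \<otimes> \<eta>)) \<cdot> (S \<cdot> \<eta>)"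
    by (simp add: comp_assoc_arr)
  finally show ?thesis by (simp add: unit_right)
qed

text \<open>\<open>ract'\<close> below is the action of the theorem; \<open>ract\<close> is the same
  formula on all of \<open>N\<close>, where programs are available.\<close>

definition ract where
  "ract = act \<cdot> (S \<otimes> \<one> N) \<cdot> \<sigma> N H"

definition ract' where
  "ract' = act' \<cdot> (S \<otimes> \<one> N') \<cdot> \<sigma> N' H"

lemma ract_arr [simp]:
  "ract \<in> Arr C" "src C ract = N \<boxtimes> H" "tgt C ract = N"
  "ract' \<in> Arr C" "src C ract' = N' \<boxtimes> H" "tgt C ract' = N'"
  by (simp_all add: ract_def ract'_def)

lemma incl_ract: "i \<cdot> ract' = ract \<cdot> (i \<otimes> \<one> H)"
proof -
  have "i \<cdot> ract' = (i \<cdot> act') \<cdot> (S \<otimes> \<one> N') \<cdot> \<sigma> N' H"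
    by (simp add: ract'_def comp_assoc_arr)
  also have "\<dots> = act \<cdot> ((\<one> H \<otimes> i) \<cdot> (S \<otimes> \<one> N')) \<cdot> \<sigma> N' H"
    by (simp add: act'_restricts comp_assoc_arr)
  also have "(\<one> H \<otimes> i) \<cdot> (S \<otimes> \<one> N') = (S \<otimes> \<one> N) \<cdot> (\<one> H \<otimes> i)"
    by (simp add: interchange_arr)
  also have "act \<cdot> ((S \<otimes> \<one> N) \<cdot> (\<one> H \<otimes> i)) \<cdot> \<sigma> N' H = act \<cdot> (S \<otimes> \<one> N) \<cdot> ((\<one> H \<otimes> i) \<cdot> \<sigma> N' H)"
    by (simp add: comp_assoc_arr)
  also have "(\<one> H \<otimes> i) \<cdot> \<sigma> N' H = \<sigma> N H \<cdot> (i \<otimes> \<one> H)"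
    by (rule braiding_natural_arr[symmetric]) simp_all
  finally show ?thesis by (simp add: ract_def comp_assoc_arr)
qed

text \<open>The antipode reverses products, which is what turns a left action into a right one:
  \<open>S k \<rightharpoonup> (S h \<rightharpoonup> x) = (S k S h) \<rightharpoonup> x = S (h k)
  \<rightharpoonup> x\<close>.\<close>

lemma ract_assoc: "ract \<cdot> (ract \<otimes> \<one> H) = ract \<cdot> (\<one> N \<otimes> m)"
proof -
  let ?ws = "[(1, N), (2, H), (3, H)]" and ?zs = "[(4, N)]"
  have "eqv ?ws ?zs [bm 2 3 5, bS 5 6, ba 6 1 4] [bS 3 8, bS 2 7, bm 8 7 6, ba 6 1 4]"
    by (rule eqv_at[OF eqv_antipode_mult[of 2 3 5 6 7 8], of _ 0]) simp_all
  also have "eqv ?ws ?zs \<dots> [bS 2 7, ba 7 1 9, bS 3 8, ba 8 9 4]"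
    by (rule eqv_at[OF eqv_act_assoc[of 8 7 1 6 9 4], of _ 2]) simp_all
  finally have e: "eqv ?ws ?zs [bm 2 3 5, bS 5 6, ba 6 1 4] [bS 2 7, ba 7 1 9, bS 3 8, ba 8 9 4]" .
  have r: "denotes ract [(x, N), (h, H)] [(y, N)] [bS h s, ba s x y]" if "distinct [x, h, s, y]" for x h s y
    by (rule den_comp_eq[OF den_NH[of x h] den_comp[OF den_tensor[OF den_S[of h s] den_N[of x]] den_a[of s x y]]])
      (use that in \<open>auto simp: ract_def comp_assoc_arr\<close>)
  show ?thesis
    by (rule eqv_eq[OF eqv_sym[OF e] den_comp_eq[OF den_tensor[OF r[of 1 2 7 9] den_H[of 3]] r[of 9 3 8 4]]
        den_comp_eq[OF den_tensor[OF den_N[of 1] den_m[of 2 3 5]] r[of 1 5 6 4]]]) simp_all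
qed

lemma ract_unit: "ract \<cdot> (\<one> N \<otimes> \<eta>) = \<one> N"
proof -
  have "ract \<cdot> (\<one> N \<otimes> \<eta>) = act \<cdot> (S \<otimes> \<one> N) \<cdot> (\<sigma> N H \<cdot> (\<one> N \<otimes> \<eta>))"
    by (simp add: ract_def comp_assoc_arr)
  also have "\<sigma> N H \<cdot> (\<one> N \<otimes> \<eta>) = \<eta> \<otimes> \<one> N"
    using braiding_natural_arr[of "\<one> N" \<eta> N N \<I> H] by simp
  also have "(S \<otimes> \<one> N) \<cdot> (\<eta> \<otimes> \<one> N) = \<eta> \<otimes> \<one> N"
    by (simp add: interchange_arr antipode_unit)
  finally show ?thesis by (simp add: act_unit)
qed

lemma ract'_assoc: "ract' \<cdot> (ract' \<otimes> \<one> H) = ract' \<cdot> (\<one> N' \<otimes> m)"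
proof (rule incl_cancel)
  have "i \<cdot> ract' \<cdot> (ract' \<otimes> \<one> H) = (i \<cdot> ract') \<cdot> (ract' \<otimes> \<one> H)"
    by (simp add: comp_assoc_arr)
  also have "\<dots> = ract \<cdot> ((i \<cdot> ract') \<otimes> \<one> H)"
    by (simp add: incl_ract comp_assoc_arr interchange_arr)
  also have "\<dots> = (ract \<cdot> (ract \<otimes> \<one> H)) \<cdot> (i \<otimes> \<one> H \<otimes> \<one> H)"
    by (simp add: incl_ract comp_assoc_arr whisker_right_comp)
  also have "\<dots> = ract \<cdot> (i \<otimes> m)"
    by (simp add: ract_assoc comp_assoc_arr interchange_arr)
  also have "\<dots> = (i \<cdot> ract') \<cdot> (\<one> N' \<otimes> m)"
    by (simp add: incl_ract comp_assoc_arr interchange_arr)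
  finally show "i \<cdot> ract' \<cdot> (ract' \<otimes> \<one> H) = i \<cdot> ract' \<cdot> (\<one> N' \<otimes> m)"
    by (simp add: comp_assoc_arr)
qed simp_all

lemma ract'_unit: "ract' \<cdot> (\<one> N' \<otimes> \<eta>) = \<one> N'"
proof (rule incl_cancel)
  have "i \<cdot> ract' \<cdot> (\<one> N' \<otimes> \<eta>) = (i \<cdot> ract') \<cdot> (\<one> N' \<otimes> \<eta>)"
    by (simp add: comp_assoc_arr)
  also have "\<dots> = ract \<cdot> (i \<otimes> \<eta>)"
    by (simp add: incl_ract comp_assoc_arr interchange_arr)
  also have "i \<otimes> \<eta> = (\<one> N \<otimes> \<eta>) \<cdot> i"
    using interchange_arr[of i "\<one> N" "\<one> \<I>" \<eta>] by simp
  also have "ract \<cdot> (\<one> N \<otimes> \<eta>) \<cdot> i = (ract \<cdot> (\<one> N \<otimes> \<eta>)) \<cdot> i"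
    by (simp add: comp_assoc_arr)
  finally show "i \<cdot> ract' \<cdot> (\<one> N' \<otimes> \<eta>) = i \<cdot> \<one> N'"
    by (simp add: ract_unit)
qed simp_all

text \<open>In Sweedler notation \<open>y \<otimes> v \<otimes> k\<close> goes to
  \<open>v \<langle>y, k\<rangle>\<close>. For \<open>V = N'\<close> this is the evaluation that
  occurs in \<open>\<rho>_pairing\<close>.\<close>

definition pair where
  "pair V = (\<one> V \<otimes> p) \<cdot> (\<sigma> N V \<otimes> \<one> H)"

lemma pair_arr [simp]:
  assumes "V \<in> Obj C"
  shows "pair V \<in> Arr C" "src C (pair V) = N \<boxtimes> V \<boxtimes> H" "tgt C (pair V) = V"
  using assms by (simp_all add: pair_def)

lemma pair_natural:
  assumes "f \<in> Arr C" "src C f = V" "tgt C f = W"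
  shows "pair W \<cdot> (\<one> N \<otimes> f \<otimes> \<one> H) = f \<cdot> pair V"
proof -
  have obs: "V \<in> Obj C" "W \<in> Obj C" using assms by auto
  have "pair W \<cdot> (\<one> N \<otimes> f \<otimes> \<one> H) = (\<one> W \<otimes> p) \<cdot> ((\<sigma> N W \<cdot> (\<one> N \<otimes> f)) \<otimes> \<one> H)"
    using assms obs by (simp add: pair_def comp_assoc_arr whisker_right_comp)
  also have "\<sigma> N W \<cdot> (\<one> N \<otimes> f) = (f \<otimes> \<one> N) \<cdot> \<sigma> N V"
    by (rule braiding_natural_arr) (use assms obs in simp_all)
  also have "(\<one> W \<otimes> p) \<cdot> (((f \<otimes> \<one> N) \<cdot> \<sigma> N V) \<otimes> \<one> H)
    = ((\<one> W \<otimes> p) \<cdot> (f \<otimes> \<one> (N \<boxtimes> H))) \<cdot> (\<sigma> N V \<otimes> \<one> H)"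
    using assms obs by (simp add: comp_assoc_arr whisker_right_comp)
  also have "(\<one> W \<otimes> p) \<cdot> (f \<otimes> \<one> (N \<boxtimes> H)) = f \<otimes> p"
    using assms obs by (simp add: interchange_arr)
  also have "f \<otimes> p = f \<cdot> (\<one> V \<otimes> p)"
    using interchange_arr[of "\<one> V" f p "\<one> \<I>"] assms obs by simp
  finally show ?thesis using assms obs by (simp add: pair_def comp_assoc_arr)
qed

text \<open>\<open>faithful_right\<close> concerns targets \<open>H \<boxtimes> V\<close>, while a
  coaction has \<open>H\<close> on the right. The inverse \<open>s\<close> of
  \<open>\<sigma> H V\<close> moves it over, and \<open>pairing_slide_left\<close> matches the two
  pairings. Using \<open>\<sigma> V H\<close> instead of \<open>s\<close> would presuppose a
  symmetric braiding with \<open>V\<close>.\<close>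

lemma pair_faithful:
  assumes V: "V \<in> Obj C" and g: "g \<in> Arr C" "g' \<in> Arr C" "src C g = U" "src C g' = U"
      "tgt C g = V \<boxtimes> H" "tgt C g' = V \<boxtimes> H"
    and e: "pair V \<cdot> (\<one> N \<otimes> g) = pair V \<cdot> (\<one> N \<otimes> g')"
  shows "g = g'"
proof -
  obtain s where s: "s \<in> Arr C" "src C s = V \<boxtimes> H" "tgt C s = H \<boxtimes> V" "\<sigma> H V \<cdot> s = \<one> (V \<boxtimes> H)"
    by (rule braiding_inverse[of H V]) (use V in auto)
  have U: "U \<in> Obj C" using g by auto
  have "(p \<otimes> \<one> V) \<cdot> (\<one> N \<otimes> (s \<cdot> k)) = pair V \<cdot> (\<one> N \<otimes> k)"
    if k: "k \<in> Arr C" "src C k = U" "tgt C k = V \<boxtimes> H" for k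
  proof -
    have "(p \<otimes> \<one> V) \<cdot> (\<one> N \<otimes> (s \<cdot> k)) = pair V \<cdot> (\<one> N \<otimes> \<sigma> H V) \<cdot> (\<one> N \<otimes> (s \<cdot> k))"
      unfolding pairing_slide_left[OF V, symmetric] pair_def using V k s by (simp add: comp_assoc_arr)
    also have "(\<one> N \<otimes> \<sigma> H V) \<cdot> (\<one> N \<otimes> (s \<cdot> k)) = \<one> N \<otimes> ((\<sigma> H V \<cdot> s) \<cdot> k)"
      using V k s(1-3) by (simp add: interchange_arr comp_assoc_arr)
    finally show ?thesis using s V k by simp
  qed
  from this[of g] this[of g'] e g
  have eq: "(p \<otimes> \<one> V) \<cdot> (\<one> N \<otimes> (s \<cdot> g)) = (p \<otimes> \<one> V) \<cdot> (\<one> N \<otimes> (s \<cdot> g'))" by simp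
  have "s \<cdot> g = s \<cdot> g'"
    by (rule faithful_right[OF U V _ _ eq]) (use s V g in \<open>simp_all add: hom_iff\<close>)
  then have "\<sigma> H V \<cdot> s \<cdot> g = \<sigma> H V \<cdot> s \<cdot> g'" by simp
  moreover have "\<sigma> H V \<cdot> s \<cdot> k = k" if "k \<in> Arr C" "tgt C k = V \<boxtimes> H" for k
    using comp_reassoc[OF s(4), of k] s V that by simp
  ultimately show ?thesis using g by simp
qed

section \<open>The comodule structure on the ideal\<close>

lemma pair_coaction: "pair N' \<cdot> (\<one> N \<otimes> \<rho>) = m'"
  using \<rho>_pairing by (simp add: pair_def comp_assoc_arr)

lemma ideal_mult_assoc: "m' \<cdot> (mN \<otimes> \<one> N') = m' \<cdot> (\<one> N \<otimes> m')"
proof (rule incl_cancel)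
  have "i \<cdot> m' \<cdot> (mN \<otimes> \<one> N') = (i \<cdot> m') \<cdot> (mN \<otimes> \<one> N')"
    by (simp add: comp_assoc_arr)
  also have "\<dots> = mN \<cdot> (mN \<otimes> i)"
    by (simp add: N.ideal_mult comp_assoc_arr interchange_arr)
  also have "mN \<otimes> i = (mN \<otimes> \<one> N) \<cdot> (\<one> (N \<boxtimes> N) \<otimes> i)"
    by (simp add: interchange_arr)
  also have "mN \<cdot> (mN \<otimes> \<one> N) \<cdot> (\<one> (N \<boxtimes> N) \<otimes> i) = (mN \<cdot> (mN \<otimes> \<one> N)) \<cdot> (\<one> (N \<boxtimes> N) \<otimes> i)"
    by (simp add: comp_assoc_arr)
  also have "\<dots> = mN \<cdot> ((\<one> N \<otimes> mN) \<cdot> (\<one> N \<otimes> \<one> N \<otimes> i))"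
    by (simp add: N.m_assoc comp_assoc_arr flip: tensor_ident)
  also have "(\<one> N \<otimes> mN) \<cdot> (\<one> N \<otimes> \<one> N \<otimes> i) = \<one> N \<otimes> (i \<cdot> m')"
    by (simp add: whisker_left_comp N.ideal_mult flip: tensor_ident)
  also have "mN \<cdot> (\<one> N \<otimes> (i \<cdot> m')) = (mN \<cdot> (\<one> N \<otimes> i)) \<cdot> (\<one> N \<otimes> m')"
    by (simp add: whisker_left_comp comp_assoc_arr)
  finally show "i \<cdot> m' \<cdot> (mN \<otimes> \<one> N') = i \<cdot> m' \<cdot> (\<one> N \<otimes> m')"
    unfolding N.ideal_mult[symmetric] by (simp add: comp_assoc_arr)
qed simp_all

lemma ideal_mult_unit: "m' \<cdot> (\<eta>N \<otimes> \<one> N') = \<one> N'"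
proof (rule incl_cancel)
  have "i \<cdot> m' \<cdot> (\<eta>N \<otimes> \<one> N') = (i \<cdot> m') \<cdot> (\<eta>N \<otimes> \<one> N')"
    by (simp add: comp_assoc_arr)
  also have "\<dots> = mN \<cdot> (\<eta>N \<otimes> i)"
    by (simp add: N.ideal_mult comp_assoc_arr interchange_arr)
  also have "\<eta>N \<otimes> i = (\<eta>N \<otimes> \<one> N) \<cdot> i"
    using interchange_arr[of "\<one> \<I>" \<eta>N i "\<one> N"] by simp
  also have "mN \<cdot> (\<eta>N \<otimes> \<one> N) \<cdot> i = (mN \<cdot> (\<eta>N \<otimes> \<one> N)) \<cdot> i"
    by (simp add: comp_assoc_arr)
  finally show "i \<cdot> m' \<cdot> (\<eta>N \<otimes> \<one> N') = i \<cdot> \<one> N'"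
    by (simp add: N.unit_left)
qed simp_all

text \<open>This is \<open>pairing_mult\<close>, \<open>\<langle>x y, k\<rangle> = \<langle>x,
  k\<^sub>1\<rangle> \<langle>y, k\<^sub>2\<rangle>\<close>, with \<open>V\<close> between the
  elements paired. As \<open>V\<close> is an arbitrary object, later \<open>N'\<close>, programs do
  not apply and the crossings are resolved by hexagons and the exchange law.\<close>

lemma pair_pair:
  assumes V: "V \<in> Obj C"
  shows "pair V \<cdot> (\<one> N \<otimes> pair (V \<boxtimes> H)) \<cdot> (\<one> (N \<boxtimes> N \<boxtimes> V) \<otimes> \<Delta>) = pair V \<cdot> (mN \<otimes> \<one> (V \<boxtimes> H))"
proof -
  have braid: "\<sigma> (N \<boxtimes> N) V \<otimes> \<one> (H \<boxtimes> H)
    = (\<sigma> N V \<otimes> \<one> (N \<boxtimes> H \<boxtimes> H)) \<cdot> (\<one> N \<otimes> \<sigma> N V \<otimes> \<one> (H \<boxtimes> H))"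
    using V by (simp add: hexagon_left whisker_right_comp)
  have "pair V \<cdot> (\<one> N \<otimes> pair (V \<boxtimes> H)) \<cdot> (\<one> (N \<boxtimes> N \<boxtimes> V) \<otimes> \<Delta>)
    = (\<one> V \<otimes> p) \<cdot> ((\<sigma> N V \<otimes> \<one> H) \<cdot> (\<one> N \<otimes> \<one> (V \<boxtimes> H) \<otimes> p)) \<cdot> (\<one> N \<otimes> \<sigma> N (V \<boxtimes> H) \<otimes> \<one> H)
      \<cdot> (\<one> (N \<boxtimes> N \<boxtimes> V) \<otimes> \<Delta>)"
    using V by (simp add: pair_def whisker_left_comp comp_assoc_arr flip: tensor_ident)
  also have "(\<sigma> N V \<otimes> \<one> H) \<cdot> (\<one> N \<otimes> \<one> (V \<boxtimes> H) \<otimes> p)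
    = (\<one> (V \<boxtimes> N \<boxtimes> H) \<otimes> p) \<cdot> (\<sigma> N V \<otimes> \<one> (H \<boxtimes> N \<boxtimes> H))"
    using V whisker_swap[of "\<sigma> N V \<otimes> \<one> H" p, OF _ _ refl refl refl refl] by simp
  also have "\<sigma> N (V \<boxtimes> H) = (\<one> V \<otimes> \<sigma> N H) \<cdot> (\<sigma> N V \<otimes> \<one> H)"
    using V by (simp add: hexagon_right)
  also have "(\<one> V \<otimes> p) \<cdot> ((\<one> (V \<boxtimes> N \<boxtimes> H) \<otimes> p) \<cdot> (\<sigma> N V \<otimes> \<one> (H \<boxtimes> N \<boxtimes> H)))
      \<cdot> (\<one> N \<otimes> ((\<one> V \<otimes> \<sigma> N H) \<cdot> (\<sigma> N V \<otimes> \<one> H)) \<otimes> \<one> H) \<cdot> (\<one> (N \<boxtimes> N \<boxtimes> V) \<otimes> \<Delta>)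
    = ((\<one> V \<otimes> p) \<cdot> (\<one> (V \<boxtimes> N \<boxtimes> H) \<otimes> p)) \<cdot> ((\<sigma> N V \<otimes> \<one> (H \<boxtimes> N \<boxtimes> H)) \<cdot> (\<one> (N \<boxtimes> V) \<otimes> \<sigma> N H \<otimes> \<one> H))
      \<cdot> (\<one> N \<otimes> \<sigma> N V \<otimes> \<one> (H \<boxtimes> H)) \<cdot> (\<one> (N \<boxtimes> N \<boxtimes> V) \<otimes> \<Delta>)"
    using V by (simp add: whisker_left_comp whisker_right_comp comp_assoc_arr flip: tensor_ident)
  also have "(\<one> V \<otimes> p) \<cdot> (\<one> (V \<boxtimes> N \<boxtimes> H) \<otimes> p) = \<one> V \<otimes> p \<otimes> p"
  proof -
    have "p \<otimes> p = p \<cdot> (\<one> (N \<boxtimes> H) \<otimes> p)"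
      using interchange_arr[of "\<one> (N \<boxtimes> H)" p p "\<one> \<I>"] by simp
    then show ?thesis using V by (simp add: whisker_left_comp flip: tensor_ident)
  qed
  also have "(\<sigma> N V \<otimes> \<one> (H \<boxtimes> N \<boxtimes> H)) \<cdot> (\<one> (N \<boxtimes> V) \<otimes> \<sigma> N H \<otimes> \<one> H)
    = (\<one> (V \<boxtimes> N) \<otimes> \<sigma> N H \<otimes> \<one> H) \<cdot> (\<sigma> N V \<otimes> \<one> (N \<boxtimes> H \<boxtimes> H))"
    using V whisker_swap[of "\<sigma> N V" "\<sigma> N H \<otimes> \<one> H", OF _ _ refl refl refl refl] by simp
  also have "(\<one> V \<otimes> p \<otimes> p) \<cdot> ((\<one> (V \<boxtimes> N) \<otimes> \<sigma> N H \<otimes> \<one> H) \<cdot> (\<sigma> N V \<otimes> \<one> (N \<boxtimes> H \<boxtimes> H)))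
      \<cdot> (\<one> N \<otimes> \<sigma> N V \<otimes> \<one> (H \<boxtimes> H)) \<cdot> (\<one> (N \<boxtimes> N \<boxtimes> V) \<otimes> \<Delta>)
    = (\<one> V \<otimes> p \<otimes> p) \<cdot> (\<one> (V \<boxtimes> N) \<otimes> \<sigma> N H \<otimes> \<one> H)
      \<cdot> ((\<sigma> (N \<boxtimes> N) V \<otimes> \<one> (H \<boxtimes> H)) \<cdot> (\<one> (N \<boxtimes> N \<boxtimes> V) \<otimes> \<Delta>))"
    using V by (simp add: braid comp_assoc_arr)
  also have "(\<sigma> (N \<boxtimes> N) V \<otimes> \<one> (H \<boxtimes> H)) \<cdot> (\<one> (N \<boxtimes> N \<boxtimes> V) \<otimes> \<Delta>)
    = (\<one> (V \<boxtimes> N \<boxtimes> N) \<otimes> \<Delta>) \<cdot> (\<sigma> (N \<boxtimes> N) V \<otimes> \<one> H)"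
    using V whisker_swap[of "\<sigma> (N \<boxtimes> N) V" \<Delta>, OF _ _ refl refl refl refl] by simp
  also have "(\<one> V \<otimes> p \<otimes> p) \<cdot> (\<one> (V \<boxtimes> N) \<otimes> \<sigma> N H \<otimes> \<one> H) \<cdot> (\<one> (V \<boxtimes> N \<boxtimes> N) \<otimes> \<Delta>) \<cdot> (\<sigma> (N \<boxtimes> N) V \<otimes> \<one> H)
    = (\<one> V \<otimes> ((p \<otimes> p) \<cdot> (\<one> N \<otimes> \<sigma> N H \<otimes> \<one> H) \<cdot> (\<one> N \<otimes> \<one> N \<otimes> \<Delta>))) \<cdot> (\<sigma> (N \<boxtimes> N) V \<otimes> \<one> H)"
    using V by (simp add: whisker_left_comp comp_assoc_arr flip: tensor_ident)
  also have "\<dots> = (\<one> V \<otimes> p) \<cdot> ((\<one> V \<otimes> mN) \<cdot> \<sigma> (N \<boxtimes> N) V) \<otimes> \<one> H"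
    unfolding pairing_mult[symmetric] using V by (simp add: whisker_left_comp whisker_right_comp comp_assoc_arr)
  also have "(\<one> V \<otimes> mN) \<cdot> \<sigma> (N \<boxtimes> N) V = \<sigma> N V \<cdot> (mN \<otimes> \<one> V)"
    by (rule braiding_natural_arr[symmetric]) (use V in simp_all)
  finally show ?thesis using V by (simp add: pair_def whisker_right_comp comp_assoc_arr)
qed

text \<open>The target has two legs in \<open>H\<close>, so faithfulness is applied twice. Pairing
  off the last leg reduces the left side to \<open>\<rho> \<cdot> m'\<close>, and pairing once more
  to \<open>m' \<cdot> (\<one> N \<otimes> m')\<close>; on the right side the two pairings merge by
  \<open>pair_pair\<close> into one with the product in \<open>N\<close>.\<close>

lemma coaction_coassociative: "(\<rho> \<otimes> \<one> H) \<cdot> \<rho> = (\<one> N' \<otimes> \<Delta>) \<cdot> \<rho>"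
proof (rule pair_faithful[of "N' \<boxtimes> H" _ _ N'])
  have "pair (N' \<boxtimes> H) \<cdot> (\<one> N \<otimes> ((\<rho> \<otimes> \<one> H) \<cdot> \<rho>)) = (pair (N' \<boxtimes> H) \<cdot> (\<one> N \<otimes> \<rho> \<otimes> \<one> H)) \<cdot> (\<one> N \<otimes> \<rho>)"
    by (simp add: whisker_left_comp comp_assoc_arr)
  also have "pair (N' \<boxtimes> H) \<cdot> (\<one> N \<otimes> \<rho> \<otimes> \<one> H) = \<rho> \<cdot> pair N'"
    by (rule pair_natural) simp_all
  finally have l: "pair (N' \<boxtimes> H) \<cdot> (\<one> N \<otimes> ((\<rho> \<otimes> \<one> H) \<cdot> \<rho>)) = \<rho> \<cdot> m'"
    by (simp add: comp_assoc_arr pair_coaction)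
  show "pair (N' \<boxtimes> H) \<cdot> (\<one> N \<otimes> ((\<rho> \<otimes> \<one> H) \<cdot> \<rho>)) = pair (N' \<boxtimes> H) \<cdot> (\<one> N \<otimes> ((\<one> N' \<otimes> \<Delta>) \<cdot> \<rho>))"
    unfolding l
  proof (rule pair_faithful[of N' _ _ "N \<boxtimes> N'"])
    have "pair N' \<cdot> (\<one> N \<otimes> (\<rho> \<cdot> m')) = (pair N' \<cdot> (\<one> N \<otimes> \<rho>)) \<cdot> (\<one> N \<otimes> m')"
      by (simp add: whisker_left_comp comp_assoc_arr)
    also have "\<dots> = (pair N' \<cdot> (\<one> N \<otimes> \<rho>)) \<cdot> (mN \<otimes> \<one> N')"
      by (simp add: pair_coaction ideal_mult_assoc)
    also have "\<dots> = (pair N' \<cdot> (mN \<otimes> \<one> (N' \<boxtimes> H))) \<cdot> (\<one> (N \<boxtimes> N) \<otimes> \<rho>)"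
      by (simp add: comp_assoc_arr interchange_arr)
    also have "pair N' \<cdot> (mN \<otimes> \<one> (N' \<boxtimes> H))
      = pair N' \<cdot> (\<one> N \<otimes> pair (N' \<boxtimes> H)) \<cdot> (\<one> (N \<boxtimes> N \<boxtimes> N') \<otimes> \<Delta>)"
      by (rule pair_pair[symmetric]) simp
    also have "\<dots> \<cdot> (\<one> (N \<boxtimes> N) \<otimes> \<rho>)
      = pair N' \<cdot> (\<one> N \<otimes> (pair (N' \<boxtimes> H) \<cdot> (\<one> N \<otimes> ((\<one> N' \<otimes> \<Delta>) \<cdot> \<rho>))))"
      by (simp add: whisker_left_comp comp_assoc_arr flip: tensor_ident)
    finally show "pair N' \<cdot> (\<one> N \<otimes> (\<rho> \<cdot> m'))
      = pair N' \<cdot> (\<one> N \<otimes> (pair (N' \<boxtimes> H) \<cdot> (\<one> N \<otimes> ((\<one> N' \<otimes> \<Delta>) \<cdot> \<rho>))))" .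
  qed simp_all
qed simp_all

text \<open>By \<open>pairing_unit\<close> the counit is the pairing with the unit of
  \<open>N\<close>, so the claim becomes the unit law for multiplication on the ideal.\<close>

lemma coaction_counital: "(\<one> N' \<otimes> \<epsilon>) \<cdot> \<rho> = \<one> N'"
proof -
  have "\<one> N' \<otimes> \<epsilon> = (\<one> N' \<otimes> p) \<cdot> ((\<one> N' \<otimes> \<eta>N) \<otimes> \<one> H)"
    unfolding pairing_unit[symmetric] by (simp add: whisker_left_comp)
  also have "\<one> N' \<otimes> \<eta>N = \<sigma> N N' \<cdot> (\<eta>N \<otimes> \<one> N')"
    using braiding_natural_arr[of \<eta>N "\<one> N'" \<I> N N' N'] by simp
  finally have "\<one> N' \<otimes> \<epsilon> = pair N' \<cdot> (\<eta>N \<otimes> \<one> (N' \<boxtimes> H))"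
    by (simp add: pair_def whisker_right_comp comp_assoc_arr)
  then have "(\<one> N' \<otimes> \<epsilon>) \<cdot> \<rho> = pair N' \<cdot> ((\<eta>N \<otimes> \<one> (N' \<boxtimes> H)) \<cdot> \<rho>)"
    by (simp add: comp_assoc_arr)
  also have "(\<eta>N \<otimes> \<one> (N' \<boxtimes> H)) \<cdot> \<rho> = (\<one> N \<otimes> \<rho>) \<cdot> (\<eta>N \<otimes> \<one> N')"
    using interchange_arr[of "\<one> \<I>" \<eta>N \<rho> "\<one> (N' \<boxtimes> H)"] by (simp add: interchange_arr)
  also have "pair N' \<cdot> (\<one> N \<otimes> \<rho>) \<cdot> (\<eta>N \<otimes> \<one> N') = (pair N' \<cdot> (\<one> N \<otimes> \<rho>)) \<cdot> (\<eta>N \<otimes> \<one> N')"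
    by (simp add: comp_assoc_arr)
  finally show ?thesis by (simp add: pair_coaction ideal_mult_unit)
qed

section \<open>Compatibility of action and coaction\<close>

text \<open>In Sweedler notation \<open>transfer X f\<close> maps \<open>y \<otimes> x \<otimes> h\<close> to \<open>S h\<^sub>1 \<rightharpoonup> f (h\<^sub>2 \<rightharpoonup> y, x)\<close>. It equals both
  sides of the Hopf module condition, for \<open>f\<close> the product and for \<open>f\<close> the pairing with the coaction.\<close>

definition transfer where
  "transfer X f = act \<cdot> (S \<otimes> \<one> N) \<cdot> (\<one> H \<otimes> f) \<cdot> (\<one> H \<otimes> act \<otimes> \<one> X) \<cdot> (\<Delta> \<otimes> \<one> (N \<boxtimes> X)) \<cdot> \<sigma> (N \<boxtimes> X) H"

text \<open>The two identities for \<open>transfer\<close> that follow are obtained from programs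
  and thus only for \<open>X\<close> built from \<open>H\<close> and \<open>N\<close>. Naturality in
  \<open>X\<close> transports them to \<open>N'\<close>.\<close>

lemma transfer_natural:
  assumes f: "f \<in> Arr C" "src C f = N \<boxtimes> X" "tgt C f = N" and X: "X \<in> Obj C"
    and g: "g \<in> Arr C" "src C g = Y" "tgt C g = X"
  shows "transfer Y (f \<cdot> (\<one> N \<otimes> g)) = transfer X f \<cdot> (\<one> N \<otimes> g \<otimes> \<one> H)"
proof -
  have Y: "Y \<in> Obj C" using g by auto
  have "transfer X f \<cdot> (\<one> N \<otimes> g \<otimes> \<one> H) = act \<cdot> (S \<otimes> \<one> N) \<cdot> (\<one> H \<otimes> f) \<cdot> (\<one> H \<otimes> act \<otimes> \<one> X)
      \<cdot> (\<Delta> \<otimes> \<one> (N \<boxtimes> X)) \<cdot> (\<sigma> (N \<boxtimes> X) H \<cdot> ((\<one> N \<otimes> g) \<otimes> \<one> H))"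
    using f g X Y by (simp add: transfer_def comp_assoc_arr)
  also have "\<sigma> (N \<boxtimes> X) H \<cdot> ((\<one> N \<otimes> g) \<otimes> \<one> H) = (\<one> H \<otimes> (\<one> N \<otimes> g)) \<cdot> \<sigma> (N \<boxtimes> Y) H"
    by (rule braiding_natural_arr) (use g X Y in simp_all)
  also have "act \<cdot> (S \<otimes> \<one> N) \<cdot> (\<one> H \<otimes> f) \<cdot> (\<one> H \<otimes> act \<otimes> \<one> X)
      \<cdot> (\<Delta> \<otimes> \<one> (N \<boxtimes> X)) \<cdot> ((\<one> H \<otimes> (\<one> N \<otimes> g)) \<cdot> \<sigma> (N \<boxtimes> Y) H)
    = act \<cdot> (S \<otimes> \<one> N) \<cdot> (\<one> H \<otimes> f) \<cdot> (\<one> H \<otimes> act \<otimes> \<one> X)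
      \<cdot> ((\<Delta> \<otimes> \<one> (N \<boxtimes> X)) \<cdot> (\<one> H \<otimes> (\<one> N \<otimes> g))) \<cdot> \<sigma> (N \<boxtimes> Y) H"
    using f g X Y by (simp add: comp_assoc_arr)
  also have "(\<Delta> \<otimes> \<one> (N \<boxtimes> X)) \<cdot> (\<one> H \<otimes> (\<one> N \<otimes> g)) = (\<one> (H \<boxtimes> H) \<otimes> (\<one> N \<otimes> g)) \<cdot> (\<Delta> \<otimes> \<one> (N \<boxtimes> Y))"
    using g X Y by (intro whisker_swap) simp_all
  also have "act \<cdot> (S \<otimes> \<one> N) \<cdot> (\<one> H \<otimes> f) \<cdot> (\<one> H \<otimes> act \<otimes> \<one> X)
      \<cdot> ((\<one> (H \<boxtimes> H) \<otimes> (\<one> N \<otimes> g)) \<cdot> (\<Delta> \<otimes> \<one> (N \<boxtimes> Y))) \<cdot> \<sigma> (N \<boxtimes> Y) H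
    = act \<cdot> (S \<otimes> \<one> N) \<cdot> (\<one> H \<otimes> f) \<cdot> ((\<one> H \<otimes> act \<otimes> \<one> X)
      \<cdot> (\<one> (H \<boxtimes> H) \<otimes> (\<one> N \<otimes> g))) \<cdot> (\<Delta> \<otimes> \<one> (N \<boxtimes> Y)) \<cdot> \<sigma> (N \<boxtimes> Y) H"
    using f g X Y by (simp add: comp_assoc_arr)
  also have "(\<one> H \<otimes> act \<otimes> \<one> X) \<cdot> (\<one> (H \<boxtimes> H) \<otimes> (\<one> N \<otimes> g))
    = (\<one> H \<otimes> \<one> N \<otimes> g) \<cdot> (\<one> H \<otimes> act \<otimes> \<one> Y)"
  proof -
    have "(act \<otimes> \<one> X) \<cdot> (\<one> (H \<boxtimes> N) \<otimes> g) = (\<one> N \<otimes> g) \<cdot> (act \<otimes> \<one> Y)"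
      using g X Y by (intro whisker_swap) simp_all
    from arg_cong[OF this, of "\<lambda>k. \<one> H \<otimes> k"] show ?thesis
      using g X Y by (simp add: whisker_left_comp flip: tensor_ident)
  qed
  also have "act \<cdot> (S \<otimes> \<one> N) \<cdot> (\<one> H \<otimes> f) \<cdot> ((\<one> H \<otimes> \<one> N \<otimes> g) \<cdot> (\<one> H \<otimes> act \<otimes> \<one> Y))
      \<cdot> (\<Delta> \<otimes> \<one> (N \<boxtimes> Y)) \<cdot> \<sigma> (N \<boxtimes> Y) H = transfer Y (f \<cdot> (\<one> N \<otimes> g))"
    using f g X Y by (simp add: transfer_def comp_assoc_arr whisker_left_comp flip: tensor_ident)
  finally show ?thesis by simp
qed

text \<open>This is \<open>eqv_mult_act_antipode\<close> preceded by the crossing that brings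
  \<open>h\<close> to the front; the hexagon leaves a double crossing of \<open>N\<close> and
  \<open>H\<close>, which \<open>braiding_NH\<close> removes.\<close>

lemma transfer_mult: "transfer N mN = mN \<cdot> (\<one> N \<otimes> ract)"
proof -
  have e: "mN \<cdot> (\<one> N \<otimes> act) \<cdot> (\<one> N \<otimes> S \<otimes> \<one> N) \<cdot> (\<sigma> H N \<otimes> \<one> N)
    = act \<cdot> (S \<otimes> \<one> N) \<cdot> (\<one> H \<otimes> mN) \<cdot> (\<one> H \<otimes> act \<otimes> \<one> N) \<cdot> (\<Delta> \<otimes> \<one> (N \<boxtimes> N))"
    by (rule eqv_eq[OF eqv_mult_act_antipode
          den_comp_eq[OF den_tensor[OF den_HN[of 1 2] den_N[of 3]]
            den_comp[OF den_tensor[OF den_N[of 2] den_tensor[OF den_S[of 1 10] den_N[of 3]]]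
              den_comp[OF den_tensor[OF den_N[of 2] den_a[of 10 3 11]] den_mN[of 2 11 4]]]]
          den_comp_eq[OF den_tensor[OF den_D[of 1 5 6] den_tensor[OF den_N[of 2] den_N[of 3]]]
            den_comp[OF den_tensor[OF den_H[of 5] den_tensor[OF den_a[of 6 2 16] den_N[of 3]]]
              den_comp[OF den_tensor[OF den_H[of 5] den_mN[of 16 3 13]]
                den_comp[OF den_tensor[OF den_S[of 5 9] den_N[of 13]] den_a[of 9 13 4]]]]]])
      (simp_all add: comp_assoc_arr)
  have "transfer N mN = (act \<cdot> (S \<otimes> \<one> N) \<cdot> (\<one> H \<otimes> mN) \<cdot> (\<one> H \<otimes> act \<otimes> \<one> N) \<cdot> (\<Delta> \<otimes> \<one> (N \<boxtimes> N))) \<cdot> \<sigma> (N \<boxtimes> N) H"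
    by (simp add: transfer_def comp_assoc_arr)
  also have "\<dots> = mN \<cdot> (\<one> N \<otimes> act) \<cdot> (\<one> N \<otimes> S \<otimes> \<one> N) \<cdot> ((\<sigma> H N \<cdot> \<sigma> N H) \<otimes> \<one> N) \<cdot> (\<one> N \<otimes> \<sigma> N H)"
    unfolding e[symmetric] by (simp add: hexagon_left comp_assoc_arr whisker_right_comp)
  also have "\<dots> = mN \<cdot> (\<one> N \<otimes> ract)"
    by (simp add: braiding_NH ract_def whisker_left_comp comp_assoc_arr)
  finally show ?thesis .
qed

text \<open>The tensor product of the right modules \<open>N\<close> and \<open>H\<close>, the
  latter acting on itself by multiplication. The Hopf module condition says that a coaction is
  linear into such a product.\<close>

definition diagonal_ract where
  "diagonal_ract = (ract \<otimes> m) \<cdot> (\<one> N \<otimes> \<sigma> H H \<otimes> \<one> H) \<cdot> (\<one> (N \<boxtimes> H) \<otimes> \<Delta>)"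

lemma diagonal_ract_arr [simp]:
  "diagonal_ract \<in> Arr C" "src C diagonal_ract = N \<boxtimes> H \<boxtimes> H" "tgt C diagonal_ract = N \<boxtimes> H"
  by (simp_all add: diagonal_ract_def)

text \<open>A single use of the definition of the action, \<open>\<langle>h\<^sub>2
  \<rightharpoonup> y, k\<rangle> = \<langle>y, k h\<^sub>2\<rangle>\<close>.\<close>

lemma transfer_pair: "transfer (N \<boxtimes> H) (pair N) = pair N \<cdot> (\<one> N \<otimes> diagonal_ract)"
proof -
  let ?ws = "[(1, N), (2, N), (3, H), (4, H)]" and ?zs = "[(5, N)]"
  have e: "eqv ?ws ?zs [bD 4 6 7, bS 6 9, ba 9 2 5, bm 3 7 8, bp 1 8] [bD 4 6 7, ba 7 1 10, bp 10 3, bS 6 9, ba 9 2 5]"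
    by (rule eqv_at[OF eqv_sym[OF eqv_act_pairing[of 7 1 3 10 8]], of _ 3]) simp_all
  have r: "denotes ract [(2, N), (6, H)] [(5, N)] [bS 6 9, ba 9 2 5]"
    by (rule den_comp_eq[OF den_NH[of 2 6] den_comp[OF den_tensor[OF den_S[of 6 9] den_N[of 2]] den_a[of 9 2 5]]])
      (simp_all add: ract_def comp_assoc_arr)
  have d: "denotes diagonal_ract [(2, N), (3, H), (4, H)] [(5, N), (8, H)] [bD 4 6 7, bS 6 9, ba 9 2 5, bm 3 7 8]"
    by (rule den_comp_eq[OF den_tensor[OF den_tensor[OF den_N[of 2] den_H[of 3]] den_D[of 4 6 7]]
          den_comp[OF den_tensor[OF den_tensor[OF den_N[of 2] den_HH[of 3 6]] den_H[of 7]]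
            den_tensor[OF r den_m[of 3 7 8]]]])
      (simp_all add: diagonal_ract_def comp_assoc_arr)
  have NN: "denotes (\<sigma> N N) [(x, N), (y, N)] [(y, N), (x, N)] []" if "x \<noteq> y" for x y
    using denotes_braiding[of "[(x, N)]" "[(y, N)]"] that by simp
  have P: "denotes (pair N) [(x, N), (y, N), (k, H)] [(y, N)] [bp x k]" if "distinct [x, y, k]" for x y k
    by (rule den_comp_eq[OF den_tensor[OF NN[of x y] den_H[of k]] den_tensor[OF den_N[of y] den_p[of x k]]])
      (use that in \<open>auto simp: pair_def\<close>)
  show ?thesis
    by (rule eqv_eq[OF eqv_sym[OF e]
          den_comp_eq[OF denotes_braiding[of "[(1, N), (2, N), (3, H)]" "[(4, H)]"]
            den_comp[OF den_tensor[OF den_D[of 4 6 7] den_tensor[OF den_N[of 1] den_tensor[OF den_N[of 2] den_H[of 3]]]]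
              den_comp[OF den_tensor[OF den_H[of 6] den_tensor[OF den_a[of 7 1 10] den_tensor[OF den_N[of 2] den_H[of 3]]]]
                den_comp[OF den_tensor[OF den_H[of 6] P[of 10 2 3]]
                  den_comp[OF den_tensor[OF den_S[of 6 9] den_N[of 2]] den_a[of 9 2 5]]]]]]
          den_comp_eq[OF den_tensor[OF den_N[of 1] d] P[of 1 5 8]]])
      (simp_all add: transfer_def comp_assoc_arr)
qed

text \<open>Paired with \<open>y\<close> and included into \<open>N\<close>, the left side is
  \<open>transfer\<close> of the product and the right side is \<open>transfer\<close> of the
  pairing with the coaction; \<open>\<rho>_pairing\<close> identifies the two arguments of
  \<open>transfer\<close>.\<close>

lemma coaction_ract':
  "\<rho> \<cdot> ract' = (ract' \<otimes> m) \<cdot> (\<one> N' \<otimes> \<sigma> H H \<otimes> \<one> H) \<cdot> (\<rho> \<otimes> \<Delta>)" (is "_ = ?R")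
proof (rule pair_faithful[of N' _ _ "N' \<boxtimes> H"])
  \<comment> \<open>The coaction with its first leg included into \<open>N\<close>, so that its
    target \<open>N \<boxtimes> H\<close> is within the scope of
    \<open>transfer_pair\<close>.\<close>
  define r where "r = (i \<otimes> \<one> H) \<cdot> \<rho>"
  have r: "r \<in> Arr C" "src C r = N'" "tgt C r = N \<boxtimes> H" by (simp_all add: r_def)
  have R: "?R \<in> Arr C" "src C ?R = N' \<boxtimes> H" "tgt C ?R = N' \<boxtimes> H" by simp_all
  have ipair: "i \<cdot> pair N' \<cdot> (\<one> N \<otimes> k) = pair N \<cdot> (\<one> N \<otimes> ((i \<otimes> \<one> H) \<cdot> k))"
    if "k \<in> Arr C" "tgt C k = N' \<boxtimes> H" for k
  proof -
    have "i \<cdot> pair N' \<cdot> (\<one> N \<otimes> k) = (i \<cdot> pair N') \<cdot> (\<one> N \<otimes> k)"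
      using that by (simp add: comp_assoc_arr)
    also have "i \<cdot> pair N' = pair N \<cdot> (\<one> N \<otimes> i \<otimes> \<one> H)"
      by (rule pair_natural[symmetric]) simp_all
    finally show ?thesis using that by (simp add: comp_assoc_arr whisker_left_comp)
  qed
  have "mN \<cdot> (\<one> N \<otimes> i) = i \<cdot> pair N' \<cdot> (\<one> N \<otimes> \<rho>)"
    by (simp add: pair_coaction N.ideal_mult)
  also have "\<dots> = pair N \<cdot> (\<one> N \<otimes> r)"
    unfolding r_def by (rule ipair) simp_all
  finally have key: "mN \<cdot> (\<one> N \<otimes> i) = pair N \<cdot> (\<one> N \<otimes> r)" .
  have "i \<cdot> pair N' \<cdot> (\<one> N \<otimes> (\<rho> \<cdot> ract')) = i \<cdot> (pair N' \<cdot> (\<one> N \<otimes> \<rho>)) \<cdot> (\<one> N \<otimes> ract')"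
    by (simp add: comp_assoc_arr whisker_left_comp)
  also have "\<dots> = (i \<cdot> m') \<cdot> (\<one> N \<otimes> ract')"
    by (simp add: pair_coaction comp_assoc_arr)
  also have "\<dots> = mN \<cdot> (\<one> N \<otimes> (i \<cdot> ract'))"
    by (simp add: N.ideal_mult comp_assoc_arr whisker_left_comp)
  also have "\<dots> = (mN \<cdot> (\<one> N \<otimes> ract)) \<cdot> (\<one> N \<otimes> i \<otimes> \<one> H)"
    by (simp add: incl_ract comp_assoc_arr whisker_left_comp)
  also have "\<dots> = transfer N' (mN \<cdot> (\<one> N \<otimes> i))"
    unfolding transfer_mult[symmetric] by (rule transfer_natural[symmetric]) simp_all
  \<comment> \<open>Here the chain passes from the action side to the coaction side:
    \<open>key\<close> replaces the product by the pairing inside \<open>transfer\<close>, and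
    naturality then takes \<open>r\<close> out.\<close>
  also have "\<dots> = transfer (N \<boxtimes> H) (pair N) \<cdot> (\<one> N \<otimes> r \<otimes> \<one> H)"
    unfolding key by (rule transfer_natural) (simp_all add: r)
  also have "\<dots> = pair N \<cdot> (\<one> N \<otimes> (diagonal_ract \<cdot> (r \<otimes> \<one> H)))"
    using r by (simp add: transfer_pair comp_assoc_arr whisker_left_comp)
  also have "diagonal_ract \<cdot> (r \<otimes> \<one> H) = (i \<otimes> \<one> H) \<cdot> ?R"
  proof -
    have "diagonal_ract \<cdot> (r \<otimes> \<one> H)
      = (ract \<otimes> m) \<cdot> (\<one> N \<otimes> \<sigma> H H \<otimes> \<one> H) \<cdot> ((\<one> (N \<boxtimes> H) \<otimes> \<Delta>) \<cdot> (r \<otimes> \<one> H))"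
      using r by (simp add: diagonal_ract_def comp_assoc_arr)
    also have "(\<one> (N \<boxtimes> H) \<otimes> \<Delta>) \<cdot> (r \<otimes> \<one> H) = r \<otimes> \<Delta>"
      using r by (simp add: interchange_arr)
    also have "r \<otimes> \<Delta> = (i \<otimes> \<one> (H \<boxtimes> H \<boxtimes> H)) \<cdot> (\<rho> \<otimes> \<Delta>)"
      using interchange_arr[of \<rho> "i \<otimes> \<one> H" \<Delta> "\<one> (H \<boxtimes> H)"] by (simp add: r_def)
    also have "(ract \<otimes> m) \<cdot> (\<one> N \<otimes> \<sigma> H H \<otimes> \<one> H) \<cdot> (i \<otimes> \<one> (H \<boxtimes> H \<boxtimes> H)) \<cdot> (\<rho> \<otimes> \<Delta>)
      = (ract \<otimes> m) \<cdot> ((\<one> N \<otimes> \<sigma> H H \<otimes> \<one> H) \<cdot> (i \<otimes> \<one> (H \<boxtimes> H \<boxtimes> H))) \<cdot> (\<rho> \<otimes> \<Delta>)"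
      by (simp add: comp_assoc_arr)
    also have "(\<one> N \<otimes> \<sigma> H H \<otimes> \<one> H) \<cdot> (i \<otimes> \<one> (H \<boxtimes> H \<boxtimes> H))
      = (i \<otimes> \<one> (H \<boxtimes> H \<boxtimes> H)) \<cdot> (\<one> N' \<otimes> \<sigma> H H \<otimes> \<one> H)"
      using whisker_swap[of i "\<sigma> H H \<otimes> \<one> H", OF _ _ refl refl refl refl] by simp
    also have "(ract \<otimes> m) \<cdot> ((i \<otimes> \<one> (H \<boxtimes> H \<boxtimes> H)) \<cdot> (\<one> N' \<otimes> \<sigma> H H \<otimes> \<one> H)) \<cdot> (\<rho> \<otimes> \<Delta>)
      = ((ract \<otimes> m) \<cdot> (i \<otimes> \<one> (H \<boxtimes> H \<boxtimes> H))) \<cdot> (\<one> N' \<otimes> \<sigma> H H \<otimes> \<one> H) \<cdot> (\<rho> \<otimes> \<Delta>)"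
      by (simp add: comp_assoc_arr)
    also have "(ract \<otimes> m) \<cdot> (i \<otimes> \<one> (H \<boxtimes> H \<boxtimes> H)) = (i \<cdot> ract') \<otimes> m"
      using interchange_arr[of "i \<otimes> \<one> H" ract "\<one> (H \<boxtimes> H)" m] by (simp add: incl_ract)
    also have "(i \<cdot> ract') \<otimes> m = (i \<otimes> \<one> H) \<cdot> (ract' \<otimes> m)"
      by (simp add: interchange_arr)
    finally show ?thesis by (simp add: comp_assoc_arr)
  qed
  also have "pair N \<cdot> (\<one> N \<otimes> ((i \<otimes> \<one> H) \<cdot> ?R)) = i \<cdot> pair N' \<cdot> (\<one> N \<otimes> ?R)"
    by (rule ipair[symmetric]) simp_all
  finally have "i \<cdot> pair N' \<cdot> (\<one> N \<otimes> (\<rho> \<cdot> ract')) = i \<cdot> pair N' \<cdot> (\<one> N \<otimes> ?R)" .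
  then show "pair N' \<cdot> (\<one> N \<otimes> (\<rho> \<cdot> ract')) = pair N' \<cdot> (\<one> N \<otimes> ?R)"
    by (rule incl_cancel[rotated 5]) simp_all
qed simp_all

lemma hopf_module: "hopf_module C H m \<eta> \<Delta> \<epsilon> S N' ract' \<rho>"
  by unfold_locales
    (simp_all add: hom_iff ract'_assoc ract'_unit coaction_coassociative coaction_counital coaction_ract')

end

theorem theorem1p4:
  fixes C :: "('o, 'a, 'x) braided_category_scheme" (structure)
    and H N N' :: 'o
    and m \<eta> \<Delta> \<epsilon> S mN \<eta>N p i m' act act' \<rho> :: 'a
  assumes "strict_braided_category C"
    and "braided_hopf_algebra C H m \<eta> \<Delta> \<epsilon> S"
    and "inverse_arrows C (\<sigma> H H) (\<sigma> H H)"
    and "faithful_quasi_dual C H m \<eta> \<Delta> \<epsilon> S N mN \<eta>N p"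
    and "strict_quasi_dual C H m \<eta> \<Delta> \<epsilon> S N mN \<eta>N p N' i m' act act' \<rho>"
  shows "hopf_module C H m \<eta> \<Delta> \<epsilon> S N' (act' \<cdot> (S \<otimes> \<one> N') \<cdot> \<sigma> N' H) \<rho>"
proof -
  interpret strict_quasi_dual C H m \<eta> \<Delta> \<epsilon> S N mN \<eta>N p N' i m' act act' \<rho> by (fact assms(5))
  interpret symmetric_quasi_dual C H m \<eta> \<Delta> \<epsilon> S N mN \<eta>N p N' i m' act act' \<rho>
    by unfold_locales (use assms(3) in \<open>simp add: inverse_arrows_def\<close>)
  show ?thesis using hopf_module unfolding ract'_def .
qed

end
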